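(* Let $m\geq2$ and let $T:\mathcal{D}(\mathbb{R}^m)\to\mathbb{R}$ be a linear functional. There exists $v\in C_0(\mathbb{R}^m;\mathbb{R}^m)$ such that $T=\mathbf{div}\,v$ in the sense of distributions if and only if $T$ satisfies the following equivalent conditions: (b) for every $\varepsilon>0$ there exists $f\in L_m(\mathbb{R}^m)$ such that for every $\varphi\in\mathcal{D}(\mathbb{R}^m)$, $|\langle\varphi,T\rangle|\leq\left|\int_{\mathbb{R}^m}\varphi f\,d\mathcal{L}^m\right|+\varepsilon\|\nabla\varphi\|_{L_1(\mathbb{R}^m)}$; (c) for every $\varepsilon>0$ there are a finite set $E$ of functions $f\in L_m(\mathbb{R}^m)$ with $\|f\|_{L_m}=1$ and $\theta>0$ such that for every $\varphi\in\mathcal{D}(\mathbb{R}^m)$, $|\langle\varphi,T\rangle|\leq\theta\max\left\{\left|\int_{\mathbb{R}^m}\varphi f\,d\mathcal{L}^m\right|:f\in E\right\}+\varepsilon\|\nabla\varphi\|_{L_1(\mathbb{R}^m)}$; (d) for every sequence $(\varphi_j)_j$ in $\mathcal{D}(\mathbb{R}^m)$ such that $\lim_j\int_{\mathbb{R}^m}\varphi_jf\,d\mathcal{L}^m=0$ for all $f\in L_m(\mathbb{R}^m)$ and $\sup_j\|\nabla\varphi_j\|_{L_1(\mathbb{R}^m)}<\infty$, we have $\lim_j\langle\varphi_j,T\rangle=0$.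
   Context: $\mathcal{D}(\mathbb{R}^m)=C_c^\infty(\mathbb{R}^m)$; $\mathcal{L}^m$ is Lebesgue measure; $C_0(\mathbb{R}^m;\mathbb{R}^m)$ is the space of continuous vector fields vanishing at infinity; the distributional divergence is $\langle\varphi,\mathbf{div}\,v\rangle=-\int_{\mathbb{R}^m}\nabla\varphi\cdot v\,d\mathcal{L}^m$. *)

theory Defs
  imports "HOL-Analysis.Analysis"
begin

definition partial :: "'m \<Rightarrow> (real^'m \<Rightarrow> real) \<Rightarrow> real^'m \<Rightarrow> real" where
  "partial i f x = frechet_derivative f (at x) (axis i 1)"

definition grad :: "(real^'m \<Rightarrow> real) \<Rightarrow> real^'m \<Rightarrow> real^'m" where
  "grad f x = (\<chi> i. partial i f x)"

primrec Ck :: "nat \<Rightarrow> (real^'m \<Rightarrow> real) \<Rightarrow> bool" where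
  "Ck 0 f \<longleftrightarrow> continuous_on UNIV f"
| "Ck (Suc k) f \<longleftrightarrow> (\<forall>x. f differentiable (at x)) \<and> (\<forall>i. Ck k (partial i f))"

definition test_functions :: "(real^'m \<Rightarrow> real) set" where
  "test_functions = {\<phi>. (\<forall>k. Ck k \<phi>) \<and> compact (closure {x. \<phi> x \<noteq> 0})}"

text \<open>A functional on the space of test functions is represented by a function on all of
  \<^typ>\<open>real^'m \<Rightarrow> real\<close>; its values outside \<^const>\<open>test_functions\<close> are irrelevant.\<close>

definition linear_functional :: "((real^'m \<Rightarrow> real) \<Rightarrow> real) \<Rightarrow> bool" where
  "linear_functional T \<longleftrightarrow>
     (\<forall>\<phi>\<in>test_functions. \<forall>\<psi>\<in>test_functions. T (\<lambda>x. \<phi> x + \<psi> x) = T \<phi> + T \<psi>) \<and>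
     (\<forall>c. \<forall>\<phi>\<in>test_functions. T (\<lambda>x. c * \<phi> x) = c * T \<phi>)"

definition C0_fields :: "(real^'m \<Rightarrow> real^'m) set" where
  "C0_fields = {v. continuous_on UNIV v \<and> (v \<longlongrightarrow> 0) at_infinity}"

text \<open>Elements of \<open>L\<^sub>p\<close> are represented by functions rather than by almost-everywhere classes.\<close>

definition Lspace :: "real \<Rightarrow> (real^'m \<Rightarrow> real) set" where
  "Lspace p = {f. f \<in> borel_measurable lebesgue \<and> integrable lebesgue (\<lambda>x. \<bar>f x\<bar> powr p)}"

definition Lnorm :: "real \<Rightarrow> (real^'m \<Rightarrow> 'b::real_normed_vector) \<Rightarrow> real" where
  "Lnorm p f = (LINT x|lebesgue. norm (f x) powr p) powr (1 / p)"

text \<open>The pairing of a test function with the distributional divergence of a vector field.\<close>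

definition distr_div :: "(real^'m \<Rightarrow> real^'m) \<Rightarrow> (real^'m \<Rightarrow> real) \<Rightarrow> real" where
  "distr_div v \<phi> = - (LINT x|lebesgue. grad \<phi> x \<bullet> v x)"

definition is_C0_divergence :: "((real^'m \<Rightarrow> real) \<Rightarrow> real) \<Rightarrow> bool" where
  "is_C0_divergence T \<longleftrightarrow> (\<exists>v\<in>C0_fields. \<forall>\<phi>\<in>test_functions. T \<phi> = distr_div v \<phi>)"

definition single_function_bound :: "((real^'m \<Rightarrow> real) \<Rightarrow> real) \<Rightarrow> bool" where
  "single_function_bound T \<longleftrightarrow>
     (\<forall>\<epsilon>>0. \<exists>f\<in>Lspace CARD('m). \<forall>\<phi>\<in>test_functions.
        \<bar>T \<phi>\<bar> \<le> \<bar>LINT x|lebesgue. \<phi> x * f x\<bar> + \<epsilon> * Lnorm 1 (grad \<phi>))"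

text \<open>The set \<open>E\<close> is required to be nonempty because \<^term>\<open>Max {}\<close> is unspecified; enlarging \<open>E\<close> only
  weakens the bound, so this is no restriction.\<close>

definition finite_family_bound :: "((real^'m \<Rightarrow> real) \<Rightarrow> real) \<Rightarrow> bool" where
  "finite_family_bound T \<longleftrightarrow>
     (\<forall>\<epsilon>>0. \<exists>E \<theta>. finite E \<and> E \<noteq> {} \<and> E \<subseteq> {f \<in> Lspace CARD('m). Lnorm CARD('m) f = 1} \<and>
        \<theta> > 0 \<and>
        (\<forall>\<phi>\<in>test_functions.
           \<bar>T \<phi>\<bar> \<le> \<theta> * Max ((\<lambda>f. \<bar>LINT x|lebesgue. \<phi> x * f x\<bar>) ` E) + \<epsilon> * Lnorm 1 (grad \<phi>)))"

definition sequentially_continuous :: "((real^'m \<Rightarrow> real) \<Rightarrow> real) \<Rightarrow> bool" where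
  "sequentially_continuous T \<longleftrightarrow>
     (\<forall>\<phi> :: nat \<Rightarrow> real^'m \<Rightarrow> real.
        (\<forall>j. \<phi> j \<in> test_functions) \<longrightarrow>
        (\<forall>f\<in>Lspace CARD('m). (\<lambda>j. LINT x|lebesgue. \<phi> j x * f x) \<longlonglongrightarrow> 0) \<longrightarrow>
        bdd_above (range (\<lambda>j. Lnorm 1 (grad (\<phi> j)))) \<longrightarrow>
        (\<lambda>j. T (\<phi> j)) \<longlonglongrightarrow> 0)"

end

(* The heart is that every T approximated, in the norm dual to |grad phi|_1, by functions in L_m is the
   divergence of a field in C_0.

   By the Sobolev inequality |phi|_{m/(m-1)} <= |grad phi|_1, L_m embeds into that dual space, so T may be
   approximated by f in C_c. If |int phi f| <= C |grad phi|_1, the Hahn-Banach theorem extends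
   grad phi |-> - int phi f to a functional of norm C on all fields; mollifying it gives a continuous
   field u with |u| <= C and div u = kappa * f. Multiplying u by a smooth function that decays slowly
   enough produces a field in C_0, and changes the divergence only by a small element of L_m because
   infinity has zero m-capacity for m >= 2. Hence T - div v is again approximable, with a norm as small as
   we like, while |v| <= 2 C; summing a geometric series of such corrections gives T = div v.

   Conversely div v is approximated by div (kappa * w) with w in C_c close to v. The finite families of (c)
   are absorbed one function at a time by one-dimensional Hahn-Banach extensions, and (d) implies (c)
   because L_m is separable. *)

theory Submission
  imports Defs
begin

text \<open>The obstacle is that Hahn-Banach, applied to the L_1 norm of fields, can only produce a
  bounded object: neither continuity nor decay at infinity comes with it. Mollification repairs the
  first defect and the cutoff the second, and each disturbs the divergence by a function that is
  small in L_m but not zero, so no single step solves the equation exactly. The iteration closes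
  because \<open>approximable\<close> puts the L_m function inside the absolute value and is
  therefore visibly stable under subtracting one. Mollifying also replaces the representation of
  functionals on L_1: the field is read off from the values of the functional on translates of the
  kernel, and only compactly supported continuous fields occur as arguments. The Sobolev inequality
  is reached from a grid inequality by passing to the limit in Riemann sums, which turns integrating
  out one variable at a time into finite sums. Conditions (b), (c) and (d) are compared through the
  weaker-looking \<open>finite_sum_bound\<close>, whose finite families may be empty and need no
  normalisation.\<close>

section \<open>Continuous functions of compact support\<close>

definition Cc :: "('a::euclidean_space \<Rightarrow> 'b::real_normed_vector) \<Rightarrow> bool" where
  "Cc f \<longleftrightarrow> continuous_on UNIV f \<and> (\<exists>R. \<forall>x. norm x > R \<longrightarrow> f x = 0)"

lemma Cc_continuous: "Cc f \<Longrightarrow> continuous_on UNIV f"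
  by (simp add: Cc_def)

lemma Cc_support:
  assumes "Cc f"
  obtains R where "R > 0" "\<And>x. norm x > R \<Longrightarrow> f x = 0"
proof -
  obtain R where "\<forall>x. norm x > R \<longrightarrow> f x = 0" using assms by (auto simp: Cc_def)
  then show ?thesis by (intro that[of "max R 1"]) auto
qed

lemma CcI:
  assumes "continuous_on UNIV f" "\<And>x. norm x > R \<Longrightarrow> f x = 0"
  shows "Cc f"
  using assms by (auto simp: Cc_def)

lemma Cc_bounded:
  assumes "Cc f"
  obtains B where "B > 0" "\<And>x. norm (f x) \<le> B"
proof -
  obtain R where R: "R > 0" "\<And>x. norm x > R \<Longrightarrow> f x = 0" using Cc_support[OF assms] by blast
  have "compact (f ` cball 0 R)"
    by (intro compact_continuous_image continuous_on_subset[OF Cc_continuous[OF assms]]) auto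
  then obtain B where B: "B > 0" "\<And>y. y \<in> f ` cball 0 R \<Longrightarrow> norm y \<le> B"
    by (meson bounded_pos compact_imp_bounded)
  have "norm (f x) \<le> B" for x
    using B R by (cases "norm x > R") auto
  then show ?thesis using that B by blast
qed

lemma Cc_uniformly_continuous:
  assumes "Cc f"
  shows "uniformly_continuous_on UNIV f"
  unfolding uniformly_continuous_on_def
proof (intro allI impI)
  fix e :: real assume e: "e > 0"
  obtain R where R: "R > 0" "\<And>x. norm x > R \<Longrightarrow> f x = 0" using Cc_support[OF assms] by blast
  \<comment> \<open>Two points at distance less than 1 either both lie in this enlarged ball or both
    lie outside the support.\<close>
  have "uniformly_continuous_on (cball 0 (R+1)) f"
    by (intro compact_uniformly_continuous continuous_on_subset[OF Cc_continuous[OF assms]]) auto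
  then obtain d where d: "d > 0"
    "\<And>x y. x \<in> cball 0 (R+1) \<Longrightarrow> y \<in> cball 0 (R+1) \<Longrightarrow> dist y x < d \<Longrightarrow> dist (f y) (f x) < e"
    unfolding uniformly_continuous_on_def using e by metis
  have "dist (f y) (f x) < e" if "dist y x < min d 1" for x y
  proof (cases "norm x \<le> R + 1 \<and> norm y \<le> R + 1")
    case True then show ?thesis using d that by auto
  next
    case False
    have "\<bar>norm y - norm x\<bar> < 1" using that norm_triangle_ineq3[of y x] by (auto simp: dist_norm)
    then have "norm x > R" "norm y > R" using False by linarith+
    then show ?thesis using R e by simp
  qed
  then show "\<exists>d>0. \<forall>x\<in>UNIV. \<forall>x'\<in>UNIV. dist x' x < d \<longrightarrow> dist (f x') (f x) < e"
    using d by (intro exI[of _ "min d 1"]) auto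
qed

lemma Cc_measurable: "Cc f \<Longrightarrow> f \<in> borel_measurable borel"
  using Cc_continuous borel_measurable_continuous_onI by blast

lemma Cc_integrable:
  fixes f :: "'a::euclidean_space \<Rightarrow> 'b::{banach, second_countable_topology}"
  assumes "Cc f"
  shows "integrable lborel f"
proof -
  obtain R where R: "R > 0" "\<And>x. norm x > R \<Longrightarrow> f x = 0" using Cc_support[OF assms] by blast
  have "integrable lborel (\<lambda>x. indicator (cball 0 R) x *\<^sub>R f x)"
    by (intro borel_integrable_compact continuous_on_subset[OF Cc_continuous[OF assms]]) auto
  also have "(\<lambda>x. indicator (cball 0 R) x *\<^sub>R f x) = f"
    using R by (force simp: fun_eq_iff indicator_def)
  finally show ?thesis .
qed

text \<open>Bridge between the two measures: the theorem is stated with \<open>lebesgue\<close>,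
  while Fubini, substitutions and Riemann sums are carried out on \<open>lborel\<close>.\<close>

lemma continuous_integral_lebesgue:
  fixes f :: "'a::euclidean_space \<Rightarrow> 'b::{banach, second_countable_topology}"
  assumes "continuous_on UNIV f"
  shows "(LINT x|lebesgue. f x) = (LINT x|lborel. f x)"
  by (rule integral_completion) (use borel_measurable_continuous_onI[OF assms] in simp)

lemma Cc_integrable_lebesgue:
  fixes f :: "'a::euclidean_space \<Rightarrow> 'b::{banach, second_countable_topology}"
  assumes "Cc f"
  shows "integrable lebesgue f"
  using Cc_integrable[OF assms] Cc_measurable[OF assms] by (subst integrable_completion) auto

lemma Cc_compose: "Cc f \<Longrightarrow> continuous_on UNIV h \<Longrightarrow> h 0 = 0 \<Longrightarrow> Cc (\<lambda>x. h (f x))"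
  unfolding Cc_def by (metis continuous_on_compose2 subset_UNIV)

lemma Cc_add:
  assumes "Cc f" "Cc g" shows "Cc (\<lambda>x. f x + g x)"
proof -
  obtain R S where "\<And>x. norm x > R \<Longrightarrow> f x = 0" "\<And>x. norm x > S \<Longrightarrow> g x = 0"
    using assms by (metis Cc_def)
  moreover have "continuous_on UNIV (\<lambda>x. f x + g x)"
    using assms by (auto simp: Cc_def intro: continuous_intros)
  ultimately show ?thesis
    by (intro CcI[of _ "max R S"]) auto
qed

lemma Cc_scaleR: "Cc f \<Longrightarrow> Cc (\<lambda>x. c *\<^sub>R f x)"
  by (rule Cc_compose) (auto intro: continuous_intros)

lemma Cc_diff: "Cc f \<Longrightarrow> Cc g \<Longrightarrow> Cc (\<lambda>x. f x - g x)"
  using Cc_add[of f "\<lambda>x. (-1) *\<^sub>R g x"] Cc_scaleR[of g "-1"] by simp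

lemma Cc_zero: "Cc (\<lambda>x. 0)"
  by (auto simp: Cc_def)

lemma Cc_sum: "(\<And>i. i \<in> I \<Longrightarrow> Cc (f i)) \<Longrightarrow> Cc (\<lambda>x. \<Sum>i\<in>I. f i x)"
  by (induction I rule: infinite_finite_induct) (auto intro: Cc_zero Cc_add)

lemma Cc_norm: "Cc f \<Longrightarrow> Cc (\<lambda>x. norm (f x))"
  by (rule Cc_compose) (auto intro: continuous_intros)

lemma Cc_scaleR_cont1: "Cc f \<Longrightarrow> continuous_on UNIV g \<Longrightarrow> Cc (\<lambda>x. f x *\<^sub>R g x)"
  unfolding Cc_def by (metis continuous_on_scaleR scaleR_zero_left)

lemma Cc_mult1: "Cc f \<Longrightarrow> continuous_on UNIV g \<Longrightarrow> Cc (\<lambda>x. f x * (g x :: real))"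
  using Cc_scaleR_cont1[of f g] by simp

lemma Cc_mult2: "Cc f \<Longrightarrow> continuous_on UNIV g \<Longrightarrow> Cc (\<lambda>x. g x * (f x :: real))"
  using Cc_mult1[of f g] by (simp add: mult.commute)

lemma Cc_inner1: "Cc f \<Longrightarrow> continuous_on UNIV g \<Longrightarrow> Cc (\<lambda>x. f x \<bullet> g x)"
  unfolding Cc_def by (metis continuous_on_inner inner_zero_left)

lemma Cc_nth: "Cc f \<Longrightarrow> Cc (\<lambda>x. f x $ i)"
  by (rule Cc_compose[where h="\<lambda>v. v $ i"]) (auto intro: continuous_intros)

lemma Cc_vec: 
  fixes f :: "'m::finite \<Rightarrow> 'a::euclidean_space \<Rightarrow> real"
  assumes "\<And>i. Cc (f i)" shows "Cc (\<lambda>x. \<chi> i. f i x)"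
proof -
  have "\<exists>R. \<forall>x. norm x > R \<longrightarrow> f i x = 0" for i using assms by (auto simp: Cc_def)
  then obtain R where R: "\<And>i x. norm x > R i \<Longrightarrow> f i x = 0" by metis
  show ?thesis
  proof (rule CcI[of _ "Max (range R)"])
    show "continuous_on UNIV (\<lambda>x. \<chi> i. f i x)"
      by (intro continuous_on_vec_lambda Cc_continuous assms)
    fix x :: 'a assume "norm x > Max (range R)"
    then have "norm x > R i" for i by (simp add: Max_less_iff)
    then show "(\<chi> i. f i x) = 0" using R by (simp add: vec_eq_iff)
  qed
qed

lemma Cc_shift:
  assumes "Cc f" shows "Cc (\<lambda>y. f (x - y))" "Cc (\<lambda>y. f (y - x))"
proof -
  obtain R where R: "\<And>x. norm x > R \<Longrightarrow> f x = 0" using assms by (auto simp: Cc_def)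
  have "norm (x - y) > R" "norm (y - x) > R" if "norm y > R + norm x" for y
    using that norm_triangle_ineq2[of y x] by (auto simp: norm_minus_commute)
  then show "Cc (\<lambda>y. f (x - y))" "Cc (\<lambda>y. f (y - x))"
    by (auto intro!: CcI[of _ "R + norm x"] R
        continuous_on_compose2[OF Cc_continuous[OF assms]] continuous_intros)
qed

lemma Cc_reflect: "Cc f \<Longrightarrow> Cc (\<lambda>y. f (- y))"
  using Cc_shift(1)[of f 0] by simp

section \<open>Differentiation\<close>

lemma partial_eq: "(f has_derivative D) (at x) \<Longrightarrow> partial i f x = D (axis i 1)"
  unfolding partial_def by (metis frechet_derivative_at)

lemma has_derivative_grad:
  assumes "f differentiable (at x)"
  shows "(f has_derivative (\<lambda>h. grad f x \<bullet> h)) (at x)"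
proof -
  obtain D where D: "(f has_derivative D) (at x)" using assms by (auto simp: differentiable_def)
  interpret bounded_linear D using D by (rule has_derivative_bounded_linear)
  have "D h = grad f x \<bullet> h" for h
  proof -
    have "D h = D (\<Sum>i\<in>UNIV. h $ i *\<^sub>R axis i 1)"
      using basis_expansion[of h] by (simp add: scalar_mult_eq_scaleR)
    also have "\<dots> = grad f x \<bullet> h"
      by (simp add: sum scaleR grad_def partial_eq[OF D] inner_vec_def mult.commute)
    finally show ?thesis .
  qed
  then show ?thesis using D by (metis (no_types, lifting) ext)
qed

lemma partial_grad: "grad f x $ i = partial i f x"
  by (simp add: grad_def)

lemma partial_add:
  "f differentiable (at x) \<Longrightarrow> g differentiable (at x) \<Longrightarrow>
   partial i (\<lambda>x. f x + g x) x = partial i f x + partial i g x"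
  by (subst partial_eq[OF has_derivative_add[OF has_derivative_grad has_derivative_grad]])
     (auto simp: inner_axis grad_def)

lemma partial_cmult:
  "f differentiable (at x) \<Longrightarrow> partial i (\<lambda>x. c * f x) x = c * partial i f x"
  by (subst partial_eq[OF has_derivative_mult_right[OF has_derivative_grad]])
     (auto simp: inner_axis grad_def)

lemma partial_mult:
  "f differentiable (at x) \<Longrightarrow> g differentiable (at x) \<Longrightarrow>
   partial i (\<lambda>x. f x * g x) x = partial i f x * g x + f x * partial i g x"
  by (subst partial_eq[OF has_derivative_mult[OF has_derivative_grad has_derivative_grad]])
     (auto simp: inner_axis grad_def)

lemma grad_add:
  "f differentiable (at x) \<Longrightarrow> g differentiable (at x) \<Longrightarrow>
   grad (\<lambda>x. f x + g x) x = grad f x + grad g x"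
  by (simp add: vec_eq_iff partial_grad partial_add)

lemma grad_cmult:
  "f differentiable (at x) \<Longrightarrow> grad (\<lambda>x. c * f x) x = c *\<^sub>R grad f x"
  by (simp add: vec_eq_iff partial_grad partial_cmult)

lemma grad_mult:
  "f differentiable (at x) \<Longrightarrow> g differentiable (at x) \<Longrightarrow>
   grad (\<lambda>x. f x * g x) x = g x *\<^sub>R grad f x + f x *\<^sub>R grad g x"
  by (simp add: vec_eq_iff partial_grad partial_mult)

lemma Ck_decrease: "Ck (Suc k) f \<Longrightarrow> Ck k f"
proof (induction k arbitrary: f)
  case 0
  then show ?case
    by (auto simp: continuous_on_eq_continuous_within intro: differentiable_imp_continuous_within)
qed auto

lemma Ck_add: "Ck k f \<Longrightarrow> Ck k g \<Longrightarrow> Ck k (\<lambda>x. f x + g x)"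
proof (induction k arbitrary: f g)
  case (Suc k)
  then have "partial i (\<lambda>x. f x + g x) = (\<lambda>x. partial i f x + partial i g x)" for i
    by (auto simp: partial_add)
  then show ?case using Suc by auto
qed (auto intro: continuous_intros)

lemma Ck_cmult: "Ck k f \<Longrightarrow> Ck k (\<lambda>x. c * f x)"
proof (induction k arbitrary: f)
  case (Suc k)
  then have "partial i (\<lambda>x. c * f x) = (\<lambda>x. c * partial i f x)" for i
    by (auto simp: partial_cmult)
  then show ?case using Suc by auto
qed (auto intro: continuous_intros)

lemma Ck_mult: "Ck k f \<Longrightarrow> Ck k g \<Longrightarrow> Ck k (\<lambda>x. f x * g x)"
proof (induction k arbitrary: f g)
  case (Suc k)
  then have "partial i (\<lambda>x. f x * g x) = (\<lambda>x. partial i f x * g x + f x * partial i g x)" for i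
    by (auto simp: partial_mult)
  moreover have "Ck k f" "Ck k g" using Suc.prems Ck_decrease by blast+
  ultimately show ?case using Suc by (auto intro!: Ck_add Suc.IH)
qed (auto intro: continuous_intros)

section \<open>Compactly supported functions of class C^1 and test functions\<close>

text \<open>The regularity asked of mollifiers and of functions in the Sobolev inequality: only one
  derivative is ever taken there, so kernels do not have to be smooth.\<close>

definition Cc1 :: "(real^'m \<Rightarrow> real) \<Rightarrow> bool" where
  "Cc1 f \<longleftrightarrow> Cc f \<and> (\<forall>x. f differentiable (at x)) \<and> (\<forall>i. Cc (partial i f))"

lemma grad_outside_support:
  assumes "\<And>x. norm x > R \<Longrightarrow> f x = 0" "norm x > R"
  shows "grad f x = 0"
proof -
  have "((\<lambda>y. 0) has_derivative (\<lambda>h. 0)) (at x)" by simp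
  then have "(f has_derivative (\<lambda>h. 0)) (at x)"
    by (rule has_derivative_transform_within_open[of _ _ _ _ "- cball 0 R"]) (use assms in auto)
  then show ?thesis by (simp add: vec_eq_iff partial_grad partial_eq)
qed

lemma Cc1_grad: "Cc1 f \<Longrightarrow> Cc (grad f)"
  using Cc_vec[of "\<lambda>i. partial i f"] by (simp add: Cc1_def grad_def[abs_def])

lemma Cc1_iff:
  "Cc1 f \<longleftrightarrow> Ck 1 f \<and> (\<exists>R. \<forall>x. norm x > R \<longrightarrow> f x = 0)"
proof
  assume R: "Ck 1 f \<and> (\<exists>R. \<forall>x. norm x > R \<longrightarrow> f x = 0)"
  then obtain R where R': "\<And>x. norm x > R \<Longrightarrow> f x = 0" by auto
  have "continuous_on UNIV f" using R Ck_decrease[of 0 f] by simp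
  moreover have "Cc (partial i f)" for i
    using R by (intro CcI[of _ R]) (auto simp: partial_grad[symmetric] grad_outside_support[OF R'])
  ultimately show "Cc1 f" using R by (auto simp: Cc1_def Cc_def)
qed (auto simp: Cc1_def Cc_def)

lemma test_functions_iff:
  "\<phi> \<in> test_functions \<longleftrightarrow> (\<forall>k. Ck k \<phi>) \<and> (\<exists>R. \<forall>x. norm x > R \<longrightarrow> \<phi> x = 0)"
proof -
  have "compact (closure {x. \<phi> x \<noteq> 0}) \<longleftrightarrow> bounded {x. \<phi> x \<noteq> 0}" by simp
  also have "\<dots> \<longleftrightarrow> (\<exists>R. \<forall>x. norm x > R \<longrightarrow> \<phi> x = 0)"
    unfolding bounded_iff by (metis (mono_tags, lifting) linorder_not_less mem_Collect_eq)
  finally show ?thesis by (simp add: test_functions_def)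
qed

lemma test_Cc1: "\<phi> \<in> test_functions \<Longrightarrow> Cc1 \<phi>"
  by (metis Cc1_iff test_functions_iff)

lemma test_Cc: "\<phi> \<in> test_functions \<Longrightarrow> Cc \<phi>"
  using test_Cc1 Cc1_def by blast

lemma test_differentiable: "\<phi> \<in> test_functions \<Longrightarrow> \<phi> differentiable (at x)"
  using test_Cc1 Cc1_def by blast

lemma test_grad: "\<phi> \<in> test_functions \<Longrightarrow> Cc (grad \<phi>)"
  using test_Cc1 Cc1_grad by blast

lemma test_zero: "(\<lambda>x::real^'m. 0) \<in> test_functions"
proof -
  have "Ck k (\<lambda>x::real^'m. 0)" for k
  proof (induction k)
    case (Suc k)
    have "partial i (\<lambda>x::real^'m. 0) = (\<lambda>x. 0)" for i by (simp add: fun_eq_iff partial_eq[of _ "\<lambda>h. 0"])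
    then show ?case using Suc by simp
  qed simp
  then show ?thesis by (auto simp: test_functions_iff)
qed

lemma test_add:
  assumes "\<phi> \<in> test_functions" "\<psi> \<in> test_functions"
  shows "(\<lambda>x. \<phi> x + \<psi> x) \<in> test_functions"
  using assms Cc_add[OF test_Cc test_Cc, OF assms] by (auto simp: test_functions_iff Ck_add Cc_def)

lemma test_cmult: "\<phi> \<in> test_functions \<Longrightarrow> (\<lambda>x. c * \<phi> x) \<in> test_functions"
  unfolding test_functions_iff by (auto simp: Ck_cmult)

lemma test_mult:
  assumes "\<phi> \<in> test_functions" "\<And>k. Ck k f"
  shows "(\<lambda>x. f x * \<phi> x) \<in> test_functions"
  using assms unfolding test_functions_iff by (auto simp: Ck_mult)

section \<open>Convolution\<close>

lemma lborel_integral_affine: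
  fixes f :: "'a::euclidean_space \<Rightarrow> 'b::{banach, second_countable_topology}"
  assumes "f \<in> borel_measurable borel"
  shows "(LINT y|lborel. f (x - y)) = (LINT y|lborel. f y)"
    and "(LINT y|lborel. f (x + y)) = (LINT y|lborel. f y)"
    and "(LINT y|lborel. f (- y)) = (LINT y|lborel. f y)"
proof -
  have plus: "(LINT y|lborel. g (z + y)) = (LINT y|lborel. g y)"
    if "g \<in> borel_measurable borel" for g :: "'a \<Rightarrow> 'b" and z
    using integral_distr[of "(+) z" lborel borel g] that by (simp add: lborel_distr_plus)
  have uminus: "(LINT y|lborel. g (- y)) = (LINT y|lborel. g y)"
    if "g \<in> borel_measurable borel" for g :: "'a \<Rightarrow> 'b"
    using integral_distr[of uminus lborel borel g] that
      lborel_affine[of "-1" "0::'a"] by (simp add: density_1)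
  show "(LINT y|lborel. f (x + y)) = (LINT y|lborel. f y)"
    "(LINT y|lborel. f (- y)) = (LINT y|lborel. f y)"
    using plus uminus assms by auto
  have "(\<lambda>y. f (x + y)) \<in> borel_measurable borel" using assms by measurable
  then show "(LINT y|lborel. f (x - y)) = (LINT y|lborel. f y)"
    using uminus[of "\<lambda>y. f (x + y)"] plus[OF assms, of x] by simp
qed

definition conv :: "('a::euclidean_space \<Rightarrow> real) \<Rightarrow> ('a \<Rightarrow> 'b::euclidean_space) \<Rightarrow> 'a \<Rightarrow> 'b" where
  "conv a b x = (LINT y|lborel. a (x - y) *\<^sub>R b y)"

lemma conv_integrand_Cc:
  assumes "Cc a" "Cc b"
  shows "Cc (\<lambda>y. a (x - y) *\<^sub>R b y)" "Cc (\<lambda>y. a y *\<^sub>R b (x - y))"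
  using assms by (auto intro!: Cc_scaleR_cont1 Cc_shift intro: Cc_continuous Cc_shift)

lemma conv_altdef:
  assumes "Cc a" "Cc b"
  shows "conv a b x = (LINT y|lborel. a y *\<^sub>R b (x - y))"
  using lborel_integral_affine(1)[OF Cc_measurable[OF conv_integrand_Cc(2)[OF assms, of x]], of x]
  by (simp add: conv_def)

lemma conv_commute:
  fixes a b :: "'a::euclidean_space \<Rightarrow> real"
  assumes "Cc a" "Cc b"
  shows "conv a b = conv b a"
  using conv_altdef[OF assms] by (auto simp: conv_def fun_eq_iff mult.commute)

lemma Cc_conv:
  fixes b :: "'a::euclidean_space \<Rightarrow> 'b::euclidean_space"
  assumes a: "Cc a" and b: "Cc b"
  shows "Cc (conv a b)"
proof -
  obtain R where R: "\<And>x. norm x > R \<Longrightarrow> a x = 0" using Cc_support[OF a] by blast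
  obtain S where S: "\<And>x. norm x > S \<Longrightarrow> b x = 0" using Cc_support[OF b] by blast
  define I where "I = (LINT y|lborel. norm (b y))"
  have I: "I \<ge> 0" by (simp add: I_def)
  show ?thesis
  proof (rule CcI[of _ "R + S"])
    fix x :: 'a assume x: "norm x > R + S"
    have "a (x - y) *\<^sub>R b y = 0" for y
      using R[of "x - y"] S[of y] x norm_triangle_ineq2[of x y] by fastforce
    then show "conv a b x = 0" unfolding conv_def by (simp only: integral_zero)
  next
    show "continuous_on UNIV (conv a b)"
      unfolding continuous_on_iff
    proof (intro ballI allI impI)
      fix x :: 'a and e :: real assume e: "e > 0"
      \<comment> \<open>The \<open>+ 1\<close> keeps the quotient meaningful when
        \<open>I = 0\<close>; the same device recurs in later estimates.\<close>
      define e' where "e' = e / (I + 1)"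
      have e': "e' > 0" using e I by (simp add: e'_def)
      obtain d where d: "d > 0" "\<And>x y. dist x y < d \<Longrightarrow> dist (a x) (a y) < e'"
        using Cc_uniformly_continuous[OF a] e' unfolding uniformly_continuous_on_def
        by (metis UNIV_I)
      have "dist (conv a b x') (conv a b x) < e" if "dist x' x < d" for x'
      proof -
        have "norm (conv a b x' - conv a b x) = norm (LINT y|lborel. a (x' - y) *\<^sub>R b y - a (x - y) *\<^sub>R b y)"
          unfolding conv_def
          by (subst Bochner_Integration.integral_diff) (auto intro: Cc_integrable conv_integrand_Cc a b)
        also have "\<dots> \<le> (LINT y|lborel. norm (a (x' - y) *\<^sub>R b y - a (x - y) *\<^sub>R b y))"
          by (rule integral_norm_bound)
        also have "\<dots> \<le> (LINT y|lborel. e' * norm (b y))"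
        proof (rule integral_mono)
          show "integrable lborel (\<lambda>y. norm (a (x' - y) *\<^sub>R b y - a (x - y) *\<^sub>R b y))"
            by (intro Cc_integrable Cc_norm Cc_diff conv_integrand_Cc a b)
          show "integrable lborel (\<lambda>y. e' * norm (b y))"
            using Cc_integrable[OF Cc_norm[OF b]] by simp
          fix y
          have "\<bar>a (x' - y) - a (x - y)\<bar> \<le> e'"
            using d(2)[of "x' - y" "x - y"] that by (simp add: dist_norm)
          then show "norm (a (x' - y) *\<^sub>R b y - a (x - y) *\<^sub>R b y) \<le> e' * norm (b y)"
            by (simp add: scaleR_diff_left[symmetric] mult_right_mono)
        qed
        also have "\<dots> = e' * I" by (simp add: I_def)
        also have "\<dots> < e" using e I by (simp add: e'_def field_simps)
        finally show ?thesis by (simp add: dist_norm)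
      qed
      then show "\<exists>d>0. \<forall>x'\<in>UNIV. dist x' x < d \<longrightarrow> dist (conv a b x') (conv a b x) < e"
        using d(1) by auto
    qed
  qed
qed

text \<open>Fubini: moving a convolution to the other factor reflects the kernel. The integrand is
  continuous with compact support on the product space, which settles integrability at once.\<close>

lemma integral_conv_mult:
  fixes a b c :: "'a::euclidean_space \<Rightarrow> real"
  assumes a: "Cc a" and b: "Cc b" and c: "Cc c"
  shows "(LINT x|lborel. conv a b x * c x) = (LINT y|lborel. b y * conv (\<lambda>z. a (- z)) c y)"
proof -
  have cont: "continuous_on UNIV (\<lambda>z::'a\<times>'a. a (fst z - snd z) * b (snd z) * c (fst z))"
    by (intro continuous_intros continuous_on_compose2[OF Cc_continuous[OF a]]
        continuous_on_compose2[OF Cc_continuous[OF b]] continuous_on_compose2[OF Cc_continuous[OF c]])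
       auto
  obtain R where R: "\<And>x. norm x > R \<Longrightarrow> b x = 0" using Cc_support[OF b] by blast
  obtain S where S: "\<And>x. norm x > S \<Longrightarrow> c x = 0" using Cc_support[OF c] by blast
  have "a (fst z - snd z) * b (snd z) * c (fst z) = 0" if "norm z > R + S" for z :: "'a \<times> 'a"
  proof -
    have "norm z \<le> norm (fst z) + norm (snd z)" by (metis norm_Pair_le prod.collapse)
    then have "norm (snd z) > R \<or> norm (fst z) > S" using that by linarith
    then show ?thesis using R S by auto
  qed
  then have "Cc (\<lambda>z::'a\<times>'a. a (fst z - snd z) * b (snd z) * c (fst z))"
    using cont by (rule CcI[rotated])
  then have "integrable (lborel \<Otimes>\<^sub>M lborel) (\<lambda>(x,y). a (x - y) * b y * c x)"
    using Cc_integrable by (simp add: lborel_prod case_prod_beta')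
  note F = lborel_pair.Fubini_integral[OF this]
  have "(LINT x|lborel. conv a b x * c x) = (LBINT x. LBINT y. a (x - y) * b y * c x)"
    by (simp add: conv_def)
  also have "\<dots> = (LBINT y. LBINT x. a (x - y) * b y * c x)" by (rule F[symmetric])
  also have "\<dots> = (LINT y|lborel. b y * conv (\<lambda>z. a (- z)) c y)"
  proof (rule Bochner_Integration.integral_cong[OF refl])
    fix y
    have "(LBINT x. a (x - y) * b y * c x) = (LBINT x. b y * (a (x - y) * c x))"
      by (simp only: mult_ac)
    then show "(LBINT x. a (x - y) * b y * c x) = b y * conv (\<lambda>z. a (- z)) c y"
      by (simp add: conv_def)
  qed
  finally show ?thesis .
qed

section \<open>Derivatives of convolutions\<close>

text \<open>Uniform continuity of the gradient makes the mean value estimate uniform in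
  \<open>x\<close>. It serves both to differentiate convolutions and to compare differences on a
  grid with the gradient.\<close>

lemma Cc1_uniform_linearization:
  assumes b: "Cc1 b" and e: "e > 0"
  shows "\<exists>d>0. \<forall>x h. norm h < d \<longrightarrow> \<bar>b (x + h) - b x - grad b x \<bullet> h\<bar> \<le> e * norm h"
proof -
  obtain d where d: "d > 0" "\<And>x y. dist x y < d \<Longrightarrow> dist (grad b x) (grad b y) < e"
    using Cc_uniformly_continuous[OF Cc1_grad[OF b]] e unfolding uniformly_continuous_on_def
    by (metis UNIV_I)
  have "\<bar>b (x + h) - b x - grad b x \<bullet> h\<bar> \<le> e * norm h" if h: "norm h < d" for x h
  proof -
    have "norm (b (x + h) - b x - grad b x \<bullet> ((x + h) - x)) \<le> norm ((x + h) - x) * e"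
    proof (rule differentiable_bound_linearization[where S="ball x d" and f'="\<lambda>z h. grad b z \<bullet> h"])
      fix t :: real assume "t \<in> {0..1}"
      then have "t * norm h \<le> 1 * norm h" by (intro mult_right_mono) auto
      then show "x + t *\<^sub>R (x + h - x) \<in> ball x d" using h \<open>t \<in> {0..1}\<close> by (simp add: dist_norm)
    next
      fix z assume z: "z \<in> ball x d"
      show "(b has_derivative (\<lambda>h. grad b z \<bullet> h)) (at z within ball x d)"
        using b by (auto simp: Cc1_def intro: has_derivative_at_withinI[OF has_derivative_grad])
      have "onorm (\<lambda>h. (grad b z - grad b x) \<bullet> h) \<le> norm (grad b z - grad b x)"
        by (rule onorm_le) (simp add: Cauchy_Schwarz_ineq2)
      also have "\<dots> \<le> e" using d(2)[of z x] z by (simp add: dist_norm norm_minus_commute less_imp_le)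
      finally show "onorm ((\<lambda>h. grad b z \<bullet> h) - (\<lambda>h. grad b x \<bullet> h)) \<le> e"
        by (simp add: fun_diff_def inner_diff_left)
    qed (use d in auto)
    then show ?thesis by (simp add: mult.commute)
  qed
  then show ?thesis using d(1) by blast
qed

text \<open>With the translation placed on \<open>b\<close>, its linearization error is uniform in
  the point and can be integrated against \<open>\<bar>a\<bar>\<close>.\<close>

lemma has_derivative_conv:
  assumes a: "Cc a" and b: "Cc1 b"
  shows "(conv a b has_derivative (\<lambda>h. conv a (grad b) x \<bullet> h)) (at x)"
  unfolding has_derivative_at_alt
proof (intro conjI allI impI)
  show "bounded_linear (\<lambda>h. conv a (grad b) x \<bullet> h)" by (rule bounded_linear_inner_right)
next
  fix e :: real assume e: "e > 0"
  have bc: "Cc b" using b by (simp add: Cc1_def)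
  note g = Cc1_grad[OF b]
  define I where "I = (LINT y|lborel. \<bar>a y\<bar>)"
  have I: "I \<ge> 0" by (simp add: I_def)
  obtain d where d: "d > 0"
    "\<And>x h. norm h < d \<Longrightarrow> \<bar>b (x + h) - b x - grad b x \<bullet> h\<bar> \<le> e / (I + 1) * norm h"
    using Cc1_uniform_linearization[OF b, of "e / (I + 1)"] e I by auto
  have "norm (conv a b y - conv a b x - conv a (grad b) x \<bullet> (y - x)) \<le> e * norm (y - x)"
    if y: "norm (y - x) < d" for y
  proof -
    define h where "h = y - x"
    have h: "y = x + h" "norm h < d" using y by (auto simp: h_def)
    have ig: "integrable lborel (\<lambda>z. a z *\<^sub>R grad b (x - z))"
      by (intro Cc_integrable conv_integrand_Cc a g)
    have i1: "integrable lborel (\<lambda>z. a z * b (x + h - z))" "integrable lborel (\<lambda>z. a z * b (x - z))"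
      using Cc_integrable[OF conv_integrand_Cc(2)[OF a bc]] by auto
    have i2: "integrable lborel (\<lambda>z. a z * (grad b (x - z) \<bullet> h))"
      using integrable_inner_left[OF ig, of h] by simp
    have e1: "conv a (grad b) x \<bullet> h = (LINT z|lborel. a z * (grad b (x - z) \<bullet> h))"
      unfolding conv_altdef[OF a g] using integral_inner_left[OF ig, of h] by simp
    have "norm (conv a b y - conv a b x - conv a (grad b) x \<bullet> h)
        = norm (LINT z|lborel. a z * b (x + h - z) - a z * b (x - z) - a z * (grad b (x - z) \<bullet> h))"
      using i1 i2 by (simp add: e1 conv_altdef[OF a bc] h)
    also have "\<dots> \<le> (LINT z|lborel. norm (a z * b (x + h - z) - a z * b (x - z) - a z * (grad b (x - z) \<bullet> h)))"
      by (rule integral_norm_bound)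
    also have "\<dots> \<le> (LINT z|lborel. (e / (I + 1) * norm h) * \<bar>a z\<bar>)"
    proof (rule integral_mono)
      fix z
      have "norm (a z * b (x + h - z) - a z * b (x - z) - a z * (grad b (x - z) \<bullet> h))
          = \<bar>a z\<bar> * \<bar>b ((x - z) + h) - b (x - z) - grad b (x - z) \<bullet> h\<bar>"
        unfolding right_diff_distrib[symmetric] real_norm_def abs_mult
        by (simp only: diff_add_eq)
      also have "\<dots> \<le> \<bar>a z\<bar> * (e / (I + 1) * norm h)"
        by (intro mult_left_mono d h) auto
      finally show "norm (a z * b (x + h - z) - a z * b (x - z) - a z * (grad b (x - z) \<bullet> h))
          \<le> (e / (I + 1) * norm h) * \<bar>a z\<bar>" by (simp add: mult.commute)
    next
      show "integrable lborel (\<lambda>z. (e / (I + 1) * norm h) * \<bar>a z\<bar>)"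
        using Cc_integrable[OF Cc_norm[OF a]] by simp
    qed (use i1 i2 in auto)
    also have "\<dots> = (e / (I + 1) * norm h) * I" by (simp add: I_def)
    also have "\<dots> = (e * norm h) * (I / (I + 1))" by simp
    also have "\<dots> \<le> (e * norm h) * 1"
      using e I by (intro mult_left_mono) (auto simp: field_simps)
    finally show ?thesis by (simp add: h_def)
  qed
  then show "\<exists>d>0. \<forall>y. norm (y - x) < d \<longrightarrow>
      norm (conv a b y - conv a b x - conv a (grad b) x \<bullet> (y - x)) \<le> e * norm (y - x)"
    using d(1) by blast
qed

lemma conv_nth:
  fixes b :: "'a::euclidean_space \<Rightarrow> real^'m"
  assumes a: "Cc a" and b: "Cc b"
  shows "conv a b x $ i = conv a (\<lambda>y. b y $ i) x"
  unfolding conv_def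
  using integral_bounded_linear[OF bounded_linear_vec_nth[of i] Cc_integrable[OF conv_integrand_Cc(1)[OF a b, of x]]]
  by simp

lemma partial_conv:
  assumes a: "Cc a" and b: "Cc1 b"
  shows "partial i (conv a b) = conv a (partial i b)"
proof
  fix x
  have "partial i (conv a b) x = conv a (grad b) x $ i"
    using partial_eq[OF has_derivative_conv[OF assms]] by (simp add: inner_axis)
  also have "\<dots> = conv a (partial i b) x"
    by (simp add: conv_nth[OF a Cc1_grad[OF b]] partial_grad)
  finally show "partial i (conv a b) x = conv a (partial i b) x" .
qed

lemma grad_conv:
  assumes a: "Cc a" and b: "Cc1 b"
  shows "grad (conv a b) = conv a (grad b)"
  by (simp add: fun_eq_iff vec_eq_iff partial_grad partial_conv[OF assms]
      conv_nth[OF a Cc1_grad[OF b]])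

lemma test_partial: "\<phi> \<in> test_functions \<Longrightarrow> partial i \<phi> \<in> test_functions"
proof -
  assume p: "\<phi> \<in> test_functions"
  have "\<forall>k. Ck k (partial i \<phi>)" using p unfolding test_functions_iff by (metis Ck.simps(2))
  moreover have "Cc (partial i \<phi>)" using test_Cc1[OF p] by (simp add: Cc1_def)
  ultimately show ?thesis by (auto simp: test_functions_iff Cc_def)
qed

text \<open>Every derivative falls on \<open>\<phi>\<close>, so a merely continuous kernel preserves
  test functions.\<close>

lemma test_conv:
  assumes a: "Cc a" and p: "\<phi> \<in> test_functions"
  shows "conv a \<phi> \<in> test_functions"
proof -
  have "Ck k (conv a \<phi>)" if "\<phi> \<in> test_functions" for k \<phi>
    using that
  proof (induction k arbitrary: \<phi>)
    case 0
    then show ?case using Cc_conv[OF a test_Cc] by (simp add: Cc_def)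
  next
    case (Suc k)
    then show ?case
      using has_derivative_conv[OF a test_Cc1[OF Suc.prems]] Suc.IH[OF test_partial[OF Suc.prems]]
      by (auto simp: partial_conv[OF a test_Cc1[OF Suc.prems]] differentiable_def)
  qed
  then show ?thesis using Cc_conv[OF a test_Cc[OF p]] p by (auto simp: test_functions_iff Cc_def)
qed

section \<open>Mollifiers\<close>

text \<open>Squaring the positive part removes the kink at 0; this turns a quadratic polynomial into
  a bump function of class C^1.\<close>

lemma DERIV_max_0_square: "((\<lambda>t::real. (max 0 t)\<^sup>2) has_real_derivative 2 * max 0 t) (at t)"
proof (cases "t = 0")
  case False
  show ?thesis
  proof (cases "t > 0")
    case True
    have "((\<lambda>t::real. t\<^sup>2) has_real_derivative 2 * t) (at t)" by (auto intro!: derivative_eq_intros)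
    then have "((\<lambda>t::real. (max 0 t)\<^sup>2) has_real_derivative 2 * t) (at t)"
      by (rule has_field_derivative_transform_within_open[of _ _ _ "{0<..}"]) (use True in auto)
    then show ?thesis using True by simp
  next
    case f: False
    have "((\<lambda>t::real. 0) has_real_derivative 0) (at t)" by auto
    then have "((\<lambda>t::real. (max 0 t)\<^sup>2) has_real_derivative 0) (at t)"
      by (rule has_field_derivative_transform_within_open[of _ _ _ "{..<0}"]) (use False f in auto)
    then show ?thesis using f by simp
  qed
next
  case True
  have "((\<lambda>h. ((max 0 h)\<^sup>2) / h) \<longlongrightarrow> 0) (at (0::real))"
  proof (rule Lim_null_comparison)
    show "\<forall>\<^sub>F h in at (0::real). norm (((max 0 h)\<^sup>2) / h) \<le> \<bar>h\<bar>"
      by (rule eventuallyI) (auto simp: max_def power2_eq_square)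
    show "((\<lambda>h::real. \<bar>h\<bar>) \<longlongrightarrow> 0) (at 0)" by (rule tendsto_rabs_zero) (rule tendsto_ident_at)
  qed
  then show ?thesis using True by (simp add: DERIV_def)
qed

text \<open>Evenness is part of the conclusion because it makes convolution with the kernel its own
  adjoint.\<close>

lemma mollifier_exists:
  assumes r: "r > 0"
  obtains \<kappa> :: "real^'m \<Rightarrow> real" where "Cc1 \<kappa>" "\<And>x. \<kappa> x \<ge> 0" "\<And>x. \<kappa> (- x) = \<kappa> x"
    "\<And>x. norm x \<ge> r \<Longrightarrow> \<kappa> x = 0" "(LINT x|lborel. \<kappa> x) = 1"
proof -
  define k :: "real^'m \<Rightarrow> real" where "k x = (max 0 (r\<^sup>2 - x \<bullet> x))\<^sup>2" for x
  have d: "(k has_derivative (\<lambda>h. 2 * max 0 (r\<^sup>2 - x \<bullet> x) * (- 2 * (x \<bullet> h)))) (at x)" for x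
  proof -
    have "((\<lambda>x::real^'m. r\<^sup>2 - x \<bullet> x) has_derivative (\<lambda>h. - 2 * (x \<bullet> h))) (at x)"
      by (auto intro!: derivative_eq_intros simp: inner_commute)
    from has_derivative_compose[OF this DERIV_max_0_square[unfolded has_field_derivative_def]]
    show ?thesis unfolding k_def[abs_def] .
  qed
  have k0: "k x = 0" if "norm x \<ge> r" for x
  proof -
    have "r\<^sup>2 \<le> x \<bullet> x" using that r by (simp add: dot_square_norm power_mono)
    then show ?thesis by (simp add: k_def)
  qed
  have "Ck 1 k"
  proof -
    have "partial i k = (\<lambda>x. 2 * max 0 (r\<^sup>2 - x \<bullet> x) * (- 2 * (x \<bullet> axis i 1)))" for i
      by (rule ext) (rule partial_eq[OF d])
    then show ?thesis using d by (auto simp: differentiable_def intro!: continuous_intros)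
  qed
  then have k1: "Cc1 k" using k0 by (auto simp: Cc1_iff intro!: exI[of _ r])
  then have kc: "Cc k" by (simp add: Cc1_def)
  define I where "I = (LINT x|lborel. k x)"
  \<comment> \<open>Otherwise \<open>k\<close> would vanish almost everywhere, whereas it is
    positive on the whole ball of radius \<open>r\<close>, which has positive measure.\<close>
  have "I \<noteq> 0"
  proof
    assume "I = 0"
    then have "AE x in lborel. k x = 0"
      using integral_nonneg_eq_0_iff_AE[OF Cc_integrable[OF kc]] by (auto simp: I_def k_def[abs_def])
    then obtain N where N: "{x \<in> space lborel. k x \<noteq> 0} \<subseteq> N" "emeasure lborel N = 0" "N \<in> sets lborel"
      by (rule AE_E)
    have "k x \<noteq> 0" if "x \<in> ball 0 r" for x
    proof -
      have "(norm x)\<^sup>2 < r\<^sup>2" using that r by (intro power_strict_mono) auto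
      then show ?thesis by (simp add: k_def dot_square_norm)
    qed
    then have "ball 0 r \<subseteq> N" using N(1) by auto
    then have "emeasure lborel (ball (0::real^'m) r) = 0"
      using emeasure_mono[of "ball 0 r" N lborel] N by auto
    then show False using content_ball_pos[OF r, of "0::real^'m"] by (simp add: measure_def)
  qed
  moreover have "I \<ge> 0" by (simp add: I_def k_def)
  ultimately have I: "I > 0" by simp
  define K where "K x = (1 / I) * k x" for x
  show ?thesis
  proof (rule that[of K])
    have "Ck 1 K" unfolding K_def[abs_def] by (rule Ck_cmult) (use k1 in \<open>simp add: Cc1_iff\<close>)
    then show "Cc1 K" using k0 by (auto simp: Cc1_iff K_def intro!: exI[of _ r])
    show "(LINT x|lborel. K x) = 1" using I by (simp add: K_def I_def[symmetric])
  qed (use I k0 in \<open>auto simp: K_def k_def\<close>)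
qed

lemma conv_mollifier_close:
  fixes f :: "real^'m \<Rightarrow> real"
  assumes k: "Cc \<kappa>" "\<And>x. \<kappa> x \<ge> 0" "\<And>x. norm x \<ge> r \<Longrightarrow> \<kappa> x = 0" "(LINT x|lborel. \<kappa> x) = 1"
    and f: "Cc f" and u: "\<And>x y. dist x y < r \<Longrightarrow> dist (f x) (f y) \<le> e"
  shows "\<bar>conv \<kappa> f x - f x\<bar> \<le> e"
proof -
  have i: "integrable lborel (\<lambda>y. \<kappa> y * f (x - y))"
    using Cc_integrable[OF conv_integrand_Cc(2)[OF k(1) f]] by simp
  note ik = Cc_integrable[OF k(1)]
  have "\<bar>conv \<kappa> f x - f x\<bar> = \<bar>(LINT y|lborel. \<kappa> y * f (x - y)) - (LINT y|lborel. \<kappa> y * f x)\<bar>"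
    by (simp add: conv_altdef[OF k(1) f] k(4))
  also have "\<dots> = \<bar>LINT y|lborel. \<kappa> y * f (x - y) - \<kappa> y * f x\<bar>"
    using i ik by simp
  also have "\<dots> \<le> (LINT y|lborel. \<bar>\<kappa> y * f (x - y) - \<kappa> y * f x\<bar>)"
    by (rule integral_abs_bound)
  also have "\<dots> \<le> (LINT y|lborel. \<kappa> y * e)"
  proof (rule integral_mono)
    fix y
    have "\<bar>\<kappa> y * f (x - y) - \<kappa> y * f x\<bar> = \<kappa> y * \<bar>f (x - y) - f x\<bar>"
      using k(2) by (simp add: abs_mult right_diff_distrib[symmetric])
    also have "\<dots> \<le> \<kappa> y * e"
    proof (cases "norm y < r")
      case True
      then show ?thesis using u[of "x - y" x] k(2) by (intro mult_left_mono) (auto simp: dist_norm)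
    qed (simp add: k(3))
    finally show "\<bar>\<kappa> y * f (x - y) - \<kappa> y * f x\<bar> \<le> \<kappa> y * e" .
  qed (use i ik in auto)
  also have "\<dots> = e" by (simp add: k(4))
  finally show ?thesis .
qed

section \<open>A discrete Gagliardo inequality\<close>

text \<open>Jensen's inequality for \<open>exp\<close> at the points
  \<open>ln (x j)\<close>.\<close>

lemma weighted_AM_GM:
  fixes x w :: "'i \<Rightarrow> real"
  assumes "finite J" "J \<noteq> {}" "\<And>j. j \<in> J \<Longrightarrow> x j > 0" "\<And>j. j \<in> J \<Longrightarrow> w j \<ge> 0" "sum w J = 1"
  shows "(\<Prod>j\<in>J. x j powr w j) \<le> (\<Sum>j\<in>J. w j * x j)"
proof -
  have "(\<Prod>j\<in>J. x j powr w j) = (\<Prod>j\<in>J. exp (w j * ln (x j)))"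
    using assms(3) by (intro prod.cong) (fastforce simp: powr_def)+
  also have "\<dots> = exp (\<Sum>j\<in>J. w j *\<^sub>R ln (x j))"
    using assms(1) by (simp add: exp_sum)
  also have "\<dots> \<le> (\<Sum>j\<in>J. w j * exp (ln (x j)))"
    by (rule convex_on_sum[OF assms(1,2) exp_convex]) (use assms in auto)
  also have "\<dots> = (\<Sum>j\<in>J. w j * x j)"
    using assms(3) by (intro sum.cong) auto
  finally show ?thesis .
qed

text \<open>Normalise each \<open>g j\<close> to have sum 1 and apply the weighted AM-GM inequality
  to every term. Strict positivity matters twice: it permits the division, and it avoids the
  convention \<open>0 powr 0 = 0\<close> for weights that are 0.\<close>

lemma finite_Holder:
  fixes g :: "'i \<Rightarrow> 'b \<Rightarrow> real"
  assumes J: "finite J" "J \<noteq> {}" and A: "finite A" "A \<noteq> {}"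
    and g: "\<And>j t. j \<in> J \<Longrightarrow> g j t > 0" and w: "\<And>j. j \<in> J \<Longrightarrow> w j \<ge> 0" "sum w J = 1"
  shows "(\<Sum>t\<in>A. \<Prod>j\<in>J. g j t powr w j) \<le> (\<Prod>j\<in>J. (\<Sum>t\<in>A. g j t) powr w j)"
proof -
  define G where "G j = (\<Sum>t\<in>A. g j t)" for j
  have G: "G j > 0" if "j \<in> J" for j unfolding G_def using that A g by (intro sum_pos) auto
  have "(\<Sum>t\<in>A. \<Prod>j\<in>J. (g j t / G j) powr w j) \<le> (\<Sum>t\<in>A. \<Sum>j\<in>J. w j * (g j t / G j))"
    using J g G w by (intro sum_mono weighted_AM_GM) auto
  also have "\<dots> = (\<Sum>j\<in>J. w j * (G j / G j))"
    by (subst sum.swap) (simp only: G_def sum_distrib_left[symmetric] sum_divide_distrib[symmetric])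
  also have "\<dots> = sum w J"
    by (rule sum.cong) (use G in \<open>auto simp: less_imp_neq[symmetric]\<close>)
  finally have le: "(\<Sum>t\<in>A. \<Prod>j\<in>J. (g j t / G j) powr w j) \<le> 1" using w by simp
  have "(\<Prod>j\<in>J. g j t powr w j) = (\<Prod>j\<in>J. (g j t / G j) powr w j) * (\<Prod>j\<in>J. G j powr w j)" for t
    unfolding prod.distrib[symmetric]
    by (rule prod.cong) (use g G in \<open>auto simp: powr_mult[symmetric] less_imp_le less_imp_neq[symmetric]\<close>)
  then have "(\<Sum>t\<in>A. \<Prod>j\<in>J. g j t powr w j)
      = (\<Sum>t\<in>A. \<Prod>j\<in>J. (g j t / G j) powr w j) * (\<Prod>j\<in>J. G j powr w j)"
    by (simp add: sum_distrib_right)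
  also have "\<dots> \<le> 1 * (\<Prod>j\<in>J. G j powr w j)"
    by (intro mult_right_mono le prod_nonneg) auto
  finally show ?thesis by (simp add: G_def)
qed

lemma sum_PiE_insert:
  assumes "j \<notin> I"
  shows "(\<Sum>x\<in>PiE (insert j I) (\<lambda>_. A). F x) = (\<Sum>x\<in>PiE I (\<lambda>_. A). \<Sum>t\<in>A. F (x(j := t)))"
proof -
  have "(\<Sum>x\<in>PiE (insert j I) (\<lambda>_. A). F x) = (\<Sum>z\<in>A \<times> PiE I (\<lambda>_. A). F ((snd z)(j := fst z)))"
    unfolding PiE_insert_eq
    by (subst sum.reindex) (use inj_combinator[OF assms, of "\<lambda>_. A"] in \<open>auto simp: case_prod_beta'\<close>)
  also have "\<dots> = (\<Sum>t\<in>A. \<Sum>x\<in>PiE I (\<lambda>_. A). F (x(j := t)))"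
    by (simp add: sum.cartesian_product case_prod_beta')
  finally show ?thesis by (subst (asm) sum.swap)
qed

text \<open>The exponent of \<open>f\<close> is chosen such that summing out one coordinate and applying Hoelder's
  inequality reproduces the inequality for the remaining coordinates.\<close>

lemma discrete_Gagliardo:
  fixes f :: "('i \<Rightarrow> 'b) \<Rightarrow> real"
  assumes A: "finite A" "A \<noteq> {}" and p: "p \<ge> 0" and I: "finite I"
    and f: "\<And>x. f x > 0" and np: "(real (card I) - 1) * p \<le> 1"
  shows "(\<Sum>x\<in>PiE I (\<lambda>_. A). f x powr (1 - (real (card I) - 1) * p) *
            (\<Prod>i\<in>I. (\<Sum>t\<in>A. f (x(i := t))) powr p))
         \<le> (\<Sum>x\<in>PiE I (\<lambda>_. A). f x) powr (1 + p)"
  using I f np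
proof (induction I arbitrary: f)
  case empty
  then show ?case by simp
next
  case (insert j I)
  define e where "e = 1 - real (card I) * p"
  have e: "e \<ge> 0" using insert by (simp add: e_def)
  define G where "G x = (\<Sum>t\<in>A. f (x(j := t)))" for x
  have G: "G x > 0" for x unfolding G_def using A insert.prems(1) by (intro sum_pos) auto
  have np': "(real (card I) - 1) * p \<le> 1" using insert p by (auto simp: algebra_simps)
  have inner: "(\<Sum>t\<in>A. f (x(j := t)) powr e * (\<Prod>i\<in>I. (\<Sum>s\<in>A. f (x(j := t, i := s))) powr p))
      \<le> G x powr e * (\<Prod>i\<in>I. (\<Sum>s\<in>A. G (x(i := s))) powr p)" for x
  proof -
    \<comment> \<open>The free index \<open>j\<close> carries the factor \<open>f\<close> itself,
      with weight \<open>e\<close>; each remaining coordinate carries its line sum, with weight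
      \<open>p\<close>. The weights add up to \<open>e + card I * p = 1\<close>.\<close>
    define g where "g i t = (if i = j then f (x(j := t)) else (\<Sum>s\<in>A. f (x(j := t, i := s))))" for i t
    define w where "w i = (if i = j then e else p)" for i
    have split: "(\<Prod>i\<in>insert j I. h i powr w i) = h j powr e * (\<Prod>i\<in>I. h i powr p)" for h :: "'i \<Rightarrow> real"
      using insert.hyps by (auto simp: w_def intro!: prod.cong arg_cong2[where f="(*)"])
    have gI: "g i t = (\<Sum>s\<in>A. f (x(j := t, i := s)))" if "i \<in> I" for i t
      using that insert.hyps by (auto simp: g_def)
    have "(\<Sum>t\<in>A. g i t) = (\<Sum>s\<in>A. G (x(i := s)))" if "i \<in> I" for i
    proof -
      have "i \<noteq> j" using that insert.hyps by auto
      then have "(\<Sum>t\<in>A. g i t) = (\<Sum>t\<in>A. \<Sum>s\<in>A. f (x(i := s, j := t)))"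
        by (simp add: g_def fun_upd_twist)
      also have "\<dots> = (\<Sum>s\<in>A. G (x(i := s)))" unfolding G_def by (rule sum.swap)
      finally show ?thesis .
    qed
    moreover have "(\<Sum>t\<in>A. g j t) = G x" by (simp add: g_def G_def)
    moreover have "(\<Sum>t\<in>A. \<Prod>i\<in>insert j I. g i t powr w i) \<le> (\<Prod>i\<in>insert j I. (\<Sum>t\<in>A. g i t) powr w i)"
    proof (rule finite_Holder)
      show "g i t > 0" for i t
        unfolding g_def using A insert.prems(1) by (auto intro!: sum_pos)
      have "(\<Sum>i\<in>I. w i) = (\<Sum>i\<in>I. p)"
        using insert.hyps by (intro sum.cong) (auto simp: w_def)
      then show "sum w (insert j I) = 1" using insert.hyps by (simp add: w_def e_def)
    qed (use A e p insert.hyps in \<open>auto simp: w_def\<close>)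
    ultimately show ?thesis unfolding split by (simp add: gI g_def[of j])
  qed
  have "(\<Sum>x\<in>PiE (insert j I) (\<lambda>_. A). f x powr (1 - (real (card (insert j I)) - 1) * p) *
            (\<Prod>i\<in>insert j I. (\<Sum>t\<in>A. f (x(i := t))) powr p))
      = (\<Sum>x\<in>PiE I (\<lambda>_. A). \<Sum>t\<in>A. G x powr p * (f (x(j := t)) powr e *
            (\<Prod>i\<in>I. (\<Sum>s\<in>A. f (x(j := t, i := s))) powr p)))"
    unfolding sum_PiE_insert[OF insert.hyps(2)]
    using insert.hyps by (intro sum.cong) (auto simp: e_def G_def mult_ac)
  also have "\<dots> \<le> (\<Sum>x\<in>PiE I (\<lambda>_. A). G x powr p *
      (G x powr e * (\<Prod>i\<in>I. (\<Sum>s\<in>A. G (x(i := s))) powr p)))"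
    unfolding sum_distrib_left[symmetric]
    by (intro sum_mono mult_left_mono inner) auto
  \<comment> \<open>The line sum in direction \<open>j\<close> does not depend on \<open>t\<close>
    and was pulled out with exponent \<open>p\<close>; together with the exponent \<open>e\<close>
    from Hoelder it gives the exponent for one coordinate fewer.\<close>
  also have "\<dots> = (\<Sum>x\<in>PiE I (\<lambda>_. A). G x powr (1 - (real (card I) - 1) * p) *
      (\<Prod>i\<in>I. (\<Sum>s\<in>A. G (x(i := s))) powr p))"
  proof -
    have "1 - (real (card I) - 1) * p = p + e" by (simp add: e_def algebra_simps)
    then show ?thesis by (simp add: powr_add mult.assoc)
  qed
  also have "\<dots> \<le> (\<Sum>x\<in>PiE I (\<lambda>_. A). G x) powr (1 + p)"
    by (rule insert.IH[OF G np'])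
  also have "(\<Sum>x\<in>PiE I (\<lambda>_. A). G x) = (\<Sum>x\<in>PiE (insert j I) (\<lambda>_. A). f x)"
    unfolding sum_PiE_insert[OF insert.hyps(2)] G_def ..
  finally show ?case .
qed

text \<open>Telescope from \<open>k\<close> up to \<open>N\<close>, where \<open>h\<close> vanishes;
  extending the sum to the whole range makes the bound independent of \<open>k\<close>.\<close>

lemma abs_le_sum_abs_differences:
  fixes h :: "int \<Rightarrow> real"
  assumes "h N = 0" "k \<in> {-N..<N}"
  shows "\<bar>h k\<bar> \<le> (\<Sum>t\<in>{-N..<N}. \<bar>h (t + 1) - h t\<bar>)"
proof -
  have "\<bar>h N - h k\<bar> \<le> (\<Sum>t\<in>{k..<N}. \<bar>h (t + 1) - h t\<bar>)" if "k \<le> N" for k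
    using that
  proof (induction k rule: int_le_induct)
    case base
    then show ?case by simp
  next
    case (step k)
    have "{k - 1..<N} = insert (k - 1) {k..<N}" using step by auto
    then show ?case using step by simp
  qed
  from this[of k] have "\<bar>h k\<bar> \<le> (\<Sum>t\<in>{k..<N}. \<bar>h (t + 1) - h t\<bar>)" using assms by auto
  also have "\<dots> \<le> (\<Sum>t\<in>{-N..<N}. \<bar>h (t + 1) - h t\<bar>)"
    using assms by (intro sum_mono2) auto
  finally show ?thesis .
qed

text \<open>Along each of the m axis-parallel lines through \<open>k\<close>,
  \<open>\<bar>F k\<bar>\<close> is bounded by the sum of \<open>a\<close>. The m bounds, each
  raised to \<open>p = 1/(m-1)\<close>, multiply to the exponent \<open>m p = 1 + p\<close>, and for
  this \<open>p\<close> the extra factor in \<open>discrete_Gagliardo\<close> has exponent 0. A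
  positive majorant \<open>a\<close> replaces the differences themselves, which may vanish.\<close>

lemma discrete_Sobolev:
  fixes F a :: "('m::finite \<Rightarrow> int) \<Rightarrow> real"
  assumes m: "CARD('m) \<ge> 2" and N: "N > 0"
    and F: "\<And>k i. k i = N \<Longrightarrow> F k = 0"
    and a: "\<And>k. a k > 0" "\<And>k i. \<bar>F (k(i := k i + 1)) - F k\<bar> \<le> a k"
  shows "(\<Sum>k\<in>PiE UNIV (\<lambda>_. {-N..<N}). \<bar>F k\<bar> powr (real CARD('m) / (real CARD('m) - 1)))
     \<le> (\<Sum>k\<in>PiE UNIV (\<lambda>_. {-N..<N}). a k) powr (real CARD('m) / (real CARD('m) - 1))"
proof -
  define p where "p = 1 / (real CARD('m) - 1)"
  have p: "p \<ge> 0" "(real CARD('m) - 1) * p = 1" "real CARD('m) / (real CARD('m) - 1) = 1 + p"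
    "real CARD('m) * p = 1 + p"
    using m by (auto simp: p_def field_simps of_nat_diff)
  have "\<bar>F k\<bar> powr (1 + p) \<le> a k powr (1 - (real CARD('m) - 1) * p) *
      (\<Prod>i\<in>UNIV. (\<Sum>t\<in>{-N..<N}. a (k(i := t))) powr p)"
    if k: "k \<in> PiE UNIV (\<lambda>_. {-N..<N})" for k
  proof -
    have "\<bar>F k\<bar> \<le> (\<Sum>t\<in>{-N..<N}. a (k(i := t)))" for i
    proof -
      have "\<bar>F (k(i := k i))\<bar> \<le> (\<Sum>t\<in>{-N..<N}. \<bar>F (k(i := t + 1)) - F (k(i := t))\<bar>)"
        by (rule abs_le_sum_abs_differences[of "\<lambda>t. F (k(i := t))"]) (use k F[of "k(i := N)" i] in auto)
      also have "\<dots> \<le> (\<Sum>t\<in>{-N..<N}. a (k(i := t)))"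
      proof (rule sum_mono)
        fix t show "\<bar>F (k(i := t + 1)) - F (k(i := t))\<bar> \<le> a (k(i := t))"
          using a(2)[of "k(i := t)" i] by simp
      qed
      finally show ?thesis by simp
    qed
    then have "(\<Prod>i\<in>(UNIV::'m set). \<bar>F k\<bar> powr p)
        \<le> (\<Prod>i\<in>UNIV. (\<Sum>t\<in>{-N..<N}. a (k(i := t))) powr p)"
      using p by (intro prod_mono) (auto intro!: powr_mono2)
    moreover have "(\<Prod>i\<in>(UNIV::'m set). \<bar>F k\<bar> powr p) = \<bar>F k\<bar> powr (1 + p)"
      by (cases "F k = 0") (auto simp: powr_power p(4))
    \<comment> \<open>Relies on \<open>a k > 0\<close>, since \<open>0 powr 0\<close> is 0.\<close>
    moreover have "a k powr (1 - (real CARD('m) - 1) * p) = 1"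
      using p(2) a(1)[of k] by simp
    ultimately show ?thesis by simp
  qed
  then have "(\<Sum>k\<in>PiE UNIV (\<lambda>_. {-N..<N}). \<bar>F k\<bar> powr (1 + p)) \<le>
     (\<Sum>k\<in>PiE UNIV (\<lambda>_. {-N..<N}). a k powr (1 - (real CARD('m) - 1) * p) *
      (\<Prod>i\<in>UNIV. (\<Sum>t\<in>{-N..<N}. a (k(i := t))) powr p))"
    by (rule sum_mono)
  also have "\<dots> \<le> (\<Sum>k\<in>PiE UNIV (\<lambda>_. {-N..<N}). a k) powr (1 + p)"
    by (rule discrete_Gagliardo) (use N p a in auto)
  finally show ?thesis by (simp add: p(3))
qed

section \<open>Riemann sums\<close>

definition grid_point :: "nat \<Rightarrow> ('m::finite \<Rightarrow> int) \<Rightarrow> real^'m" where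
  "grid_point n k = (\<chi> i. real_of_int (k i) / real (Suc n))"

text \<open>Half-open, because a cell is attached to its lower corner: the cells with index in
  \<open>grid R n\<close> tile the cube [-R, R)^m.\<close>

definition grid :: "nat \<Rightarrow> nat \<Rightarrow> ('m::finite \<Rightarrow> int) set" where
  "grid R n = PiE UNIV (\<lambda>_. {- int (Suc n * R)..<int (Suc n * R)})"

definition grid_cell :: "nat \<Rightarrow> ('m::finite \<Rightarrow> int) \<Rightarrow> (real^'m) set" where
  "grid_cell n k = {x. \<forall>i. \<lfloor>real (Suc n) * x $ i\<rfloor> = k i}"

definition grid_round :: "nat \<Rightarrow> real^'m \<Rightarrow> 'm \<Rightarrow> int" where
  "grid_round n x i = \<lfloor>real (Suc n) * x $ i\<rfloor>"

lemma finite_grid: "finite (grid R n)"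
  by (simp add: grid_def finite_PiE)

lemma card_grid:
  "(1 / real (Suc n)) ^ CARD('m) * real (card (grid R n :: ('m::finite \<Rightarrow> int) set)) = (2 * real R) ^ CARD('m)"
proof -
  have "card (grid R n :: ('m \<Rightarrow> int) set) = (2 * (Suc n * R)) ^ CARD('m)"
    unfolding grid_def by (simp add: card_PiE nat_add_distrib nat_mult_distrib mult.commute)
  then have "(1 / real (Suc n)) ^ CARD('m) * real (card (grid R n :: ('m \<Rightarrow> int) set))
      = ((1 / real (Suc n)) * (2 * (real (Suc n) * real R))) ^ CARD('m)"
    by (simp only: power_mult_distrib of_nat_mult of_nat_power of_nat_numeral)
  also have "(1 / real (Suc n)) * (2 * (real (Suc n) * real R)) = 2 * real R" by simp
  finally show ?thesis .
qed

text \<open>A half-open cell lies between the open and the closed box with the same corners, and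
  these have equal measure.\<close>

lemma grid_cell_measure:
  fixes k :: "'m::finite \<Rightarrow> int"
  shows "grid_cell n k \<in> sets borel" "emeasure lborel (grid_cell n k) = ennreal ((1 / real (Suc n)) ^ CARD('m))"
proof -
  have meq: "grid_cell n k = (\<Inter>i. {x. \<lfloor>real (Suc n) * x $ i\<rfloor> = k i})"
    by (auto simp: grid_cell_def)
  show m: "grid_cell n k \<in> sets borel"
    unfolding meq by (intro sets.countable_INT'') auto
  define a where "a = grid_point n k"
  define b :: "real^'m" where "b = (\<chi> i. (real_of_int (k i) + 1) / real (Suc n))"
  have sub: "box a b \<subseteq> grid_cell n k" "grid_cell n k \<subseteq> cbox a b"
  proof -
    have *: "(real_of_int (k i) / real (Suc n) \<le> x $ i \<longleftrightarrow> real_of_int (k i) \<le> real (Suc n) * x $ i)"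
        "(real_of_int (k i) / real (Suc n) < x $ i \<longleftrightarrow> real_of_int (k i) < real (Suc n) * x $ i)"
        "(x $ i < (real_of_int (k i) + 1) / real (Suc n) \<longleftrightarrow> real (Suc n) * x $ i < (real_of_int (k i) + 1))" 
        "(x $ i \<le> (real_of_int (k i) + 1) / real (Suc n) \<longleftrightarrow> real (Suc n) * x $ i \<le> (real_of_int (k i) + 1))" for x :: "real^'m" and i
      by (simp_all add: pos_divide_le_eq pos_divide_less_eq pos_le_divide_eq pos_less_divide_eq mult.commute del: of_nat_Suc)
    show "box a b \<subseteq> grid_cell n k" "grid_cell n k \<subseteq> cbox a b"
      unfolding grid_cell_def a_def b_def grid_point_def
      by (auto simp: mem_box_cart * floor_eq_iff less_imp_le simp del: of_nat_Suc)
  qed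
  have c: "measure lborel (cbox a b) = (1 / real (Suc n)) ^ CARD('m)"
  proof -
    have ba: "b $ i - a $ i = 1 / real (Suc n)" for i
      by (simp add: a_def b_def grid_point_def add_divide_distrib)
    then have "a $ i \<le> b $ i" for i by (metis diff_ge_0_iff_ge zero_le_divide_1_iff of_nat_0_le_iff)
    then have "a \<in> cbox a b" by (simp add: mem_box_cart)
    then show ?thesis using ba by (subst content_cbox_cart) auto
  qed
  have "emeasure lborel (cbox a b) = ennreal (measure lborel (cbox a b))"
    using emeasure_lborel_cbox_finite by (metis emeasure_eq_ennreal_measure infinity_ennreal_def less_irrefl)
  moreover have "emeasure lborel (box a b) = emeasure lborel (cbox a b)"
    by (simp add: emeasure_lborel_box_eq emeasure_lborel_cbox_eq)
  moreover have "emeasure lborel (box a b) \<le> emeasure lborel (grid_cell n k)"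
    "emeasure lborel (grid_cell n k) \<le> emeasure lborel (cbox a b)"
    using sub m by (auto intro!: emeasure_mono)
  ultimately show "emeasure lborel (grid_cell n k) = ennreal ((1 / real (Suc n)) ^ CARD('m))"
    using c by (metis order.antisym)
qed

lemma grid_round_close:
  "norm (grid_point n (grid_round n x) - (x::real^'m)) \<le> real CARD('m) / real (Suc n)"
proof -
  have "\<bar>(grid_point n (grid_round n x) - x) $ i\<bar> \<le> 1 / real (Suc n)" for i
  proof -
    have "(grid_point n (grid_round n x) - x) $ i
        = (of_int \<lfloor>real (Suc n) * x $ i\<rfloor> - real (Suc n) * x $ i) / real (Suc n)"
      by (simp add: grid_point_def grid_round_def diff_divide_distrib del: of_nat_Suc)
    moreover have "\<bar>of_int \<lfloor>real (Suc n) * x $ i\<rfloor> - real (Suc n) * x $ i\<bar> \<le> 1"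
      by linarith
    ultimately show ?thesis by (simp add: divide_right_mono)
  qed
  then have "(\<Sum>i\<in>UNIV. \<bar>(grid_point n (grid_round n x) - x) $ i\<bar>) \<le> (\<Sum>i\<in>(UNIV::'m set). 1 / real (Suc n))"
    by (intro sum_mono)
  then show ?thesis using norm_le_l1_cart[of "grid_point n (grid_round n x) - x"] by simp
qed

lemma grid_point_outside:
  assumes "k \<notin> grid R n"
  shows "norm (grid_point n k) \<ge> real R"
proof -
  obtain i where i: "k i \<notin> {- int (Suc n * R)..<int (Suc n * R)}"
    using assms unfolding grid_def by (metis PiE_I UNIV_I)
  then have "\<bar>k i\<bar> \<ge> int (Suc n * R)" by auto
  then have "real_of_int \<bar>k i\<bar> \<ge> real (Suc n * R)" by linarith
  then have "real R \<le> \<bar>grid_point n k $ i\<bar>"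
    by (simp add: grid_point_def pos_le_divide_eq algebra_simps)
  also have "\<dots> \<le> norm (grid_point n k)" by (rule component_le_norm_cart)
  finally show ?thesis .
qed

text \<open>The sum is the integral of the step function that evaluates \<open>g\<close> at the
  rounded point, so dominated convergence applies. Vanishing is asked already for norm equal to
  \<open>R\<close>, since grid points outside the index range satisfy only that weak
  inequality.\<close>

lemma Riemann_sums_tendsto:
  fixes g :: "real^'m \<Rightarrow> 'b::{banach, second_countable_topology}"
  assumes c: "continuous_on UNIV g" and z: "\<And>x. norm x \<ge> real R \<Longrightarrow> g x = 0"
  shows "(\<lambda>n. (1 / real (Suc n)) ^ CARD('m) *\<^sub>R (\<Sum>k\<in>grid R n. g (grid_point n k)))
    \<longlonglongrightarrow> (LINT x|lborel. g x)"
proof -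
  have cc: "Cc g" by (rule CcI[OF c, of "real R"]) (use z in auto)
  obtain B where B: "B > 0" "\<And>x. norm (g x) \<le> B" using Cc_bounded[OF cc] by blast
  define s where "s n x = g (grid_point n (grid_round n x))" for n x
  have s: "s n x = (\<Sum>k\<in>grid R n. indicator (grid_cell n k) x *\<^sub>R g (grid_point n k))" for n x
  proof -
    have "indicator (grid_cell n k) x *\<^sub>R g (grid_point n k)
        = (if grid_round n x = k then g (grid_point n (grid_round n x)) else 0)" for k
    proof -
      have "x \<in> grid_cell n k \<longleftrightarrow> grid_round n x = k"
        by (auto simp: grid_cell_def grid_round_def fun_eq_iff)
      then show ?thesis by auto
    qed
    then have "(\<Sum>k\<in>grid R n. indicator (grid_cell n k) x *\<^sub>R g (grid_point n k))
        = (if grid_round n x \<in> grid R n then s n x else 0)"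
      by (simp add: s_def sum.delta finite_grid)
    also have "\<dots> = s n x" using grid_point_outside z by (auto simp: s_def)
    finally show ?thesis by simp
  qed
  have ind: "integrable lborel (indicat_real (grid_cell n k :: (real^'m) set))"
    "measure lborel (grid_cell n k :: (real^'m) set) = (1 / real (Suc n)) ^ CARD('m)" for n k
    using grid_cell_measure[of n k] by (auto simp: measure_def simp del: of_nat_Suc)
  have "(LINT x|lborel. s n x) = (1 / real (Suc n)) ^ CARD('m) *\<^sub>R (\<Sum>k\<in>grid R n. g (grid_point n k))" for n
    unfolding s using ind
    by (subst Bochner_Integration.integral_sum) (auto simp: scaleR_sum_right simp del: of_nat_Suc)
  moreover have "(\<lambda>n. LINT x|lborel. s n x) \<longlonglongrightarrow> (LINT x|lborel. g x)"
  proof (rule integral_dominated_convergence)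
    show "g \<in> borel_measurable lborel" using Cc_measurable[OF cc] by simp
    show "s n \<in> borel_measurable lborel" for n
      unfolding s[abs_def]
      by (simp, intro borel_measurable_sum borel_measurable_scaleR borel_measurable_indicator
          borel_measurable_const grid_cell_measure(1))
    \<comment> \<open>Rounding moves a point by at most \<open>CARD('m)\<close>, whatever
      \<open>n\<close> is, so all step functions vanish outside this ball.\<close>
    show "integrable lborel (\<lambda>x. B * indicator (cball (0::real^'m) (real R + real CARD('m))) x)"
      by (intro integrable_mult_right integrable_real_indicator emeasure_bounded_finite) auto
    show "AE x in lborel. (\<lambda>n. s n x) \<longlonglongrightarrow> g x"
    proof (rule AE_I2)
      fix x :: "real^'m"
      have "(\<lambda>n. grid_point n (grid_round n x) - x) \<longlonglongrightarrow> 0"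
      proof (rule Lim_null_comparison)
        show "\<forall>\<^sub>F n in sequentially. norm (grid_point n (grid_round n x) - x) \<le> real CARD('m) / real (Suc n)"
          by (intro always_eventually allI grid_round_close)
        show "(\<lambda>n. real CARD('m) / real (Suc n)) \<longlonglongrightarrow> 0"
          by (rule LIMSEQ_Suc[OF lim_const_over_n])
      qed
      then have "(\<lambda>n. grid_point n (grid_round n x)) \<longlonglongrightarrow> x" by (simp add: LIM_zero_iff)
      then show "(\<lambda>n. s n x) \<longlonglongrightarrow> g x" unfolding s_def
        using c by (intro continuous_on_tendsto_compose[OF c]) auto
    qed
    show "AE x in lborel. norm (s n x) \<le> B * indicator (cball 0 (real R + real CARD('m))) x" for n
    proof (rule AE_I2)
      fix x :: "real^'m"
      show "norm (s n x) \<le> B * indicator (cball 0 (real R + real CARD('m))) x"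
      proof (cases "norm x \<le> real R + real CARD('m)")
        case True
        then show ?thesis using B by (simp add: s_def)
      next
        case False
        have "norm (grid_point n (grid_round n x) - x) \<le> real CARD('m)"
          using grid_round_close[of n x]
          by (rule order_trans) (simp add: divide_le_eq mult_le_cancel_left1)
        then have "norm (grid_point n (grid_round n x)) \<ge> real R"
          using False norm_triangle_ineq2[of x "grid_point n (grid_round n x)"]
          by (simp add: norm_minus_commute)
        then show ?thesis using z B by (simp add: s_def)
      qed
    qed
  qed
  ultimately show ?thesis by simp
qed

section \<open>The Gagliardo-Nirenberg-Sobolev inequality and the pairing with \<open>L\<^sub>m\<close>\<close>

lemma continuous_on_abs_powr:
  fixes f :: "'a::topological_space \<Rightarrow> real"
  assumes "continuous_on S f" "p > 0"
  shows "continuous_on S (\<lambda>x. \<bar>f x\<bar> powr p)"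
  using assms by (intro continuous_on_powr' continuous_intros) auto

text \<open>The grid inequality is applied to the values of \<open>\<phi>\<close> at mesh size
  \<open>h n\<close>. The slack \<open>w\<close> absorbs the linearization error; first
  \<open>n\<close> tends to infinity for fixed \<open>w\<close>, then \<open>w\<close> tends to
  0.\<close>

lemma Sobolev_powr:
  fixes \<phi> :: "real^'m \<Rightarrow> real"
  assumes m: "CARD('m) \<ge> 2" and \<phi>: "Cc1 \<phi>"
  defines "q \<equiv> real CARD('m) / (real CARD('m) - 1)"
  shows "(LINT x|lborel. \<bar>\<phi> x\<bar> powr q) \<le> (LINT x|lborel. norm (grad \<phi> x)) powr q"
proof -
  have q: "q > 1" "real CARD('m) + q = real CARD('m) * q"
    using m by (auto simp: q_def field_simps)
  have c: "Cc \<phi>" "Cc (grad \<phi>)" using \<phi> Cc1_grad by (auto simp: Cc1_def)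
  obtain R1 where R1: "\<And>x. norm x > R1 \<Longrightarrow> \<phi> x = 0" using Cc_support[OF c(1)] by blast
  obtain R2 where R2: "\<And>x. norm x > R2 \<Longrightarrow> grad \<phi> x = 0" using Cc_support[OF c(2)] by blast
  define R where "R = Suc (nat \<lceil>max R1 R2\<rceil>)"
  have "real R > max R1 R2" unfolding R_def by linarith
  then have R: "R > 0" "\<And>x. norm x \<ge> real R \<Longrightarrow> \<phi> x = 0" "\<And>x. norm x \<ge> real R \<Longrightarrow> grad \<phi> x = 0"
    using R1 R2 by (auto simp: R_def)
  define h where "h n = 1 / real (Suc n)" for n
  have h: "h n > 0" for n by (simp add: h_def)
  define S where "S n = h n ^ CARD('m) * (\<Sum>k\<in>grid R n. norm (grad \<phi> (grid_point n k)))" for n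
  define P where "P n = h n ^ CARD('m) * (\<Sum>k\<in>grid R n. \<bar>\<phi> (grid_point n k)\<bar> powr q)" for n
  have S: "S \<longlonglongrightarrow> (LINT x|lborel. norm (grad \<phi> x))"
    using Riemann_sums_tendsto[of "\<lambda>x. norm (grad \<phi> x)" R] R c
    by (simp add: S_def[abs_def] h_def Cc_continuous continuous_on_norm del: of_nat_Suc)
  have P: "P \<longlonglongrightarrow> (LINT x|lborel. \<bar>\<phi> x\<bar> powr q)"
    using Riemann_sums_tendsto[of "\<lambda>x. \<bar>\<phi> x\<bar> powr q" R] R q continuous_on_abs_powr[OF Cc_continuous[OF c(1)], of q]
    by (simp add: P_def[abs_def] h_def del: of_nat_Suc)
  have step: "(LINT x|lborel. \<bar>\<phi> x\<bar> powr q)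
      \<le> ((LINT x|lborel. norm (grad \<phi> x)) + (2 * real R) ^ CARD('m) * w) powr q" if w: "w > 0" for w
  proof -
    obtain d where d: "d > 0"
      "\<And>x h. norm h < d \<Longrightarrow> \<bar>\<phi> (x + h) - \<phi> x - grad \<phi> x \<bullet> h\<bar> \<le> w * norm h"
      using Cc1_uniform_linearization[OF \<phi> w] by blast
    have "h \<longlonglongrightarrow> 0" unfolding h_def[abs_def] by (rule LIMSEQ_Suc[OF lim_const_over_n])
    then have "\<forall>\<^sub>F n in sequentially. h n < d" using d(1) by (rule order_tendstoD(2))
    then have ev: "\<forall>\<^sub>F n in sequentially. P n \<le> (S n + (2 * real R) ^ CARD('m) * w) powr q"
    proof eventually_elim
      case (elim n)
      \<comment> \<open>Bounds a difference of \<open>\<phi>\<close> over one mesh width;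
        \<open>w\<close> also makes it strictly positive, as the grid inequality demands.\<close>
      define a where "a k = h n * (norm (grad \<phi> (grid_point n k)) + w)" for k
      have "(\<Sum>k\<in>grid R n. \<bar>\<phi> (grid_point n k)\<bar> powr q) \<le> (\<Sum>k\<in>grid R n. a k) powr q"
        unfolding grid_def q_def
      proof (rule discrete_Sobolev[OF m])
        show "0 < int (Suc n * R)" using R(1) by (metis nat_0_less_mult_iff of_nat_0_less_iff zero_less_Suc)
        fix k :: "'m \<Rightarrow> int" and i
        show "a k > 0" using h w by (auto simp: a_def intro!: mult_pos_pos add_nonneg_pos)
        show "\<phi> (grid_point n k) = 0" if "k i = int (Suc n * R)"
        proof -
          have "k \<notin> grid R n" using that unfolding grid_def by (auto dest!: PiE_mem[where x=i])
          then show ?thesis using R(2) grid_point_outside by blast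
        qed
        have e: "grid_point n (k(i := k i + 1)) = grid_point n k + h n *\<^sub>R axis i 1"
          by (auto simp: grid_point_def vec_eq_iff h_def axis_def add_divide_distrib)
        have nh: "norm (h n *\<^sub>R axis i (1::real)) = h n" using h[of n] by simp
        have "\<bar>\<phi> (grid_point n k + h n *\<^sub>R axis i 1) - \<phi> (grid_point n k)\<bar>
            \<le> \<bar>grad \<phi> (grid_point n k) \<bullet> (h n *\<^sub>R axis i 1)\<bar> + w * h n"
          using d(2)[of "h n *\<^sub>R axis i 1" "grid_point n k"] elim unfolding nh by linarith
        also have "\<dots> \<le> norm (grad \<phi> (grid_point n k)) * h n + w * h n"
          using Cauchy_Schwarz_ineq2[of "grad \<phi> (grid_point n k)" "h n *\<^sub>R axis i 1"]
          unfolding nh by simp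
        finally show "\<bar>\<phi> (grid_point n (k(i := k i + 1))) - \<phi> (grid_point n k)\<bar> \<le> a k"
          unfolding e by (simp add: a_def algebra_simps)
      qed
      also have "(\<Sum>k\<in>grid R n. a k)
          = h n * ((\<Sum>k\<in>grid R n. norm (grad \<phi> (grid_point n k))) + real (card (grid R n :: ('m \<Rightarrow> int) set)) * w)"
        by (simp add: a_def sum_distrib_left[symmetric] sum.distrib)
      finally have "P n \<le> h n ^ CARD('m) * (h n * ((\<Sum>k\<in>grid R n. norm (grad \<phi> (grid_point n k)))
          + real (card (grid R n :: ('m \<Rightarrow> int) set)) * w)) powr q"
        unfolding P_def using h[of n] by (intro mult_left_mono) auto
      also have "\<dots> = (h n ^ CARD('m) * ((\<Sum>k\<in>grid R n. norm (grad \<phi> (grid_point n k)))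
          + real (card (grid R n :: ('m \<Rightarrow> int) set)) * w)) powr q"
      proof -
        define X where "X = (\<Sum>k\<in>grid R n. norm (grad \<phi> (grid_point n k))) + real (card (grid R n :: ('m \<Rightarrow> int) set)) * w"
        have X: "X \<ge> 0" using w by (auto simp: X_def intro!: add_nonneg_nonneg sum_nonneg)
        \<comment> \<open>Scale invariance of the exponent: \<open>m + q = m q\<close>, so the
          powers of the mesh size on both sides agree.\<close>
        have "h n ^ CARD('m) * (h n * X) powr q = h n powr (real CARD('m) + q) * X powr q"
          using h[of n] X by (simp add: powr_mult powr_add powr_realpow)
        also have "\<dots> = (h n powr real CARD('m) * X) powr q"
          using h[of n] X q(2) by (simp add: powr_mult powr_powr)
        finally show ?thesis using h[of n] by (simp add: X_def powr_realpow)
      qed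
      also have "h n ^ CARD('m) * ((\<Sum>k\<in>grid R n. norm (grad \<phi> (grid_point n k)))
          + real (card (grid R n :: ('m \<Rightarrow> int) set)) * w) = S n + (2 * real R) ^ CARD('m) * w"
        using card_grid[where 'm='m, of n R] by (simp add: S_def h_def distrib_left mult.assoc[symmetric] del: of_nat_Suc)
      finally show ?case .
    qed
    have "(\<lambda>n. (S n + (2 * real R) ^ CARD('m) * w) powr q)
        \<longlonglongrightarrow> ((LINT x|lborel. norm (grad \<phi> x)) + (2 * real R) ^ CARD('m) * w) powr q"
      using R w by (intro tendsto_powr tendsto_add S tendsto_const)
        (auto simp: add_nonneg_eq_0_iff)
    from tendsto_le[OF sequentially_bot this P ev] show ?thesis .
  qed
  have "((\<lambda>w. ((LINT x|lborel. norm (grad \<phi> x)) + (2 * real R) ^ CARD('m) * w) powr q)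
      \<longlongrightarrow> ((LINT x|lborel. norm (grad \<phi> x)) + (2 * real R) ^ CARD('m) * 0) powr q) (at_right 0)"
    using q R by (intro tendsto_powr' tendsto_intros)
       (auto simp: eventually_at_filter intro!: always_eventually add_nonneg_nonneg)
  from tendsto_lowerbound[OF this eventually_mono[OF eventually_at_right_less step]]
  show ?thesis by simp
qed

section \<open>Hoelder's inequality and the duality pairing\<close>

text \<open>Young's inequality is integrated after dividing by the norms. Adding
  \<open>t > 0\<close> to both norms avoids a division by zero, and \<open>t\<close> then tends to
  0.\<close>

lemma Holder_inequality:
  fixes f g :: "'a \<Rightarrow> real"
  assumes pq: "1 < p" "1 < q" "1 / p + 1 / q = 1"
    and f: "f \<in> borel_measurable M" "integrable M (\<lambda>x. \<bar>f x\<bar> powr p)"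
    and g: "g \<in> borel_measurable M" "integrable M (\<lambda>x. \<bar>g x\<bar> powr q)"
  shows "integrable M (\<lambda>x. f x * g x)"
    and "\<bar>LINT x|M. f x * g x\<bar>
      \<le> (LINT x|M. \<bar>f x\<bar> powr p) powr (1 / p) * (LINT x|M. \<bar>g x\<bar> powr q) powr (1 / q)"
proof -
  have young: "\<bar>f x * g x\<bar> \<le> \<bar>f x\<bar> powr p / p + \<bar>g x\<bar> powr q / q" for x
    using Youngs_inequality[OF pq, of "\<bar>f x\<bar>" "\<bar>g x\<bar>"] by (simp add: abs_mult)
  show i: "integrable M (\<lambda>x. f x * g x)"
  proof (rule Bochner_Integration.integrable_bound)
    show "integrable M (\<lambda>x. \<bar>f x\<bar> powr p / p + \<bar>g x\<bar> powr q / q)" using f g by auto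
    show "AE x in M. norm (f x * g x) \<le> norm (\<bar>f x\<bar> powr p / p + \<bar>g x\<bar> powr q / q)"
      using young pq by (intro AE_I2) (simp add: abs_of_nonneg)
  qed (use f g in auto)
  define A where "A = (LINT x|M. \<bar>f x\<bar> powr p) powr (1 / p)"
  define B where "B = (LINT x|M. \<bar>g x\<bar> powr q) powr (1 / q)"
  have A: "A powr p = (LINT x|M. \<bar>f x\<bar> powr p)" and B: "B powr q = (LINT x|M. \<bar>g x\<bar> powr q)"
    using pq by (auto simp: A_def B_def powr_powr)
  have nn: "A \<ge> 0" "B \<ge> 0" by (auto simp: A_def B_def)
  have le: "\<bar>LINT x|M. f x * g x\<bar> \<le> (A + t) * (B + t)" if t: "t > 0" for t
  proof -
    define a where "a = A + t"
    define b where "b = B + t"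
    have ab: "a > 0" "b > 0" "A \<le> a" "B \<le> b" using nn t by (auto simp: a_def b_def)
    have pt: "\<bar>f x * g x\<bar> \<le> a * b * (\<bar>f x\<bar> powr p / (p * a powr p) + \<bar>g x\<bar> powr q / (q * b powr q))" for x
      using Youngs_inequality[OF pq, of "\<bar>f x\<bar> / a" "\<bar>g x\<bar> / b"] ab
      by (simp add: abs_mult powr_divide divide_le_eq mult_ac)
    have "\<bar>LINT x|M. f x * g x\<bar> \<le> (LINT x|M. \<bar>f x * g x\<bar>)" by (rule integral_abs_bound)
    also have "\<dots> \<le> (LINT x|M. a * b * (\<bar>f x\<bar> powr p / (p * a powr p) + \<bar>g x\<bar> powr q / (q * b powr q)))"
      using i f g by (intro integral_mono pt) auto
    also have "\<dots> = a * b * (A powr p / (p * a powr p) + B powr q / (q * b powr q))"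
      using f g by (simp add: A B)
    also have "\<dots> \<le> a * b * (1 / p + 1 / q)"
    proof (intro mult_left_mono add_mono)
      have "A powr p \<le> a powr p" "B powr q \<le> b powr q"
        using ab nn pq by (auto intro!: powr_mono2)
      then show "A powr p / (p * a powr p) \<le> 1 / p" "B powr q / (q * b powr q) \<le> 1 / q"
        using pq ab by (auto simp: field_simps)
    qed (use ab in auto)
    finally show ?thesis using pq by (simp add: a_def b_def)
  qed
  have "((\<lambda>t. (A + t) * (B + t)) \<longlongrightarrow> (A + 0) * (B + 0)) (at_right 0)"
    by (intro tendsto_intros)
  then have "\<bar>LINT x|M. f x * g x\<bar> \<le> (A + 0) * (B + 0)"
    by (rule tendsto_lowerbound) (auto intro: eventually_mono[OF eventually_at_right_less[of 0]] le)
  then show "\<bar>LINT x|M. f x * g x\<bar>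
      \<le> (LINT x|M. \<bar>f x\<bar> powr p) powr (1 / p) * (LINT x|M. \<bar>g x\<bar> powr q) powr (1 / q)"
    by (simp add: A_def B_def)
qed

lemma Lnorm_1: "Lnorm 1 V = (LINT x|lebesgue. norm (V x))"
  by (simp add: Lnorm_def)

lemma Lnorm_grad:
  "Cc1 \<phi> \<Longrightarrow> Lnorm 1 (grad \<phi>) = (LINT x|lborel. norm (grad \<phi> x))"
  unfolding Lnorm_1 by (intro continuous_integral_lebesgue continuous_on_norm Cc_continuous Cc1_grad)

lemma Cc_Lspace: "Cc f \<Longrightarrow> p > 0 \<Longrightarrow> f \<in> Lspace p"
  using Cc_integrable_lebesgue[of "\<lambda>x. \<bar>f x\<bar> powr p"] Cc_compose[of f "\<lambda>y. \<bar>y\<bar> powr p"]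
    continuous_on_abs_powr[OF continuous_on_id, of p UNIV] Cc_integrable_lebesgue[of f]
  by (auto simp: Lspace_def)

abbreviation pairing :: "(real^'m \<Rightarrow> real) \<Rightarrow> (real^'m \<Rightarrow> real) \<Rightarrow> real" where
  "pairing \<phi> f \<equiv> LINT x|lebesgue. \<phi> x * f x"

text \<open>The Sobolev exponent \<open>q\<close> is conjugate to m, so Hoelder and Sobolev combine
  with constant 1.\<close>

lemma pairing_bound:
  fixes \<phi> :: "real^'m \<Rightarrow> real"
  assumes m: "CARD('m) \<ge> 2" and \<phi>: "Cc1 \<phi>" and f: "f \<in> Lspace (real CARD('m))"
  shows "integrable lebesgue (\<lambda>x. \<phi> x * f x)"
    and "\<bar>pairing \<phi> f\<bar> \<le> Lnorm (real CARD('m)) f * Lnorm 1 (grad \<phi>)"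
proof -
  define q where "q = real CARD('m) / (real CARD('m) - 1)"
  have q: "1 < q" "1 < real CARD('m)" "1 / q + 1 / real CARD('m) = 1"
    using m by (auto simp: q_def field_simps)
  have c: "Cc \<phi>" using \<phi> by (simp add: Cc1_def)
  have pL: "\<phi> \<in> Lspace q" using Cc_Lspace[OF c] q by simp
  note H = Holder_inequality[OF q, of \<phi> lebesgue f]
  show "integrable lebesgue (\<lambda>x. \<phi> x * f x)" using H(1) pL f by (simp add: Lspace_def)
  have "(LINT x|lebesgue. \<bar>\<phi> x\<bar> powr q) powr (1 / q) \<le> ((LINT x|lborel. norm (grad \<phi> x)) powr q) powr (1 / q)"
    using Sobolev_powr[OF m \<phi>] q
    by (intro powr_mono2)
       (auto simp: q_def continuous_integral_lebesgue continuous_on_abs_powr Cc_continuous[OF c])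
  also have "\<dots> = Lnorm 1 (grad \<phi>)" using q by (simp add: Lnorm_grad[OF \<phi>] powr_powr)
  finally have "(LINT x|lebesgue. \<bar>\<phi> x\<bar> powr q) powr (1 / q) * Lnorm (real CARD('m)) f
      \<le> Lnorm 1 (grad \<phi>) * Lnorm (real CARD('m)) f"
    by (intro mult_right_mono) (auto simp: Lnorm_def)
  then show "\<bar>pairing \<phi> f\<bar> \<le> Lnorm (real CARD('m)) f * Lnorm 1 (grad \<phi>)"
    using H(2) pL f by (simp add: Lspace_def Lnorm_def mult.commute)
qed

section \<open>Dense families in \<open>L\<^sub>p\<close>\<close>

text \<open>A crude stand-in for Minkowski's inequality; the factor \<open>2 powr p\<close> is
  harmless because the errors it multiplies can be made arbitrarily small.\<close>

lemma abs_add_powr_le: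
  fixes a b p :: real
  assumes "p > 0"
  shows "\<bar>a + b\<bar> powr p \<le> 2 powr p * (\<bar>a\<bar> powr p + \<bar>b\<bar> powr p)"
proof -
  have "\<bar>a + b\<bar> powr p \<le> (2 * max \<bar>a\<bar> \<bar>b\<bar>) powr p"
    using assms by (intro powr_mono2) auto
  also have "\<dots> = 2 powr p * max \<bar>a\<bar> \<bar>b\<bar> powr p" by (simp add: powr_mult)
  also have "max \<bar>a\<bar> \<bar>b\<bar> powr p \<le> \<bar>a\<bar> powr p + \<bar>b\<bar> powr p" by (auto simp: max_def)
  finally show ?thesis by (simp add: mult_left_mono)
qed

lemma Lspace_cmult: "f \<in> Lspace p \<Longrightarrow> (\<lambda>x. c * f x) \<in> Lspace p"
  by (auto simp: Lspace_def abs_mult powr_mult)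

lemma Lspace_add:
  assumes "f \<in> Lspace p" "g \<in> Lspace p" "p > 0"
  shows "(\<lambda>x. f x + g x) \<in> Lspace p"
proof -
  have "integrable lebesgue (\<lambda>x. \<bar>f x + g x\<bar> powr p)"
  proof (rule Bochner_Integration.integrable_bound)
    show "integrable lebesgue (\<lambda>x. 2 powr p * (\<bar>f x\<bar> powr p + \<bar>g x\<bar> powr p))"
      using assms by (auto simp: Lspace_def)
    show "AE x in lebesgue. norm (\<bar>f x + g x\<bar> powr p) \<le> norm (2 powr p * (\<bar>f x\<bar> powr p + \<bar>g x\<bar> powr p))"
      using abs_add_powr_le[OF assms(3)] by (intro AE_I2) (simp add: abs_mult)
  qed (use assms in \<open>auto simp: Lspace_def\<close>)
  then show ?thesis using assms by (auto simp: Lspace_def)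
qed

lemma Lspace_diff:
  "f \<in> Lspace p \<Longrightarrow> g \<in> Lspace p \<Longrightarrow> p > 0 \<Longrightarrow> (\<lambda>x. f x - g x) \<in> Lspace p"
  using Lspace_add[of f p "\<lambda>x. (-1) * g x"] Lspace_cmult[of g p "-1"] by simp

lemma Lnorm_nonneg: "Lnorm p f \<ge> 0"
  by (simp add: Lnorm_def)

lemma Lnorm_less:
  assumes "p > 0" "e > 0" "(LINT x|lebesgue. \<bar>f x\<bar> powr p) < e powr p"
  shows "Lnorm p f < e"
proof -
  have "Lnorm p f < (e powr p) powr (1 / p)"
    unfolding Lnorm_def real_norm_def using assms by (intro powr_less_mono2) auto
  then show ?thesis using assms by (simp add: powr_powr)
qed

lemma Lnorm_cmult:
  fixes f :: "real^'m \<Rightarrow> real"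
  assumes "p > 0" shows "Lnorm p (\<lambda>x. c * f x) = \<bar>c\<bar> * Lnorm p f"
  using assms by (simp add: Lnorm_def abs_mult powr_mult powr_powr)

lemma integrable_indicator_cball:
  "integrable lebesgue (indicat_real (cball (0::'a::euclidean_space) R))"
proof -
  have "emeasure lborel (cball (0::'a) R) < \<infinity>" by (rule emeasure_bounded_finite) simp
  then show ?thesis by (intro integrable_real_indicator) auto
qed

lemma Lspace_bounded_support:
  fixes f :: "real^'m \<Rightarrow> real"
  assumes f: "f \<in> borel_measurable lebesgue" and p: "p > 0"
    and B: "\<And>x. norm x \<le> R \<Longrightarrow> \<bar>f x\<bar> \<le> B" and z: "\<And>x. norm x > R \<Longrightarrow> f x = 0"
  shows "f \<in> Lspace p"
    and "(LINT x|lebesgue. \<bar>f x\<bar> powr p) \<le> B powr p * measure lebesgue (cball (0::real^'m) R)"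
proof -
  have bd: "\<bar>f x\<bar> powr p \<le> B powr p * indicator (cball 0 R) x" for x
    using B[of x] z[of x] p by (auto simp: indicator_def intro!: powr_mono2)
  have i: "integrable lebesgue (\<lambda>x. B powr p * indicator (cball (0::real^'m) R) x)"
    by (intro integrable_mult_right integrable_indicator_cball)
  have i': "integrable lebesgue (\<lambda>x. \<bar>f x\<bar> powr p)"
    by (rule Bochner_Integration.integrable_bound[OF i]) (use f bd in \<open>auto intro!: AE_I2\<close>)
  then show "f \<in> Lspace p" using f by (simp add: Lspace_def)
  have "(LINT x|lebesgue. \<bar>f x\<bar> powr p) \<le> (LINT x|lebesgue. B powr p * indicator (cball (0::real^'m) R) x)"
    by (rule integral_mono[OF i' i bd])
  then show "(LINT x|lebesgue. \<bar>f x\<bar> powr p) \<le> B powr p * measure lebesgue (cball (0::real^'m) R)"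
    by simp
qed

text \<open>Measurability supplies continuous functions converging to \<open>f\<close> off a null
  set. Clipping their values to [-k, k] and multiplying by a cutoff that is 1 on the ball of radius
  \<open>k\<close> keeps the limit and yields a bounded majorant of compact support.\<close>

lemma Cc_dense_bounded:
  fixes f :: "real^'m \<Rightarrow> real"
  assumes f: "f \<in> borel_measurable lebesgue" and p: "p > 0" and k: "k > 0"
    and bd: "\<And>x. \<bar>f x\<bar> \<le> k" "\<And>x. norm x > k \<Longrightarrow> f x = 0" and e: "e > 0"
  shows "\<exists>g. Cc g \<and> (LINT x|lebesgue. \<bar>f x - g x\<bar> powr p) < e"
proof -
  have "f measurable_on UNIV"
    using lebesgue_measurable_imp_measurable_on_real[of f UNIV] f bd by simp
  then obtain N g where N: "negligible N" "\<And>n. continuous_on UNIV (g n)"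
    "\<And>x. x \<notin> N \<Longrightarrow> (\<lambda>n. g n x) \<longlonglongrightarrow> f x"
    unfolding measurable_on_def by auto
  define c where "c x = max 0 (min 1 (k + 1 - norm x))" for x :: "real^'m"
  define h where "h n x = max (- k) (min k (g n x)) * c x" for n x
  have hc: "Cc (h n)" for n
    by (rule CcI[of _ "k + 1"]) (auto simp: h_def[abs_def] c_def intro!: continuous_intros N)
  have hm: "h n \<in> borel_measurable lebesgue" for n
    using Cc_Lspace[OF hc p] by (simp add: Lspace_def)
  have hf: "(\<lambda>n. h n x) \<longlonglongrightarrow> f x" if "x \<notin> N" for x
  proof -
    have "(\<lambda>n. h n x) \<longlonglongrightarrow> max (- k) (min k (f x)) * c x"
      unfolding h_def using N(3)[OF that] by (intro tendsto_intros)
    also have "max (- k) (min k (f x)) = f x" using bd(1)[of x] by auto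
    also have "f x * c x = f x" using bd(2)[of x] by (cases "norm x > k") (auto simp: c_def)
    finally show ?thesis .
  qed
  have hb: "\<bar>h n x\<bar> \<le> k" "norm x > k + 1 \<Longrightarrow> h n x = 0" for n x
  proof -
    have "\<bar>h n x\<bar> \<le> k * 1" unfolding h_def abs_mult
      by (intro mult_mono) (use k in \<open>auto simp: c_def\<close>)
    then show "\<bar>h n x\<bar> \<le> k" by simp
  qed (simp add: h_def c_def)
  have "(\<lambda>n. LINT x|lebesgue. \<bar>f x - h n x\<bar> powr p) \<longlonglongrightarrow> (LINT x|(lebesgue :: (real^'m) measure). 0)"
  proof (rule integral_dominated_convergence[where w="\<lambda>x. (2 * k) powr p * indicator (cball 0 (k + 1)) x"])
    show "integrable lebesgue (\<lambda>x. (2 * k) powr p * indicator (cball (0::real^'m) (k + 1)) x)"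
      by (intro integrable_mult_right integrable_indicator_cball)
    show "(\<lambda>x. \<bar>f x - h n x\<bar> powr p) \<in> borel_measurable lebesgue" for n
      using f hm[of n] by measurable
    show "AE x in lebesgue. (\<lambda>n. \<bar>f x - h n x\<bar> powr p) \<longlonglongrightarrow> 0"
    proof (rule AE_I'[of N])
      show "N \<in> null_sets lebesgue" using N(1) by (simp add: negligible_iff_null_sets)
      show "{x \<in> space lebesgue. \<not> (\<lambda>n. \<bar>f x - h n x\<bar> powr p) \<longlonglongrightarrow> 0} \<subseteq> N"
      proof (rule subsetI, rule ccontr)
        fix x assume x: "x \<in> {x \<in> space lebesgue. \<not> (\<lambda>n. \<bar>f x - h n x\<bar> powr p) \<longlonglongrightarrow> 0}" "x \<notin> N"
        have "(\<lambda>n. \<bar>f x - h n x\<bar> powr p) \<longlonglongrightarrow> \<bar>f x - f x\<bar> powr p"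
          by (intro tendsto_powr' tendsto_intros hf x) (use p in auto)
        then show False using x by simp
      qed
    qed
    show "AE x in lebesgue. norm (\<bar>f x - h n x\<bar> powr p) \<le> (2 * k) powr p * indicator (cball 0 (k + 1)) x" for n
    proof (rule AE_I2)
      fix x :: "real^'m"
      have "\<bar>f x - h n x\<bar> \<le> \<bar>f x\<bar> + \<bar>h n x\<bar>" by (rule abs_triangle_ineq4)
      also have "\<dots> \<le> 2 * k" using bd(1)[of x] hb(1)[of n x] by simp
      finally have "\<bar>f x - h n x\<bar> \<le> 2 * k" .
      then show "norm (\<bar>f x - h n x\<bar> powr p) \<le> (2 * k) powr p * indicator (cball 0 (k + 1)) x"
        using bd(2)[of x] hb(2)[of x n] p by (auto simp: indicator_def intro!: powr_mono2)
    qed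
  qed auto
  then have "\<forall>\<^sub>F n in sequentially. (LINT x|lebesgue. \<bar>f x - h n x\<bar> powr p) < e"
    using e by (intro order_tendstoD(2)) auto
  then show ?thesis using hc by (auto simp: eventually_sequentially)
qed

text \<open>Truncating \<open>f\<close> both in height and in space reduces to the bounded case; the
  truncation error is dominated by \<open>\<bar>f\<bar> powr p\<close> itself.\<close>

lemma Cc_dense:
  fixes f :: "real^'m \<Rightarrow> real"
  assumes f: "f \<in> Lspace p" and p: "p > 0" and e: "e > 0"
  shows "\<exists>g. Cc g \<and> Lnorm p (\<lambda>x. f x - g x) < e"
proof -
  have fm: "f \<in> borel_measurable lebesgue" and fi: "integrable lebesgue (\<lambda>x. \<bar>f x\<bar> powr p)"
    using f by (auto simp: Lspace_def)
  define t where "t k x = (if norm x \<le> real k \<and> \<bar>f x\<bar> \<le> real k then f x else 0)" for k x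
  have tm: "t k \<in> borel_measurable lebesgue" for k
  proof -
    have 1: "(\<lambda>x. if \<bar>f x\<bar> \<le> real k then f x else 0) \<in> borel_measurable lebesgue"
      using fm by measurable
    have 2: "indicat_real (cball (0::real^'m) (real k)) \<in> borel_measurable lebesgue"
      by (intro borel_measurable_indicator) simp
    have "t k = (\<lambda>x. indicat_real (cball 0 (real k)) x * (if \<bar>f x\<bar> \<le> real k then f x else 0))"
      by (auto simp: t_def fun_eq_iff)
    then show ?thesis using borel_measurable_times[OF 2 1] by (simp only:)
  qed
  \<comment> \<open>Two errors below \<open>d\<close>, enlarged by the factor
    \<open>2 powr p\<close>, stay below \<open>e powr p\<close>.\<close>
  define d where "d = e powr p / (2 powr p * 2)"
  have d: "d > 0" using e by (simp add: d_def)
  have "(\<lambda>k. LINT x|lebesgue. \<bar>f x - t k x\<bar> powr p) \<longlonglongrightarrow> (LINT x|(lebesgue :: (real^'m) measure). 0)"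
  proof (rule integral_dominated_convergence[OF _ _ fi])
    show "(\<lambda>x. \<bar>f x - t k x\<bar> powr p) \<in> borel_measurable lebesgue" for k
      using fm tm[of k] by measurable
    show "AE x in lebesgue. (\<lambda>k. \<bar>f x - t k x\<bar> powr p) \<longlonglongrightarrow> 0"
    proof (rule AE_I2)
      fix x
      obtain K where K: "norm x \<le> real K" "\<bar>f x\<bar> \<le> real K"
        using real_arch_simple[of "max (norm x) \<bar>f x\<bar>"] by auto
      have "\<forall>\<^sub>F k in sequentially. \<bar>f x - t k x\<bar> powr p = 0"
        unfolding eventually_sequentially
      proof (intro exI allI impI)
        fix k assume "K \<le> k"
        then have "real K \<le> real k" by simp
        then show "\<bar>f x - t k x\<bar> powr p = 0" using K by (auto simp: t_def)
      qed
      then show "(\<lambda>k. \<bar>f x - t k x\<bar> powr p) \<longlonglongrightarrow> 0" by (rule tendsto_eventually)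
    qed
    show "AE x in lebesgue. norm (\<bar>f x - t k x\<bar> powr p) \<le> \<bar>f x\<bar> powr p" for k
      by (rule AE_I2) (auto simp: t_def)
  qed auto
  then have "\<forall>\<^sub>F k in sequentially. (LINT x|lebesgue. \<bar>f x - t k x\<bar> powr p) < d"
    using d by (intro order_tendstoD(2)) auto
  then obtain K where "\<forall>k\<ge>K. (LINT x|lebesgue. \<bar>f x - t k x\<bar> powr p) < d"
    by (auto simp: eventually_sequentially)
  \<comment> \<open>\<open>Suc K\<close> instead of \<open>K\<close> makes the truncation level
    positive, as \<open>Cc_dense_bounded\<close> requires.\<close>
  then have K: "(LINT x|lebesgue. \<bar>f x - t (Suc K) x\<bar> powr p) < d" by simp
  have tb: "\<bar>t (Suc K) x\<bar> \<le> real (Suc K)" "norm x > real (Suc K) \<Longrightarrow> t (Suc K) x = 0" for x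
    by (auto simp: t_def)
  obtain g where g: "Cc g" "(LINT x|lebesgue. \<bar>t (Suc K) x - g x\<bar> powr p) < d"
    using Cc_dense_bounded[OF tm[of "Suc K"] p _ tb d] by auto
  have tL: "t (Suc K) \<in> Lspace p"
    by (rule Lspace_bounded_support(1)[OF tm p tb])
  note gL = Cc_Lspace[OF g(1) p]
  have "(LINT x|lebesgue. \<bar>f x - g x\<bar> powr p)
      \<le> (LINT x|lebesgue. 2 powr p * (\<bar>f x - t (Suc K) x\<bar> powr p + \<bar>t (Suc K) x - g x\<bar> powr p))"
  proof (rule integral_mono)
    show "\<bar>f x - g x\<bar> powr p \<le> 2 powr p * (\<bar>f x - t (Suc K) x\<bar> powr p + \<bar>t (Suc K) x - g x\<bar> powr p)" for x
      using abs_add_powr_le[OF p, of "f x - t (Suc K) x" "t (Suc K) x - g x"] by simp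
  qed (use Lspace_diff[OF f gL p] Lspace_diff[OF f tL p] Lspace_diff[OF tL gL p] in \<open>auto simp: Lspace_def\<close>)
  also have "\<dots> = 2 powr p * ((LINT x|lebesgue. \<bar>f x - t (Suc K) x\<bar> powr p) + (LINT x|lebesgue. \<bar>t (Suc K) x - g x\<bar> powr p))"
    using Lspace_diff[OF f tL p] Lspace_diff[OF tL gL p] by (simp add: Lspace_def)
  also have "\<dots> < 2 powr p * (d + d)" using K g by (intro mult_strict_left_mono add_strict_mono) auto
  also have "\<dots> = e powr p" by (simp add: d_def)
  finally have "Lnorm p (\<lambda>x. f x - g x) < e" by (rule Lnorm_less[OF p e])
  then show ?thesis using g(1) by blast
qed

section \<open>Polynomials as the span of a countable family\<close>

text \<open>Monomials are indexed by words in the coordinates. Since \<open>'m list\<close> is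
  countable, testing against all polynomials reduces to countably many functions.\<close>

inductive monomial_span :: "(real^'m \<Rightarrow> real) \<Rightarrow> bool" where
  monomial: "monomial_span (\<lambda>x. prod_list (map (($) x) l))"
| add: "monomial_span f \<Longrightarrow> monomial_span g \<Longrightarrow> monomial_span (\<lambda>x. f x + g x)"
| cmult: "monomial_span f \<Longrightarrow> monomial_span (\<lambda>x. c * f x)"

lemma monomial_span_continuous: "monomial_span f \<Longrightarrow> continuous_on UNIV f"
proof (induction rule: monomial_span.induct)
  case (monomial l)
  then show ?case by (induction l) (auto intro!: continuous_intros)
qed (auto intro: continuous_intros)

lemma monomial_span_mult_coordinate: "monomial_span f \<Longrightarrow> monomial_span (\<lambda>x. x $ i * f x)"
proof (induction rule: monomial_span.induct)
  case (monomial l)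
  show ?case using monomial_span.monomial[of "i # l"] by simp
next
  case (add f g)
  then show ?case by (auto simp: distrib_left intro: monomial_span.add)
next
  case (cmult f c)
  then show ?case using monomial_span.cmult[of "\<lambda>x. x $ i * f x" c] by (simp add: mult_ac)
qed

lemma monomial_span_sum:
  "(\<And>i. i \<in> I \<Longrightarrow> monomial_span (f i)) \<Longrightarrow> monomial_span (\<lambda>x. \<Sum>i\<in>I. f i x)"
proof (induction I rule: infinite_finite_induct)
  case (insert i I)
  then show ?case by (auto intro: monomial_span.add)
qed (use monomial_span.cmult[OF monomial_span.monomial, of 0] in auto)

text \<open>Treating a polynomial as a multiplication operator makes the product case a composition,
  so products of two general elements of the span never have to be expanded.\<close>

lemma monomial_span_mult_polynomial:
  "real_polynomial_function f \<Longrightarrow> monomial_span g \<Longrightarrow> monomial_span (\<lambda>x. f x * g x)"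
proof (induction arbitrary: g rule: real_polynomial_function.induct)
  case (linear f)
  interpret bounded_linear f by fact
  have "f x * g x = (\<Sum>i\<in>UNIV. f (axis i 1) * (x $ i * g x))" for x
  proof -
    have "f x = f (\<Sum>i\<in>UNIV. x $ i *\<^sub>R axis i 1)"
      using basis_expansion[of x] by (simp add: scalar_mult_eq_scaleR)
    also have "\<dots> = (\<Sum>i\<in>UNIV. x $ i * f (axis i 1))" by (simp add: sum scaleR)
    finally have "f x * g x = (\<Sum>i\<in>UNIV. x $ i * f (axis i 1)) * g x" by simp
    then show ?thesis by (simp only: sum_distrib_right) (simp only: mult_ac)
  qed
  then show ?case
    using linear.prems by (auto intro!: monomial_span_sum monomial_span.cmult monomial_span_mult_coordinate)
next
  case (const c)
  then show ?case by (rule monomial_span.cmult)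
next
  case (add p q)
  from monomial_span.add[OF add.IH(1)[OF add.prems] add.IH(2)[OF add.prems]]
  show ?case by (simp add: distrib_right)
next
  case (mult p q)
  from mult.IH(1)[OF mult.IH(2)[OF mult.prems]]
  show ?case by (simp add: mult.assoc)
qed

lemma monomial_span_polynomial: "real_polynomial_function f \<Longrightarrow> monomial_span f"
  using monomial_span_mult_polynomial[OF _ monomial_span.monomial[of "[]"]] by simp

lemma Lspace_cut_continuous:
  fixes f :: "real^'m \<Rightarrow> real"
  assumes "continuous_on UNIV f" "p > 0"
  shows "(\<lambda>x. indicator (cball 0 R) x * f x) \<in> Lspace p"
proof -
  have "bounded (f ` cball 0 R)"
    by (intro compact_imp_bounded compact_continuous_image continuous_on_subset[OF assms(1)]) auto
  then obtain B where "\<And>y. y \<in> f ` cball 0 R \<Longrightarrow> norm y \<le> B" unfolding bounded_iff by blast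
  then have B: "\<And>x. norm x \<le> R \<Longrightarrow> \<bar>f x\<bar> \<le> B" by auto
  have "f \<in> borel_measurable borel" using assms(1) by (rule borel_measurable_continuous_onI)
  then have "(\<lambda>x. indicator (cball 0 R) x * f x) \<in> borel_measurable lborel"
    by (intro borel_measurable_times borel_measurable_indicator) auto
  then show ?thesis
    using B by (intro Lspace_bounded_support(1)[where R=R and B=B] assms(2)) (auto simp: measurable_completion)
qed

lemma polynomial_approximation:
  fixes g :: "real^'m \<Rightarrow> real"
  assumes g: "Cc g" and p: "p > 0" and e: "e > 0"
  shows "\<exists>h k. monomial_span h \<and> Lnorm p (\<lambda>x. g x - indicator (cball 0 (real k)) x * h x) < e"
proof -
  obtain R where R: "R > 0" "\<And>x. norm x > R \<Longrightarrow> g x = 0" using Cc_support[OF g] by blast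
  obtain k where k: "R \<le> real k" using real_arch_simple by blast
  define M where "M = measure lebesgue (cball (0::real^'m) (real k))"
  \<comment> \<open>Uniform error \<open>d\<close> on a ball of measure \<open>M\<close> contributes
    \<open>d powr p * M\<close>, which is less than \<open>e powr p\<close>.\<close>
  define d where "d = (e powr p / (M + 1)) powr (1 / p)"
  have M: "M \<ge> 0" by (simp add: M_def)
  have d: "d > 0" "d powr p = e powr p / (M + 1)" using e p M by (auto simp: d_def powr_powr add_nonneg_eq_0_iff)
  obtain h where h: "real_polynomial_function h" "\<And>x. x \<in> cball 0 (real k) \<Longrightarrow> \<bar>g x - h x\<bar> < d"
    using Stone_Weierstrass_real_polynomial_function[of "cball 0 (real k)" g d] d
      continuous_on_subset[OF Cc_continuous[OF g]] by auto
  note hs = monomial_span_polynomial[OF h(1)]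
  have dL: "(\<lambda>x. g x - indicator (cball 0 (real k)) x * h x) \<in> Lspace p"
    by (intro Lspace_diff Cc_Lspace Lspace_cut_continuous monomial_span_continuous hs g p)
  have "(LINT x|lebesgue. \<bar>g x - indicator (cball 0 (real k)) x * h x\<bar> powr p) \<le> d powr p * M"
    unfolding M_def
  proof (rule Lspace_bounded_support(2)[OF _ p])
    show "(\<lambda>x. g x - indicator (cball 0 (real k)) x * h x) \<in> borel_measurable lebesgue"
      using dL by (simp add: Lspace_def)
    fix x :: "real^'m"
    show "\<bar>g x - indicator (cball 0 (real k)) x * h x\<bar> \<le> d" if "norm x \<le> real k"
      using that h(2)[of x] by simp
    show "g x - indicator (cball 0 (real k)) x * h x = 0" if "norm x > real k"
      using that R k by simp
  qed
  also have "\<dots> = e powr p * (M / (M + 1))" by (simp add: d)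
  also have "\<dots> < e powr p * 1" using e M by (intro mult_strict_left_mono) auto
  finally have "Lnorm p (\<lambda>x. g x - indicator (cball 0 (real k)) x * h x) < e"
    using Lnorm_less[OF p e] by simp
  then show ?thesis using hs by blast
qed

section \<open>The Hahn-Banach theorem\<close>

text \<open>Linear functionals on a space \<open>V\<close> of functions are represented by their graphs. A graph that is
  dominated by a seminorm is automatically single-valued.\<close>

definition dominated_graph ::
  "('a \<Rightarrow> 'b::real_vector) set \<Rightarrow> (('a \<Rightarrow> 'b) \<Rightarrow> real) \<Rightarrow> (('a \<Rightarrow> 'b) \<times> real) set \<Rightarrow> bool" where
  "dominated_graph V p G \<longleftrightarrow> G \<subseteq> V \<times> UNIV \<and> ((\<lambda>x. 0), 0) \<in> G \<and>
     (\<forall>f a g b c. (f, a) \<in> G \<longrightarrow> (g, b) \<in> G \<longrightarrow> ((\<lambda>x. f x + c *\<^sub>R g x), a + c * b) \<in> G) \<and>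
     (\<forall>f a. (f, a) \<in> G \<longrightarrow> a \<le> p f)"

text \<open>The value \<open>b\<close> at \<open>h\<close> must lie above all
  \<open>a - p (f - h)\<close> and below all \<open>p (g + h) - a\<close>. Subadditivity makes these
  bounds compatible, the supremum of the lower ones is taken, and positive homogeneity carries the
  two bounds to all multiples of \<open>h\<close>.\<close>

lemma dominated_graph_extend:
  fixes V :: "('a \<Rightarrow> 'b::real_vector) set"
  assumes V: "\<And>f g c. f \<in> V \<Longrightarrow> g \<in> V \<Longrightarrow> (\<lambda>x. f x + c *\<^sub>R g x) \<in> V"
    and p_add: "\<And>f g. f \<in> V \<Longrightarrow> g \<in> V \<Longrightarrow> p (\<lambda>x. f x + g x) \<le> p f + p g"
    and p_scale: "\<And>f c. f \<in> V \<Longrightarrow> c \<ge> 0 \<Longrightarrow> p (\<lambda>x. c *\<^sub>R f x) = c * p f"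
    and G: "dominated_graph V p G" and h: "h \<in> V"
  shows "\<exists>G' b. dominated_graph V p G' \<and> G \<subseteq> G' \<and> (h, b) \<in> G'"
proof -
  have G0: "G \<subseteq> V \<times> UNIV" "((\<lambda>x. 0), 0) \<in> G" 
    and Gl: "\<And>f a g b c. (f, a) \<in> G \<Longrightarrow> (g, b) \<in> G \<Longrightarrow> ((\<lambda>x. f x + c *\<^sub>R g x), a + c * b) \<in> G"
    and Gp: "\<And>f a. (f, a) \<in> G \<Longrightarrow> a \<le> p f"
    using G by (auto simp: dominated_graph_def)
  have Gs: "((\<lambda>x. c *\<^sub>R f x), c * a) \<in> G" if "(f, a) \<in> G" for f a c
    using Gl[OF G0(2) that, of c] by simp
  have zV: "(\<lambda>x. 0) \<in> V" using G0 by auto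
  have Vs: "(\<lambda>x. c *\<^sub>R f x) \<in> V" if "f \<in> V" for f c using V[OF zV that, of c] by simp
  define L where "L = {a - p (\<lambda>x. f x - h x) |f a. (f, a) \<in> G}"
  have key: "a - p (\<lambda>x. f x - h x) \<le> p (\<lambda>x. g x + h x) - b" if "(f, a) \<in> G" "(g, b) \<in> G" for f a g b
  proof -
    have fg: "f \<in> V" "g \<in> V" using that G0 by auto
    have "a + b \<le> p (\<lambda>x. f x + g x)" using Gp[OF Gl[OF that, of 1]] by simp
    also have "(\<lambda>x. f x + g x) = (\<lambda>x. (f x - h x) + (g x + h x))" by auto
    also have "p \<dots> \<le> p (\<lambda>x. f x - h x) + p (\<lambda>x. g x + h x)"
      using V[OF fg(1) h, of "-1"] V[OF fg(2) h, of 1] by (intro p_add) auto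
    finally show ?thesis by simp
  qed
  have L0: "L \<noteq> {}" using G0(2) by (auto simp: L_def)
  have Lb: "bdd_above L" unfolding L_def bdd_above_def using key[OF _ G0(2)] by blast
  define b where "b = Sup L"
  have b1: "a - p (\<lambda>x. f x - h x) \<le> b" if "(f, a) \<in> G" for f a
    unfolding b_def using that by (intro cSup_upper Lb) (auto simp: L_def)
  have b2: "b \<le> p (\<lambda>x. g x + h x) - a" if "(g, a) \<in> G" for g a
    unfolding b_def using key[OF _ that] by (intro cSup_least L0) (auto simp: L_def)
  define G' where "G' = {((\<lambda>x. f x + c *\<^sub>R h x), a + c * b) |f a c. (f, a) \<in> G}"
  have dom: "a + c * b \<le> p (\<lambda>x. f x + c *\<^sub>R h x)" if fa: "(f, a) \<in> G" for f a c
  proof -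
    have f: "f \<in> V" using fa G0 by auto
    consider "c = 0" | "c > 0" | "c < 0" by linarith
    then show ?thesis
    proof cases
      case 1 then show ?thesis using Gp[OF fa] by simp
    next
      case 2
      have "c * b \<le> c * (p (\<lambda>x. (1 / c) *\<^sub>R f x + h x) - (1 / c) * a)"
        using b2[OF Gs[OF fa, of "1 / c"]] 2 by (intro mult_left_mono) auto
      also have "\<dots> = p (\<lambda>x. c *\<^sub>R ((1 / c) *\<^sub>R f x + h x)) - a"
        using 2 V[OF Vs[OF f, of "1 / c"] h, of 1] by (simp add: p_scale right_diff_distrib)
      finally show ?thesis using 2 by (simp add: scaleR_add_right)
    next
      case 3
      define d where "d = - c"
      have d: "d > 0" using 3 by (simp add: d_def)
      have "d * ((1 / d) * a - p (\<lambda>x. (1 / d) *\<^sub>R f x - h x)) \<le> d * b"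
        using b1[OF Gs[OF fa, of "1 / d"]] d by (intro mult_left_mono) auto
      moreover have "d * ((1 / d) * a - p (\<lambda>x. (1 / d) *\<^sub>R f x - h x))
          = a - p (\<lambda>x. d *\<^sub>R ((1 / d) *\<^sub>R f x - h x))"
        using d V[OF Vs[OF f, of "1 / d"] h, of "-1"] by (simp add: p_scale right_diff_distrib)
      moreover have "(\<lambda>x. d *\<^sub>R ((1 / d) *\<^sub>R f x - h x)) = (\<lambda>x. f x - d *\<^sub>R h x)"
        using d by (simp add: scaleR_diff_right)
      ultimately have "a - p (\<lambda>x. f x - d *\<^sub>R h x) \<le> d * b" by metis
      then show ?thesis by (simp add: d_def)
    qed
  qed
  have "dominated_graph V p G'"
    unfolding dominated_graph_def
  proof (intro conjI allI impI)
    show "G' \<subseteq> V \<times> UNIV" using G0 V h by (auto simp: G'_def)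
    show "((\<lambda>x. 0), 0) \<in> G'" unfolding G'_def using G0(2) by force
  next
    fix f a g a' c assume "(f, a) \<in> G'" "(g, a') \<in> G'"
    then obtain f1 a1 c1 f2 a2 c2 where *: "(f1, a1) \<in> G" "(f2, a2) \<in> G"
      "f = (\<lambda>x. f1 x + c1 *\<^sub>R h x)" "a = a1 + c1 * b" "g = (\<lambda>x. f2 x + c2 *\<^sub>R h x)" "a' = a2 + c2 * b"
      by (auto simp: G'_def)
    have "(\<lambda>x. f x + c *\<^sub>R g x) = (\<lambda>x. (f1 x + c *\<^sub>R f2 x) + (c1 + c * c2) *\<^sub>R h x)"
      by (auto simp: * algebra_simps)
    moreover have "a + c * a' = (a1 + c * a2) + (c1 + c * c2) * b" by (simp add: * algebra_simps)
    ultimately show "((\<lambda>x. f x + c *\<^sub>R g x), a + c * a') \<in> G'"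
      unfolding G'_def using Gl[OF *(1,2), of c]
      by (intro CollectI exI[of _ "\<lambda>x. f1 x + c *\<^sub>R f2 x"] exI[of _ "a1 + c * a2"] exI[of _ "c1 + c * c2"]) simp
  next
    fix f a assume "(f, a) \<in> G'"
    then show "a \<le> p f" using dom by (auto simp: G'_def)
  qed
  moreover have "G \<subseteq> G'"
  proof
    fix z assume z: "z \<in> G"
    obtain f a where fa: "z = (f, a)" by (cases z)
    show "z \<in> G'" unfolding G'_def fa using z fa
      by (intro CollectI exI[of _ f] exI[of _ a] exI[of _ "0::real"]) simp
  qed
  moreover have "(h, b) \<in> G'" unfolding G'_def using G0(2) by (force intro: exI[of _ "1::real"])
  ultimately show ?thesis by blast
qed

text \<open>Zorn's lemma for graphs under inclusion: the union of a chain is again dominated, and a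
  maximal graph is total because otherwise it could be extended by one more vector.\<close>

lemma Hahn_Banach:
  fixes V :: "('a \<Rightarrow> 'b::real_vector) set"
  assumes V: "\<And>f g c. f \<in> V \<Longrightarrow> g \<in> V \<Longrightarrow> (\<lambda>x. f x + c *\<^sub>R g x) \<in> V"
    and p_add: "\<And>f g. f \<in> V \<Longrightarrow> g \<in> V \<Longrightarrow> p (\<lambda>x. f x + g x) \<le> p f + p g"
    and p_scale: "\<And>f c. f \<in> V \<Longrightarrow> c \<ge> 0 \<Longrightarrow> p (\<lambda>x. c *\<^sub>R f x) = c * p f"
    and G: "dominated_graph V p G"
  obtains L where "\<And>f a. (f, a) \<in> G \<Longrightarrow> L f = a"
    "\<And>f g c. f \<in> V \<Longrightarrow> g \<in> V \<Longrightarrow> L (\<lambda>x. f x + c *\<^sub>R g x) = L f + c * L g"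
    "\<And>f. f \<in> V \<Longrightarrow> L f \<le> p f"
proof -
  define \<G> where "\<G> = {G'. dominated_graph V p G' \<and> G \<subseteq> G'}"
  have "\<exists>M\<in>\<G>. \<forall>X\<in>\<G>. M \<subseteq> X \<longrightarrow> X = M"
  proof (rule subset_Zorn_nonempty)
    show "\<G> \<noteq> {}" using G by (auto simp: \<G>_def)
    fix C assume C: "C \<noteq> {}" "subset.chain \<G> C"
    have CG: "C \<subseteq> \<G>" and ch: "\<And>X Y. X \<in> C \<Longrightarrow> Y \<in> C \<Longrightarrow> X \<subseteq> Y \<or> Y \<subseteq> X"
      using C(2) by (auto simp: subset.chain_def)
    have "dominated_graph V p (\<Union> C)"
      unfolding dominated_graph_def
    proof (intro conjI allI impI)
      show "\<Union> C \<subseteq> V \<times> UNIV" using CG by (auto simp: \<G>_def dominated_graph_def)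
      show "((\<lambda>x. 0), 0) \<in> \<Union> C" using CG C(1) by (fastforce simp: \<G>_def dominated_graph_def)
    next
      fix f a g b c assume "(f, a) \<in> \<Union> C" "(g, b) \<in> \<Union> C"
      then obtain X Y where XY: "X \<in> C" "Y \<in> C" "(f, a) \<in> X" "(g, b) \<in> Y" by auto
      then obtain Z where Z: "Z \<in> C" "(f, a) \<in> Z" "(g, b) \<in> Z" using ch[OF XY(1,2)] by blast
      then have "dominated_graph V p Z" using CG by (auto simp: \<G>_def)
      then show "((\<lambda>x. f x + c *\<^sub>R g x), a + c * b) \<in> \<Union> C"
        using Z unfolding dominated_graph_def by blast
    next
      fix f a assume "(f, a) \<in> \<Union> C"
      then show "a \<le> p f" using CG by (auto simp: \<G>_def dominated_graph_def)
    qed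
    then show "\<Union> C \<in> \<G>" using CG C(1) by (auto simp: \<G>_def)
  qed
  then obtain M where M: "dominated_graph V p M" "G \<subseteq> M"
    and max: "\<And>X. dominated_graph V p X \<Longrightarrow> M \<subseteq> X \<Longrightarrow> X = M"
    unfolding \<G>_def by (smt (verit) mem_Collect_eq order_trans)
  have M0: "M \<subseteq> V \<times> UNIV" "((\<lambda>x. 0), 0) \<in> M" 
    and Ml: "\<And>f a g b c. (f, a) \<in> M \<Longrightarrow> (g, b) \<in> M \<Longrightarrow> ((\<lambda>x. f x + c *\<^sub>R g x), a + c * b) \<in> M"
    and Mp: "\<And>f a. (f, a) \<in> M \<Longrightarrow> a \<le> p f"
    using M(1) by (auto simp: dominated_graph_def)
  have total: "\<exists>b. (h, b) \<in> M" if h: "h \<in> V" for h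
  proof -
    obtain G' b where "dominated_graph V p G'" "M \<subseteq> G'" "(h, b) \<in> G'"
      using dominated_graph_extend[OF V p_add p_scale M(1) h] by blast
    then show ?thesis using max by blast
  qed
  have p0: "p (\<lambda>x. 0) = 0" using p_scale[of "\<lambda>x. 0" 0] M0 by auto
  \<comment> \<open>Both \<open>a - b\<close> and \<open>b - a\<close> are values over the zero
    function, where \<open>p\<close> is 0.\<close>
  have unique: "a = b" if "(f, a) \<in> M" "(f, b) \<in> M" for f a b
  proof -
    have "((\<lambda>x. 0), a - b) \<in> M" "((\<lambda>x. 0), b - a) \<in> M"
      using Ml[OF that, of "-1"] Ml[OF that(2,1), of "-1"] by auto
    then show ?thesis using Mp[of "\<lambda>x. 0" "a - b"] Mp[of "\<lambda>x. 0" "b - a"] p0 by simp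
  qed
  define L where "L f = (THE a. (f, a) \<in> M)" for f
  have L: "L f = a" if "(f, a) \<in> M" for f a
    unfolding L_def using that unique by (intro the_equality) auto
  have LM: "(f, L f) \<in> M" if "f \<in> V" for f using total[OF that] L by auto
  show ?thesis
  proof (rule that[of L])
    show "L f = a" if "(f, a) \<in> G" for f a using that M(2) L by auto
    show "L (\<lambda>x. f x + c *\<^sub>R g x) = L f + c * L g" if "f \<in> V" "g \<in> V" for f g c
      using Ml[OF LM[OF that(1)] LM[OF that(2)], of c] by (rule L)
    show "L f \<le> p f" if "f \<in> V" for f using Mp[OF LM[OF that]] .
  qed
qed

section \<open>Bounds by finitely many functions\<close>

lemma test_lin: "\<phi> \<in> test_functions \<Longrightarrow> \<psi> \<in> test_functions \<Longrightarrow> (\<lambda>x. \<phi> x + c * \<psi> x) \<in> test_functions"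
  by (intro test_add test_cmult)

lemma linear_functional_lin:
  assumes "linear_functional T" "\<phi> \<in> test_functions" "\<psi> \<in> test_functions"
  shows "T (\<lambda>x. \<phi> x + c * \<psi> x) = T \<phi> + c * T \<psi>"
  using assms test_cmult[OF assms(3), of c] unfolding linear_functional_def by simp

lemma Lnorm_grad_cmult:
  assumes "\<phi> \<in> test_functions"
  shows "Lnorm 1 (grad (\<lambda>x. c * \<phi> x)) = \<bar>c\<bar> * Lnorm 1 (grad \<phi>)"
  unfolding Lnorm_1 by (simp add: grad_cmult[OF test_differentiable[OF assms]])

lemma Lnorm_grad_lin:
  assumes \<phi>: "\<phi> \<in> test_functions" and \<psi>: "\<psi> \<in> test_functions"
  shows "Lnorm 1 (grad (\<lambda>x. \<phi> x + c * \<psi> x)) \<le> Lnorm 1 (grad \<phi>) + \<bar>c\<bar> * Lnorm 1 (grad \<psi>)"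
proof -
  note c\<psi> = test_cmult[OF \<psi>, of c]
  have g: "grad (\<lambda>x. \<phi> x + c * \<psi> x) x = grad \<phi> x + grad (\<lambda>x. c * \<psi> x) x" for x
    by (rule grad_add[OF test_differentiable[OF \<phi>] test_differentiable[OF c\<psi>]])
  note i = Cc_integrable_lebesgue[OF Cc_norm[OF test_grad[OF \<phi>]]]
    Cc_integrable_lebesgue[OF Cc_norm[OF test_grad[OF c\<psi>]]]
    Cc_integrable_lebesgue[OF Cc_norm[OF test_grad[OF test_lin[OF \<phi> \<psi>, of c]]]]
  have "Lnorm 1 (grad (\<lambda>x. \<phi> x + c * \<psi> x))
      \<le> (LINT x|lebesgue. norm (grad \<phi> x) + norm (grad (\<lambda>x. c * \<psi> x) x))"
    unfolding Lnorm_1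
    by (rule integral_mono[OF i(3)]) (use i in \<open>auto simp: g norm_triangle_ineq\<close>)
  also have "\<dots> = Lnorm 1 (grad \<phi>) + Lnorm 1 (grad (\<lambda>x. c * \<psi> x))"
    using i by (simp add: Lnorm_1)
  finally show ?thesis by (simp add: Lnorm_grad_cmult[OF \<psi>])
qed

lemma pairing_lin:
  assumes m: "CARD('m) \<ge> 2" and f: "f \<in> Lspace (real CARD('m))"
    and \<phi>: "\<phi> \<in> test_functions" and \<psi>: "(\<psi> :: real^'m \<Rightarrow> real) \<in> test_functions"
  shows "(LINT x|lebesgue. (\<phi> x + c * \<psi> x) * f x)
    = pairing \<phi> f + c * pairing \<psi> f"
  using pairing_bound(1)[OF m test_Cc1[OF \<phi>] f] pairing_bound(1)[OF m test_Cc1[OF \<psi>] f]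
  by (simp add: distrib_right mult.assoc)

lemma pairing_lin_right:
  assumes m: "CARD('m) \<ge> 2" and f: "f \<in> Lspace (real CARD('m))" and g: "g \<in> Lspace (real CARD('m))"
    and \<phi>: "(\<phi> :: real^'m \<Rightarrow> real) \<in> test_functions"
  shows "(LINT x|lebesgue. \<phi> x * (f x + c * g x))
    = pairing \<phi> f + c * pairing \<phi> g"
  using pairing_bound(1)[OF m test_Cc1[OF \<phi>] f] pairing_bound(1)[OF m test_Cc1[OF \<phi>] g]
  by (simp add: distrib_left mult.left_commute)

lemma linear_functional_pairing:
  assumes "CARD('m) \<ge> 2" "f \<in> Lspace (real CARD('m))" "linear_functional T"
  shows "linear_functional (\<lambda>\<phi> :: real^'m \<Rightarrow> real. T \<phi> - c * pairing \<phi> f)"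
  unfolding linear_functional_def
proof (intro conjI ballI allI)
  fix \<phi> \<psi> :: "real^'m \<Rightarrow> real" assume t: "\<phi> \<in> test_functions" "\<psi> \<in> test_functions"
  show "T (\<lambda>x. \<phi> x + \<psi> x) - c * (LINT x|lebesgue. (\<phi> x + \<psi> x) * f x)
      = (T \<phi> - c * pairing \<phi> f) + (T \<psi> - c * pairing \<psi> f)"
    using linear_functional_lin[OF assms(3) t, of 1] pairing_lin[OF assms(1,2) t, of 1]
    by (simp add: distrib_left)
next
  fix d and \<phi> :: "real^'m \<Rightarrow> real" assume t: "\<phi> \<in> test_functions"
  have "T (\<lambda>x. d * \<phi> x) = d * T \<phi>" using assms(3) t by (simp add: linear_functional_def)
  then show "T (\<lambda>x. d * \<phi> x) - c * (LINT x|lebesgue. d * \<phi> x * f x)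
      = d * (T \<phi> - c * pairing \<phi> f)"
    by (simp add: mult.assoc right_diff_distrib mult.left_commute)
qed

text \<open>The hub of the equivalences. With a sum instead of a maximum and no normalisation, the
  functions of \<open>E\<close> can be removed one at a time until none is left.\<close>

definition finite_sum_bound :: "((real^'m \<Rightarrow> real) \<Rightarrow> real) \<Rightarrow> bool" where
  "finite_sum_bound T \<longleftrightarrow>
     (\<forall>\<epsilon>>0. \<exists>E \<theta>. finite E \<and> E \<subseteq> Lspace (real CARD('m)) \<and>
        (\<forall>\<phi>\<in>test_functions.
           \<bar>T \<phi>\<bar> \<le> \<theta> * (\<Sum>f\<in>E. \<bar>pairing \<phi> f\<bar>) + \<epsilon> * Lnorm 1 (grad \<phi>)))"

lemma finite_sum_boundE:
  fixes T :: "(real^'m \<Rightarrow> real) \<Rightarrow> real"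
  assumes "finite_sum_bound T" "e > 0"
  obtains E \<theta> where "finite E" "E \<subseteq> Lspace (real CARD('m))"
    "\<And>\<phi>. \<phi> \<in> test_functions \<Longrightarrow>
      \<bar>T \<phi>\<bar> \<le> \<theta> * (\<Sum>f\<in>E. \<bar>pairing \<phi> f\<bar>) + e * Lnorm 1 (grad \<phi>)"
  using assms(1)[unfolded finite_sum_bound_def, rule_format, OF assms(2)]
  by (elim exE conjE) (rule that, assumption, assumption, erule bspec)

text \<open>Membership of \<open>T\<close> in the closure of L_m for the norm dual to the L_1 norm
  of the gradient.\<close>

definition approximable :: "((real^'m \<Rightarrow> real) \<Rightarrow> real) \<Rightarrow> bool" where
  "approximable T \<longleftrightarrow>
     (\<forall>\<epsilon>>0. \<exists>f\<in>Lspace (real CARD('m)). \<forall>\<phi>\<in>test_functions.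
        \<bar>T \<phi> - pairing \<phi> f\<bar> \<le> \<epsilon> * Lnorm 1 (grad \<phi>))"

lemma approximable_imp_single_function_bound: "approximable T \<Longrightarrow> single_function_bound T"
  unfolding approximable_def single_function_bound_def by (smt (verit, best))

lemma single_function_bound_imp_finite_sum_bound:
  fixes T :: "(real^'m \<Rightarrow> real) \<Rightarrow> real"
  assumes "single_function_bound T" shows "finite_sum_bound T"
  unfolding finite_sum_bound_def
proof (intro allI impI)
  fix e :: real assume "e > 0"
  then obtain f where "f \<in> Lspace (real CARD('m))"
    "\<forall>\<phi>\<in>test_functions. \<bar>T \<phi>\<bar> \<le> \<bar>pairing \<phi> f\<bar> + e * Lnorm 1 (grad \<phi>)"
    using assms unfolding single_function_bound_def by blast
  then show "\<exists>E \<theta>. finite E \<and> E \<subseteq> Lspace (real CARD('m)) \<and> (\<forall>\<phi>\<in>test_functions.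
      \<bar>T \<phi>\<bar> \<le> \<theta> * (\<Sum>f\<in>E. \<bar>pairing \<phi> f\<bar>) + e * Lnorm 1 (grad \<phi>))"
    by (intro exI[of _ "{f}"] exI[of _ "1::real"]) simp
qed

lemma finite_family_bound_imp_finite_sum_bound:
  fixes T :: "(real^'m \<Rightarrow> real) \<Rightarrow> real"
  assumes "finite_family_bound T" shows "finite_sum_bound T"
  unfolding finite_sum_bound_def
proof (intro allI impI)
  fix e :: real assume "e > 0"
  from assms[unfolded finite_family_bound_def, rule_format, OF this]
  obtain E \<theta> where E: "finite E" "E \<noteq> {}" "\<theta> > 0"
    and EL: "E \<subseteq> {f \<in> Lspace (real CARD('m)). Lnorm (real CARD('m)) f = 1}"
    and b: "\<forall>\<phi>\<in>test_functions.
      \<bar>T \<phi>\<bar> \<le> \<theta> * Max ((\<lambda>f. \<bar>pairing \<phi> f\<bar>) ` E) + e * Lnorm 1 (grad \<phi>)"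
    by (elim exE conjE)
  have "\<bar>T \<phi>\<bar> \<le> \<theta> * (\<Sum>f\<in>E. \<bar>pairing \<phi> f\<bar>) + e * Lnorm 1 (grad \<phi>)"
    if \<phi>: "\<phi> \<in> test_functions" for \<phi>
  proof -
    have "Max ((\<lambda>f. \<bar>pairing \<phi> f\<bar>) ` E) \<le> (\<Sum>f\<in>E. \<bar>pairing \<phi> f\<bar>)"
      using E by (subst Max_le_iff) (auto intro!: member_le_sum[of _ E "\<lambda>f. \<bar>pairing \<phi> f\<bar>"])
    then have "\<theta> * Max ((\<lambda>f. \<bar>pairing \<phi> f\<bar>) ` E)
        \<le> \<theta> * (\<Sum>f\<in>E. \<bar>pairing \<phi> f\<bar>)" using E(3) by simp
    then show ?thesis using bspec[OF b \<phi>] by linarith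
  qed
  then show "\<exists>E \<theta>. finite E \<and> E \<subseteq> Lspace (real CARD('m)) \<and> (\<forall>\<phi>\<in>test_functions.
      \<bar>T \<phi>\<bar> \<le> \<theta> * (\<Sum>f\<in>E. \<bar>pairing \<phi> f\<bar>) + e * Lnorm 1 (grad \<phi>))"
    using E(1) EL by (intro exI[of _ E] exI[of _ \<theta>]) auto
qed

text \<open>Supplies a member for families that would otherwise be empty after functions of norm 0
  are discarded.\<close>

lemma exists_unit_Lnorm:
  assumes "p > 0"
  obtains f :: "real^'m \<Rightarrow> real" where "f \<in> Lspace p" "Lnorm p f = 1"
proof (rule that[of "indicator (cbox 0 One)"])
  have i: "integrable lebesgue (indicat_real (cbox (0::real^'m) One))"
    using emeasure_lborel_cbox_finite[of "0::real^'m" One] by (intro integrable_real_indicator) auto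
  have e: "\<bar>indicat_real (cbox (0::real^'m) One) x\<bar> powr p = indicat_real (cbox 0 One) x" for x
    by (auto simp: indicator_def)
  show "indicat_real (cbox (0::real^'m) One) \<in> Lspace p"
    unfolding Lspace_def mem_Collect_eq e by (intro conjI i borel_measurable_indicator) simp
  show "Lnorm p (indicat_real (cbox (0::real^'m) One)) = 1"
    unfolding Lnorm_def real_norm_def e by simp
qed

lemma finite_sum_bound_imp_finite_family_bound:
  fixes T :: "(real^'m \<Rightarrow> real) \<Rightarrow> real"
  assumes m: "CARD('m) \<ge> 2" and T: "finite_sum_bound T"
  shows "finite_family_bound T"
  unfolding finite_family_bound_def
proof (intro allI impI)
  fix e :: real assume "e > 0"
  let ?L = "Lspace (real CARD('m)) :: (real^'m \<Rightarrow> real) set"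
  let ?n = "Lnorm (real CARD('m)) :: (real^'m \<Rightarrow> real) \<Rightarrow> real"
  obtain E \<theta> where E: "finite E" "E \<subseteq> ?L"
    and b: "\<And>\<phi>. \<phi> \<in> test_functions \<Longrightarrow>
      \<bar>T \<phi>\<bar> \<le> \<theta> * (\<Sum>f\<in>E. \<bar>pairing \<phi> f\<bar>) + e * Lnorm 1 (grad \<phi>)"
    by (rule finite_sum_boundE[OF T \<open>e > 0\<close>]) (rule that)
  obtain u where u: "u \<in> ?L" "?n u = 1" using exists_unit_Lnorm[of "real CARD('m)"] by auto
  define E' where "E' = insert u ((\<lambda>f x. (1 / ?n f) * f x) ` {f \<in> E. ?n f \<noteq> 0})"
  define S where "S = (\<Sum>f\<in>E. ?n f)"
  \<comment> \<open>The summand 1 guarantees positivity.\<close>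
  define \<theta>' where "\<theta>' = 1 + \<bar>\<theta>\<bar> * S"
  have S: "S \<ge> 0" unfolding S_def by (intro sum_nonneg Lnorm_nonneg)
  have fin: "finite E'" "E' \<noteq> {}" using E by (auto simp: E'_def)
  have unit: "f \<in> ?L \<and> ?n f = 1" if fE: "f \<in> E'" for f
  proof (cases "f = u")
    case False
    then obtain g where g: "g \<in> E" "?n g \<noteq> 0" and f: "f = (\<lambda>x. (1 / ?n g) * g x)"
      using fE unfolding E'_def by blast
    have "f \<in> ?L" unfolding f using g E by (intro Lspace_cmult) auto
    moreover have "?n f = 1" unfolding f using g Lnorm_nonneg[of "real CARD('m)" g]
      by (subst Lnorm_cmult) auto
    ultimately show ?thesis by simp
  qed (use u in simp)
  have "\<bar>T \<phi>\<bar> \<le> \<theta>' * Max ((\<lambda>f. \<bar>pairing \<phi> f\<bar>) ` E') + e * Lnorm 1 (grad \<phi>)"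
    if \<phi>: "\<phi> \<in> test_functions" for \<phi>
  proof -
    define M where "M = Max ((\<lambda>f. \<bar>pairing \<phi> f\<bar>) ` E')"
    have M: "\<bar>pairing \<phi> f\<bar> \<le> M" if "f \<in> E'" for f
      unfolding M_def using fin that by (intro Max_ge) auto
    have "M \<ge> 0" using M[of u] by (simp add: E'_def)
    have fM: "\<bar>pairing \<phi> f\<bar> \<le> ?n f * M" if "f \<in> E" for f
    proof (cases "?n f = 0")
      case True
      then show ?thesis using pairing_bound(2)[OF m test_Cc1[OF \<phi>], of f] that E by auto
    next
      case False
      then have pos: "?n f > 0" using Lnorm_nonneg[of _ f] by (metis order_less_le)
      have "\<bar>LINT x|lebesgue. \<phi> x * ((1 / ?n f) * f x)\<bar> \<le> M"
        using that False by (intro M) (auto simp: E'_def)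
      also have "(LINT x|lebesgue. \<phi> x * ((1 / ?n f) * f x)) = (1 / ?n f) * pairing \<phi> f"
        by (simp only: mult.left_commute[of "\<phi> _"] integral_mult_right_zero)
      finally show ?thesis using pos by (simp add: abs_mult field_simps)
    qed
    have "\<theta> * (\<Sum>f\<in>E. \<bar>pairing \<phi> f\<bar>) \<le> \<bar>\<theta>\<bar> * (\<Sum>f\<in>E. ?n f * M)"
      by (intro mult_mono sum_mono fM) (auto intro: sum_nonneg)
    also have "\<dots> \<le> \<theta>' * M"
      using \<open>M \<ge> 0\<close> by (simp add: \<theta>'_def S_def sum_distrib_right[symmetric] distrib_right)
    finally show ?thesis using b[OF \<phi>] by (simp add: M_def)
  qed
  moreover have "\<theta>' > 0" using S by (simp add: \<theta>'_def add_pos_nonneg)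
  ultimately show "\<exists>E \<theta>. finite E \<and> E \<noteq> {} \<and> E \<subseteq> {f \<in> ?L. ?n f = 1} \<and> \<theta> > 0 \<and>
      (\<forall>\<phi>\<in>test_functions. \<bar>T \<phi>\<bar> \<le> \<theta> * Max ((\<lambda>f. \<bar>pairing \<phi> f\<bar>) ` E) + e * Lnorm 1 (grad \<phi>))"
    using fin unit by blast
qed

lemma finite_sum_bound_imp_sequentially_continuous:
  fixes T :: "(real^'m \<Rightarrow> real) \<Rightarrow> real"
  assumes T: "finite_sum_bound T"
  shows "sequentially_continuous T"
  unfolding sequentially_continuous_def
proof (intro allI impI)
  fix \<phi> :: "nat \<Rightarrow> real^'m \<Rightarrow> real"
  assume t: "\<forall>j. \<phi> j \<in> test_functions"
    and w: "\<forall>f\<in>Lspace (real CARD('m)). (\<lambda>j. pairing (\<phi> j) f) \<longlonglongrightarrow> 0"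
    and bd: "bdd_above (range (\<lambda>j. Lnorm 1 (grad (\<phi> j))))"
  obtain K where K: "\<And>j. Lnorm 1 (grad (\<phi> j)) \<le> K" using bd by (auto simp: bdd_above_def)
  have K0: "K \<ge> 0" by (rule order_trans[OF Lnorm_nonneg K])
  show "(\<lambda>j. T (\<phi> j)) \<longlonglongrightarrow> 0"
  proof (rule LIMSEQ_I)
    fix r :: real assume r: "r > 0"
    \<comment> \<open>Chosen so that the gradient term, bounded by \<open>e * K\<close>, takes less
      than half of \<open>r\<close>.\<close>
    define e where "e = r / (2 * (K + 1))"
    have e: "e > 0" "e * K < r / 2" using r K0 by (auto simp: e_def field_simps)
    obtain E \<theta> where E: "finite E" "E \<subseteq> Lspace (real CARD('m))"
      and b: "\<And>\<phi>. \<phi> \<in> test_functions \<Longrightarrow>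
        \<bar>T \<phi>\<bar> \<le> \<theta> * (\<Sum>f\<in>E. \<bar>pairing \<phi> f\<bar>) + e * Lnorm 1 (grad \<phi>)"
      by (rule finite_sum_boundE[OF T e(1)]) (rule that)
    have "(\<lambda>j. \<theta> * (\<Sum>f\<in>E. \<bar>pairing (\<phi> j) f\<bar>)) \<longlonglongrightarrow> \<theta> * (\<Sum>f\<in>E. \<bar>0\<bar>)"
      using w E by (intro tendsto_intros) auto
    then have "\<forall>\<^sub>F j in sequentially. \<theta> * (\<Sum>f\<in>E. \<bar>pairing (\<phi> j) f\<bar>) < r / 2"
      using r by (intro order_tendstoD(2)) auto
    then obtain J where J: "\<And>j. j \<ge> J \<Longrightarrow> \<theta> * (\<Sum>f\<in>E. \<bar>pairing (\<phi> j) f\<bar>) < r / 2"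
      by (auto simp: eventually_sequentially)
    have "norm (T (\<phi> j) - 0) < r" if "j \<ge> J" for j
    proof -
      have "e * Lnorm 1 (grad (\<phi> j)) \<le> e * K" using K e by (intro mult_left_mono) auto
      then show ?thesis using b[OF t[rule_format, of j]] J[OF that] e(2)
        unfolding real_norm_def diff_0_right by linarith
    qed
    then show "\<exists>J. \<forall>j\<ge>J. norm (T (\<phi> j) - 0) < r" by blast
  qed
qed

section \<open>Eliminating a finite family of functionals\<close>

text \<open>On the kernel of \<open>l\<close> the hypothesis bounds \<open>T\<close> by
  \<open>q\<close> alone. The difference of two functions with \<open>l = 1\<close> lies in that
  kernel, so every \<open>T \<phi> - q \<phi>\<close> is at most every
  \<open>T \<psi> + q \<psi>\<close> on that hyperplane. A number \<open>c\<close> between the two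
  families works, and scaling covers the remaining functions.\<close>

lemma absorb_functional:
  fixes D :: "('a \<Rightarrow> real) set"
  assumes D: "\<And>\<phi> \<psi> c. \<phi> \<in> D \<Longrightarrow> \<psi> \<in> D \<Longrightarrow> (\<lambda>x. \<phi> x + c * \<psi> x) \<in> D"
    and T: "\<And>\<phi> \<psi> c. \<phi> \<in> D \<Longrightarrow> \<psi> \<in> D \<Longrightarrow> T (\<lambda>x. \<phi> x + c * \<psi> x) = T \<phi> + c * T \<psi>"
    and l: "\<And>\<phi> \<psi> c. \<phi> \<in> D \<Longrightarrow> \<psi> \<in> D \<Longrightarrow> l (\<lambda>x. \<phi> x + c * \<psi> x) = l \<phi> + c * l \<psi>"
    and q: "\<And>\<phi> \<psi> c. \<phi> \<in> D \<Longrightarrow> \<psi> \<in> D \<Longrightarrow> q (\<lambda>x. \<phi> x + c * \<psi> x) \<le> q \<phi> + \<bar>c\<bar> * q \<psi>"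
      "\<And>\<phi> c. \<phi> \<in> D \<Longrightarrow> q (\<lambda>x. c * \<phi> x) = \<bar>c\<bar> * q \<phi>"
    and b: "\<And>\<phi>. \<phi> \<in> D \<Longrightarrow> \<bar>T \<phi>\<bar> \<le> q \<phi> + \<theta> * \<bar>l \<phi>\<bar>"
  shows "\<exists>c. \<forall>\<phi>\<in>D. \<bar>T \<phi> - c * l \<phi>\<bar> \<le> q \<phi>"
proof (cases "\<forall>\<phi>\<in>D. l \<phi> = 0")
  case True
  then show ?thesis using b by (intro exI[of _ 0]) auto
next
  case False
  then obtain \<phi>0 where \<phi>0: "\<phi>0 \<in> D" "l \<phi>0 \<noteq> 0" by blast
  have Ds: "(\<lambda>x. c * \<phi> x) \<in> D" and Ts: "T (\<lambda>x. c * \<phi> x) = c * T \<phi>" and ls: "l (\<lambda>x. c * \<phi> x) = c * l \<phi>"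
    if "\<phi> \<in> D" for c \<phi>
  proof -
    have e: "(\<lambda>x. c * \<phi> x) = (\<lambda>x. \<phi> x + (c - 1) * \<phi> x)" by (simp add: algebra_simps)
    show "(\<lambda>x. c * \<phi> x) \<in> D" using D[OF that that, of "c - 1"] unfolding e[symmetric] .
    show "T (\<lambda>x. c * \<phi> x) = c * T \<phi>"
      using T[OF that that, of "c - 1"] unfolding e[symmetric] by (simp add: left_diff_distrib)
    show "l (\<lambda>x. c * \<phi> x) = c * l \<phi>"
      using l[OF that that, of "c - 1"] unfolding e[symmetric] by (simp add: left_diff_distrib)
  qed
  define S where "S = {T \<phi> - q \<phi> |\<phi>. \<phi> \<in> D \<and> l \<phi> = 1}"
  have key: "T \<phi> - q \<phi> \<le> T \<psi> + q \<psi>" if "\<phi> \<in> D" "l \<phi> = 1" "\<psi> \<in> D" "l \<psi> = 1" for \<phi> \<psi>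
    using b[OF D[OF that(1,3), of "-1"]] T[OF that(1,3), of "-1"] l[OF that(1,3), of "-1"]
      q(1)[OF that(1,3), of "-1"] that by simp
  define \<phi>1 where "\<phi>1 = (\<lambda>x. (1 / l \<phi>0) * \<phi>0 x)"
  have \<phi>1: "\<phi>1 \<in> D" "l \<phi>1 = 1"
    unfolding \<phi>1_def ls[OF \<phi>0(1)] by (rule Ds[OF \<phi>0(1)]) (use \<phi>0(2) in simp)
  have S0: "S \<noteq> {}" using \<phi>1 by (auto simp: S_def)
  have Sb: "bdd_above S" unfolding S_def bdd_above_def using key[OF _ _ \<phi>1] by blast
  define c where "c = Sup S"
  have c1: "T \<phi> - q \<phi> \<le> c" if "\<phi> \<in> D" "l \<phi> = 1" for \<phi>
    unfolding c_def using that by (intro cSup_upper Sb) (auto simp: S_def)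
  have c2: "c \<le> T \<phi> + q \<phi>" if "\<phi> \<in> D" "l \<phi> = 1" for \<phi>
    unfolding c_def using key[OF _ _ that] by (intro cSup_least S0) (auto simp: S_def)
  have "\<bar>T \<phi> - c * l \<phi>\<bar> \<le> q \<phi>" if \<phi>: "\<phi> \<in> D" for \<phi>
  proof (cases "l \<phi> = 0")
    case True
    then show ?thesis using b[OF \<phi>] by simp
  next
    case False
    define \<psi> where "\<psi> = (\<lambda>x. (1 / l \<phi>) * \<phi> x)"
    have \<psi>: "\<psi> \<in> D" "l \<psi> = 1" "T \<psi> = (1 / l \<phi>) * T \<phi>" "q \<psi> = \<bar>1 / l \<phi>\<bar> * q \<phi>"
      unfolding \<psi>_def Ts[OF \<phi>] ls[OF \<phi>] q(2)[OF \<phi>] by (rule Ds[OF \<phi>]) (use False in simp_all)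
    have "\<bar>T \<psi> - c\<bar> \<le> q \<psi>" using c1[OF \<psi>(1,2)] c2[OF \<psi>(1,2)] by linarith
    then have "\<bar>l \<phi>\<bar> * \<bar>T \<psi> - c\<bar> \<le> \<bar>l \<phi>\<bar> * q \<psi>" by (intro mult_left_mono) auto
    moreover have "\<bar>l \<phi>\<bar> * \<bar>T \<psi> - c\<bar> = \<bar>T \<phi> - c * l \<phi>\<bar>"
      unfolding abs_mult[symmetric] \<psi>(3) using False by (simp add: right_diff_distrib mult.commute)
    moreover have "\<bar>l \<phi>\<bar> * q \<psi> = q \<phi>" unfolding \<psi>(4) using False by (simp add: abs_mult[symmetric] mult.assoc[symmetric])
    ultimately show ?thesis by simp
  qed
  then show ?thesis by blast
qed

lemma finite_sum_bound_imp_approximable: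
  fixes T :: "(real^'m \<Rightarrow> real) \<Rightarrow> real"
  assumes m: "CARD('m) \<ge> 2" and lin: "linear_functional T" and T: "finite_sum_bound T"
  shows "approximable T"
  unfolding approximable_def
proof (intro allI impI)
  fix e :: real assume e: "e > 0"
  let ?L = "Lspace (real CARD('m)) :: (real^'m \<Rightarrow> real) set"
  have main: "\<exists>f\<in>?L. \<forall>\<phi>\<in>test_functions. \<bar>T \<phi> - pairing \<phi> f\<bar> \<le> e * Lnorm 1 (grad \<phi>)"
    if "finite E" "E \<subseteq> ?L" "linear_functional T" "\<And>\<phi>. \<phi> \<in> test_functions \<Longrightarrow>
      \<bar>T \<phi>\<bar> \<le> \<theta> * (\<Sum>f\<in>E. \<bar>pairing \<phi> f\<bar>) + e * Lnorm 1 (grad \<phi>)" "\<theta> \<ge> 0" for T E \<theta>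
    using that
  \<comment> \<open>\<open>T\<close> must vary, since absorbing \<open>g\<close> replaces it by
    \<open>T - c * pairing _ g\<close>, which is again linear.\<close>
  proof (induction E arbitrary: T)
    case empty
    then show ?case using Cc_Lspace[OF Cc_zero, of "real CARD('m)"]
      by (intro bexI[of _ "\<lambda>x. 0"]) auto
  next
    case (insert g E)
    have g: "g \<in> ?L" using insert.prems by simp
    \<comment> \<open>The seminorm keeps the functions still to be absorbed together with the
      gradient term.\<close>
    define q where "q \<phi> = \<theta> * (\<Sum>f\<in>E. \<bar>pairing \<phi> f\<bar>) + e * Lnorm 1 (grad \<phi>)" for \<phi> :: "real^'m \<Rightarrow> real"
    have "\<exists>c. \<forall>\<phi>\<in>test_functions. \<bar>T \<phi> - c * pairing \<phi> g\<bar> \<le> q \<phi>"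
    proof (rule absorb_functional[where \<theta>=\<theta>])
      fix \<phi> \<psi> :: "real^'m \<Rightarrow> real" and c :: real
      assume \<phi>: "\<phi> \<in> test_functions" and \<psi>: "\<psi> \<in> test_functions"
      have "(\<Sum>f\<in>E. \<bar>LINT x|lebesgue. (\<phi> x + c * \<psi> x) * f x\<bar>)
          \<le> (\<Sum>f\<in>E. \<bar>pairing \<phi> f\<bar> + \<bar>c\<bar> * \<bar>pairing \<psi> f\<bar>)"
      proof (rule sum_mono)
        fix f assume "f \<in> E"
        then have f: "f \<in> ?L" using insert.prems by auto
        show "\<bar>LINT x|lebesgue. (\<phi> x + c * \<psi> x) * f x\<bar>
            \<le> \<bar>pairing \<phi> f\<bar> + \<bar>c\<bar> * \<bar>pairing \<psi> f\<bar>"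
          unfolding pairing_lin[OF m f \<phi> \<psi>] abs_mult[symmetric] by (rule abs_triangle_ineq)
      qed
      then have "\<theta> * (\<Sum>f\<in>E. \<bar>LINT x|lebesgue. (\<phi> x + c * \<psi> x) * f x\<bar>)
          \<le> \<theta> * ((\<Sum>f\<in>E. \<bar>pairing \<phi> f\<bar>) + \<bar>c\<bar> * (\<Sum>f\<in>E. \<bar>pairing \<psi> f\<bar>))"
        using insert.prems(4) by (intro mult_left_mono) (auto simp: sum.distrib sum_distrib_left)
      moreover have "e * Lnorm 1 (grad (\<lambda>x. \<phi> x + c * \<psi> x))
          \<le> e * (Lnorm 1 (grad \<phi>) + \<bar>c\<bar> * Lnorm 1 (grad \<psi>))"
        using Lnorm_grad_lin[OF \<phi> \<psi>] e by simp
      ultimately show "q (\<lambda>x. \<phi> x + c * \<psi> x) \<le> q \<phi> + \<bar>c\<bar> * q \<psi>"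
        unfolding q_def by (simp add: algebra_simps)
    next
      fix \<phi> :: "real^'m \<Rightarrow> real" and c :: real assume \<phi>: "\<phi> \<in> test_functions"
      have "(LINT x|lebesgue. c * \<phi> x * f x) = c * pairing \<phi> f" for f
        by (simp add: mult.assoc)
      then show "q (\<lambda>x. c * \<phi> x) = \<bar>c\<bar> * q \<phi>"
        unfolding q_def Lnorm_grad_cmult[OF \<phi>]
        by (simp add: abs_mult sum_distrib_left[symmetric] algebra_simps)
    next
      fix \<phi> :: "real^'m \<Rightarrow> real" assume \<phi>: "\<phi> \<in> test_functions"
      show "\<bar>T \<phi>\<bar> \<le> q \<phi> + \<theta> * \<bar>pairing \<phi> g\<bar>"
        using insert.prems(3)[OF \<phi>] insert.hyps unfolding q_def by (simp add: distrib_left)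
    qed (use test_lin linear_functional_lin[OF insert.prems(2)] pairing_lin[OF m g] in auto)
    then obtain c where c: "\<And>\<phi>. \<phi> \<in> test_functions \<Longrightarrow> \<bar>T \<phi> - c * pairing \<phi> g\<bar> \<le> q \<phi>"
      by blast
    have EL: "E \<subseteq> ?L" using insert.prems by simp
    obtain f where f: "f \<in> ?L" "\<And>\<phi>. \<phi> \<in> test_functions \<Longrightarrow>
        \<bar>(T \<phi> - c * pairing \<phi> g) - pairing \<phi> f\<bar> \<le> e * Lnorm 1 (grad \<phi>)"
      using insert.IH[OF EL linear_functional_pairing[OF m g insert.prems(2)] _ insert.prems(4), of c] c
      unfolding q_def by blast
    show ?case
    proof (intro bexI ballI)
      show "(\<lambda>x. f x + c * g x) \<in> ?L" using f(1) g by (intro Lspace_add Lspace_cmult) auto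
      fix \<phi> :: "real^'m \<Rightarrow> real" assume \<phi>: "\<phi> \<in> test_functions"
      show "\<bar>T \<phi> - (LINT x|lebesgue. \<phi> x * (f x + c * g x))\<bar> \<le> e * Lnorm 1 (grad \<phi>)"
        using f(2)[OF \<phi>] pairing_lin_right[OF m f(1) g \<phi>, of c] by (simp add: algebra_simps)
    qed
  qed
  obtain E \<theta> where E: "finite E" "E \<subseteq> ?L"
    and b: "\<And>\<phi>. \<phi> \<in> test_functions \<Longrightarrow>
      \<bar>T \<phi>\<bar> \<le> \<theta> * (\<Sum>f\<in>E. \<bar>pairing \<phi> f\<bar>) + e * Lnorm 1 (grad \<phi>)"
    by (rule finite_sum_boundE[OF T e]) (rule that)
  \<comment> \<open>\<open>\<theta>\<close> may be negative; its absolute value makes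
    \<open>q\<close> above a seminorm.\<close>
  have abs: "\<theta> * (\<Sum>f\<in>E. \<bar>pairing \<phi> f\<bar>) \<le> \<bar>\<theta>\<bar> * (\<Sum>f\<in>E. \<bar>pairing \<phi> f\<bar>)" for \<phi>
    by (intro mult_right_mono sum_nonneg) auto
  have b': "\<bar>T \<phi>\<bar> \<le> \<bar>\<theta>\<bar> * (\<Sum>f\<in>E. \<bar>pairing \<phi> f\<bar>) + e * Lnorm 1 (grad \<phi>)"
    if "\<phi> \<in> test_functions" for \<phi> by (rule order_trans[OF b[OF that] add_right_mono[OF abs]])
  show "\<exists>f\<in>?L. \<forall>\<phi>\<in>test_functions. \<bar>T \<phi> - pairing \<phi> f\<bar> \<le> e * Lnorm 1 (grad \<phi>)"
    by (rule main[OF E lin b']) auto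
qed

section \<open>Sequential continuity and separability\<close>

text \<open>The pairings with the \<open>\<psi> n\<close> are functionals on L_m of norm at most
  \<open>K\<close>, so the functions against which they tend to 0 form a closed set.\<close>

lemma pairing_tendsto_zero_closed:
  fixes \<psi> :: "nat \<Rightarrow> real^'m \<Rightarrow> real"
  assumes m: "CARD('m) \<ge> 2" and \<psi>: "\<And>n. \<psi> n \<in> test_functions"
    and K: "\<And>n. Lnorm 1 (grad (\<psi> n)) \<le> K"
    and f: "f \<in> Lspace (real CARD('m))"
    and app: "\<And>e. e > 0 \<Longrightarrow> \<exists>g\<in>Lspace (real CARD('m)). Lnorm (real CARD('m)) (\<lambda>x. f x - g x) < e \<and>
      (\<lambda>n. pairing (\<psi> n) g) \<longlonglongrightarrow> 0"
  shows "(\<lambda>n. pairing (\<psi> n) f) \<longlonglongrightarrow> 0"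
proof (rule LIMSEQ_I)
  fix r :: real assume r: "r > 0"
  have K0: "K \<ge> 0" by (rule order_trans[OF Lnorm_nonneg K])
  define e where "e = r / (2 * (K + 1))"
  have e: "e > 0" "e * K < r / 2" using r K0 by (auto simp: e_def field_simps)
  obtain g where g: "g \<in> Lspace (real CARD('m))" "Lnorm (real CARD('m)) (\<lambda>x. f x - g x) < e"
    "(\<lambda>n. pairing (\<psi> n) g) \<longlonglongrightarrow> 0"
    using app[OF e(1)] by blast
  have fg: "(\<lambda>x. f x - g x) \<in> Lspace (real CARD('m))" using m by (intro Lspace_diff f g) auto
  obtain J where J: "\<And>n. n \<ge> J \<Longrightarrow> \<bar>pairing (\<psi> n) g\<bar> < r / 2"
    using LIMSEQ_D[OF g(3), of "r / 2"] r by auto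
  have "norm (pairing (\<psi> n) f - 0) < r" if "n \<ge> J" for n
  proof -
    have "(LINT x|lebesgue. \<psi> n x * (f x - g x)) = pairing (\<psi> n) f - pairing (\<psi> n) g"
      using pairing_lin_right[OF m f g(1) \<psi>, of n "-1"] by simp
    moreover have "\<bar>LINT x|lebesgue. \<psi> n x * (f x - g x)\<bar> \<le> e * K"
    proof (rule order_trans[OF pairing_bound(2)[OF m test_Cc1[OF \<psi>] fg]])
      show "Lnorm (real CARD('m)) (\<lambda>x. f x - g x) * Lnorm 1 (grad (\<psi> n)) \<le> e * K"
        using g(2) e(1) by (intro mult_mono K Lnorm_nonneg) auto
    qed
    ultimately show ?thesis using J[OF that] e(2) unfolding real_norm_def diff_0_right by linarith
  qed
  then show "\<exists>J. \<forall>n\<ge>J. norm (pairing (\<psi> n) f - 0) < r" by blast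
qed

text \<open>The contrapositive: if the bound fails for every finite part of a countable family spanning a
  dense subspace of \<open>L\<^sub>m\<close>, the test functions violating it, normalised by \<open>T \<phi> = 1\<close>, form a sequence
  that is bounded and converges to 0 against that family.\<close>

lemma sequentially_continuous_imp_finite_sum_bound:
  fixes T :: "(real^'m \<Rightarrow> real) \<Rightarrow> real"
  assumes m: "CARD('m) \<ge> 2" and lin: "linear_functional T" and T: "sequentially_continuous T"
  shows "finite_sum_bound T"
proof (rule ccontr)
  let ?L = "Lspace (real CARD('m)) :: (real^'m \<Rightarrow> real) set"
  have mp: "real CARD('m) > 0" using m by simp
  \<comment> \<open>Decoding a natural number as a word and a radius enumerates all monomials cut
    off at balls of integer radius.\<close>
  define G :: "nat \<Rightarrow> real^'m \<Rightarrow> real" where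
    "G i = (case from_nat i :: 'm list \<times> nat of (l, k) \<Rightarrow>
      (\<lambda>x. indicator (cball 0 (real k)) x * prod_list (map (($) x) l)))" for i
  have GL: "G i \<in> ?L" for i
    unfolding G_def
    by (cases "from_nat i :: 'm list \<times> nat")
       (simp add: Lspace_cut_continuous[OF monomial_span_continuous[OF monomial_span.monomial] mp])
  assume "\<not> finite_sum_bound T"
  then obtain e where e: "e > 0" and not_ex: "\<not> (\<exists>E \<theta>. finite E \<and> E \<subseteq> ?L \<and> (\<forall>\<phi>\<in>test_functions.
      \<bar>T \<phi>\<bar> \<le> \<theta> * (\<Sum>f\<in>E. \<bar>pairing \<phi> f\<bar>) + e * Lnorm 1 (grad \<phi>)))"
    unfolding finite_sum_bound_def not_all not_imp by (elim exE conjE) (rule that)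
  have no: "\<exists>\<phi>\<in>test_functions.
      \<bar>T \<phi>\<bar> > \<theta> * (\<Sum>f\<in>E. \<bar>pairing \<phi> f\<bar>) + e * Lnorm 1 (grad \<phi>)"
    if "finite E" "E \<subseteq> ?L" for E \<theta>
  proof (rule ccontr)
    assume "\<not> ?thesis"
    then have "\<forall>\<phi>\<in>test_functions.
      \<bar>T \<phi>\<bar> \<le> \<theta> * (\<Sum>f\<in>E. \<bar>pairing \<phi> f\<bar>) + e * Lnorm 1 (grad \<phi>)"
      by (simp only: bex_simps not_less)
    with that not_ex show False by (elim notE) (intro exI conjI)
  qed
  \<comment> \<open>Diagonal choice: at stage \<open>n\<close> both the tested family and the
    constant in front of the sum grow.\<close>
  have "\<forall>n. \<exists>\<phi>. \<phi> \<in> test_functions \<and> \<bar>T \<phi>\<bar> > real n * (\<Sum>f\<in>G ` {..n}. \<bar>pairing \<phi> f\<bar>) + e * Lnorm 1 (grad \<phi>)"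
    unfolding Bex_def[symmetric] using GL by (intro allI no) auto
  from choice[OF this] obtain \<phi> where "\<forall>n. \<phi> n \<in> test_functions \<and>
      \<bar>T (\<phi> n)\<bar> > real n * (\<Sum>f\<in>G ` {..n}. \<bar>pairing (\<phi> n) f\<bar>) + e * Lnorm 1 (grad (\<phi> n))" by (rule exE)
  then have \<phi>: "\<And>n. \<phi> n \<in> test_functions"
    "\<And>n. \<bar>T (\<phi> n)\<bar> > real n * (\<Sum>f\<in>G ` {..n}. \<bar>pairing (\<phi> n) f\<bar>) + e * Lnorm 1 (grad (\<phi> n))"
    by simp_all
  have nn: "real n * (\<Sum>f\<in>G ` {..n}. \<bar>pairing (\<phi> n) f\<bar>) \<ge> 0" "e * Lnorm 1 (grad (\<phi> n)) \<ge> 0" for n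
    using e by (auto intro!: mult_nonneg_nonneg sum_nonneg Lnorm_nonneg)
  have T0: "T (\<phi> n) \<noteq> 0" for n
  proof -
    have "\<bar>T (\<phi> n)\<bar> > 0" using \<phi>(2)[of n] nn[of n] by linarith
    then show ?thesis by simp
  qed
  define \<psi> where "\<psi> n = (\<lambda>x. (1 / T (\<phi> n)) * \<phi> n x)" for n
  have \<psi>: "\<psi> n \<in> test_functions" for n unfolding \<psi>_def by (intro test_cmult \<phi>)
  have T1: "T (\<psi> n) = 1" for n
  proof -
    have "T (\<psi> n) = (1 / T (\<phi> n)) * T (\<phi> n)"
      unfolding \<psi>_def using lin \<phi>(1)[of n] by (simp only: linear_functional_def)
    then show ?thesis using T0 by simp
  qed
  have N: "Lnorm 1 (grad (\<psi> n)) \<le> 1 / e" for n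
  proof -
    have "e * Lnorm 1 (grad (\<phi> n)) \<le> \<bar>T (\<phi> n)\<bar>" using \<phi>(2)[of n] nn(1)[of n] by linarith
    then have "Lnorm 1 (grad (\<phi> n)) / \<bar>T (\<phi> n)\<bar> \<le> 1 / e"
      using e T0[of n] by (simp add: field_simps)
    moreover have "Lnorm 1 (grad (\<psi> n)) = \<bar>1 / T (\<phi> n)\<bar> * Lnorm 1 (grad (\<phi> n))"
      unfolding \<psi>_def by (rule Lnorm_grad_cmult[OF \<phi>(1)])
    ultimately show ?thesis by simp
  qed
  \<comment> \<open>For \<open>n > i\<close> the function \<open>G i\<close> is among those tested
    at stage \<open>n\<close>, so its pairing with \<open>\<phi> n\<close> is at most
    \<open>\<bar>T (\<phi> n)\<bar> / n\<close>.\<close>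
  have pG: "(\<lambda>n. pairing (\<psi> n) (G i)) \<longlonglongrightarrow> 0" for i
  proof (rule Lim_null_comparison)
    show "(\<lambda>n. 1 / real n) \<longlonglongrightarrow> 0" by (rule lim_const_over_n)
    show "\<forall>\<^sub>F n in sequentially. norm (pairing (\<psi> n) (G i)) \<le> 1 / real n"
      unfolding eventually_sequentially
    proof (intro exI[of _ "Suc i"] allI impI)
      fix n assume n: "Suc i \<le> n"
      have "\<bar>pairing (\<phi> n) (G i)\<bar> \<le> (\<Sum>f\<in>G ` {..n}. \<bar>pairing (\<phi> n) f\<bar>)"
        using n by (intro member_le_sum[of "G i" _ "\<lambda>f. \<bar>pairing (\<phi> n) f\<bar>"]) auto
      then have "real n * \<bar>pairing (\<phi> n) (G i)\<bar>
          \<le> real n * (\<Sum>f\<in>G ` {..n}. \<bar>pairing (\<phi> n) f\<bar>)" by (intro mult_left_mono) auto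
      also have "\<dots> \<le> \<bar>T (\<phi> n)\<bar>" using \<phi>(2)[of n] nn(2)[of n] by linarith
      finally have "\<bar>pairing (\<phi> n) (G i)\<bar> / \<bar>T (\<phi> n)\<bar> \<le> 1 / real n"
        using n T0[of n] by (simp add: field_simps)
      moreover have "pairing (\<psi> n) (G i) = (1 / T (\<phi> n)) * pairing (\<phi> n) (G i)"
        unfolding \<psi>_def mult.assoc by (rule integral_mult_right_zero)
      ultimately show "norm (pairing (\<psi> n) (G i)) \<le> 1 / real n"
        by (simp add: abs_mult)
    qed
  qed
  have span: "(\<lambda>n. LINT x|lebesgue. \<psi> n x * (indicator (cball 0 (real k)) x * h x)) \<longlonglongrightarrow> 0"
    if "monomial_span h" for h k
    using that
  proof (induction rule: monomial_span.induct)
    case (monomial l)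
    have "G (to_nat (l, k)) = (\<lambda>x. indicator (cball 0 (real k)) x * prod_list (map (($) x) l))"
      by (simp add: G_def)
    then show ?case using pG[of "to_nat (l, k)"] by simp
  next
    case (add f g)
    have "(LINT x|lebesgue. \<psi> n x * (indicator (cball 0 (real k)) x * (f x + g x)))
        = (LINT x|lebesgue. \<psi> n x * (indicator (cball 0 (real k)) x * f x)) + (LINT x|lebesgue. \<psi> n x * (indicator (cball 0 (real k)) x * g x))" for n
      using pairing_lin_right[OF m Lspace_cut_continuous[OF monomial_span_continuous[OF add.hyps(1)] mp, of "real k"]
          Lspace_cut_continuous[OF monomial_span_continuous[OF add.hyps(2)] mp, of "real k"] \<psi>, of n 1]
      by (simp add: distrib_left)
    then show ?case using tendsto_add[OF add.IH] by simp
  next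
    case (cmult f c)
    have "(LINT x|lebesgue. \<psi> n x * (indicator (cball 0 (real k)) x * (c * f x)))
        = c * (LINT x|lebesgue. \<psi> n x * (indicator (cball 0 (real k)) x * f x))" for n
      unfolding mult.left_commute[of _ c] by (rule integral_mult_right_zero)
    then show ?case using tendsto_mult_right_zero[OF cmult.IH, of c] by simp
  qed
  \<comment> \<open>Convergence passes in two closure steps from cut-off polynomials to C_c and from
    there to all of L_m.\<close>
  have Cc0: "(\<lambda>n. pairing (\<psi> n) g) \<longlonglongrightarrow> 0" if g: "Cc g" for g
  proof (rule pairing_tendsto_zero_closed[OF m \<psi> N Cc_Lspace[OF g mp]])
    fix d :: real assume "d > 0"
    from polynomial_approximation[OF g mp this]
    obtain h k where hk: "monomial_span h"
      "Lnorm (real CARD('m)) (\<lambda>x. g x - indicator (cball 0 (real k)) x * h x) < d" by blast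
    show "\<exists>f\<in>?L. Lnorm (real CARD('m)) (\<lambda>x. g x - f x) < d \<and> (\<lambda>n. pairing (\<psi> n) f) \<longlonglongrightarrow> 0"
      by (intro bexI[OF _ Lspace_cut_continuous[OF monomial_span_continuous[OF hk(1)] mp, of "real k"]] conjI hk span)
  qed
  have L0: "(\<lambda>n. pairing (\<psi> n) f) \<longlonglongrightarrow> 0" if f: "f \<in> ?L" for f
  proof (rule pairing_tendsto_zero_closed[OF m \<psi> N f])
    fix d :: real assume "d > 0"
    from Cc_dense[OF f mp this]
    obtain g where g: "Cc g" "Lnorm (real CARD('m)) (\<lambda>x. f x - g x) < d" by blast
    show "\<exists>g\<in>?L. Lnorm (real CARD('m)) (\<lambda>x. f x - g x) < d \<and> (\<lambda>n. pairing (\<psi> n) g) \<longlonglongrightarrow> 0"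
      by (intro bexI[OF _ Cc_Lspace[OF g(1) mp]] conjI g Cc0)
  qed
  have "bdd_above (range (\<lambda>n. Lnorm 1 (grad (\<psi> n))))" using N by (auto intro!: bdd_aboveI)
  then have "(\<lambda>n. T (\<psi> n)) \<longlonglongrightarrow> 0"
    using T[unfolded sequentially_continuous_def, rule_format, of \<psi>] \<psi> L0 by simp
  then show False by (simp add: T1 LIMSEQ_const_iff)
qed

section \<open>Representation of mollified functionals\<close>

text \<open>Formally \<open>L\<close> integrates against a bounded field, and \<open>u\<close> is
  the mollification of that field; its value at \<open>y\<close> is found by applying
  \<open>L\<close> to the kernel centred at \<open>y\<close>. Since \<open>conv \<rho> g\<close> is
  an L_1 limit of Riemann sums of such translates and \<open>L\<close> is continuous in L_1, the
  integral formula follows.\<close>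

lemma mollified_Riesz:
  fixes L :: "(real^'m \<Rightarrow> real^'m) \<Rightarrow> real"
  assumes lin: "\<And>V W c. Cc V \<Longrightarrow> Cc W \<Longrightarrow> L (\<lambda>x. V x + c *\<^sub>R W x) = L V + c * L W"
    and bd: "\<And>V. Cc V \<Longrightarrow> \<bar>L V\<bar> \<le> C * (LINT x|lborel. norm (V x))"
    and \<rho>: "Cc \<rho>" "\<And>x. \<rho> x \<ge> 0" "(LINT x|lborel. \<rho> x) = 1"
  obtains u :: "real^'m \<Rightarrow> real^'m" where "continuous_on UNIV u" "\<And>y. norm (u y) \<le> C"
    "\<And>g. Cc g \<Longrightarrow> (LINT y|lborel. g y \<bullet> u y) = L (conv \<rho> g)"
proof -
  have L0: "L (\<lambda>x. 0) = 0" using bd[OF Cc_zero] by simp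
  have Ls: "L (\<lambda>x. c *\<^sub>R V x) = c * L V" if "Cc V" for V c
    using lin[OF Cc_zero that, of c] L0 by simp
  have Ladd: "L (\<lambda>x. V x + W x) = L V + L W" if "Cc V" "Cc W" for V W
    using lin[OF that, of 1] by simp
  have Ldiff: "L (\<lambda>x. V x - W x) = L V - L W" if "Cc V" "Cc W" for V W
    using lin[OF that, of "-1"] by simp
  have Lsum: "L (\<lambda>x. \<Sum>i\<in>I. V i x) = (\<Sum>i\<in>I. L (V i))" if "\<And>i. i \<in> I \<Longrightarrow> Cc (V i)"
    for V :: "'i \<Rightarrow> real^'m \<Rightarrow> real^'m" and I
    using that
  proof (induction I rule: infinite_finite_induct)
    case (insert i I)
    have "L (\<lambda>x. V i x + (\<Sum>i\<in>I. V i x)) = L (V i) + L (\<lambda>x. \<Sum>i\<in>I. V i x)"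
      using insert.prems by (intro Ladd Cc_sum) auto
    then show ?case using insert by simp
  qed (simp_all add: L0)
  define k where "k y a = (\<lambda>x. \<rho> (x - y) *\<^sub>R (a :: real^'m))" for y a
  have kc: "Cc (k y a)" for y a
    unfolding k_def by (intro Cc_scaleR_cont1 Cc_shift \<rho>) auto
  define u where "u y = (\<chi> i. L (k y (axis i 1)))" for y
  have u: "a \<bullet> u y = L (k y a)" for a y
  proof -
    have "k y a = (\<lambda>x. \<Sum>i\<in>UNIV. (a $ i) *\<^sub>R k y (axis i 1) x)"
    proof
      fix x
      have "k y a x = \<rho> (x - y) *\<^sub>R (\<Sum>i\<in>UNIV. a $ i *\<^sub>R axis i 1)"
        using basis_expansion[of a] by (simp add: k_def scalar_mult_eq_scaleR)
      also have "\<dots> = (\<Sum>i\<in>UNIV. (a $ i) *\<^sub>R k y (axis i 1) x)"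
        by (simp add: k_def scaleR_sum_right mult.commute)
      finally show "k y a x = (\<Sum>i\<in>UNIV. (a $ i) *\<^sub>R k y (axis i 1) x)" .
    qed
    then have "L (k y a) = (\<Sum>i\<in>UNIV. L (\<lambda>x. (a $ i) *\<^sub>R k y (axis i 1) x))"
      by (simp only: Lsum[of UNIV "\<lambda>i x. (a $ i) *\<^sub>R k y (axis i 1) x", OF Cc_scaleR[OF kc]])
    also have "\<dots> = a \<bullet> u y" by (simp add: Ls[OF kc] u_def inner_vec_def)
    finally show ?thesis by simp
  qed
  have kb: "\<bar>L (k y a)\<bar> \<le> C * norm a" for y a
  proof -
    have "(LINT x|lborel. \<rho> (- y + x)) = 1"
      using lborel_integral_affine(2)[OF Cc_measurable[OF \<rho>(1)], of "- y"] \<rho>(3) by simp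
    then have "(LINT x|lborel. norm (k y a x)) = norm a"
      using \<rho>(2) by (simp add: k_def)
    then show ?thesis using bd[OF kc[of y a]] by simp
  qed
  have C: "C \<ge> 0" using order_trans[OF abs_ge_zero kb[of 0 "axis undefined 1"]] by simp
  \<comment> \<open>Testing with the vector \<open>u y\<close> itself bounds the square of its norm
    by \<open>C\<close> times its norm.\<close>
  have ub: "norm (u y) \<le> C" for y
  proof (cases "u y = 0")
    case False
    have "(norm (u y))\<^sup>2 \<le> C * norm (u y)"
      using kb[of y "u y"] u[of "u y" y] by (simp add: power2_norm_eq_inner)
    then show ?thesis using False by (simp add: power2_eq_square)
  qed (use C in simp)
  obtain B where B: "B > 0" "\<And>x. \<bar>\<rho> x\<bar> \<le> B" using Cc_bounded[OF \<rho>(1)] by auto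
  obtain S where S: "S > 0" "\<And>x. norm x > S \<Longrightarrow> \<rho> x = 0" using Cc_support[OF \<rho>(1)] by blast
  have uc: "continuous_on UNIV u"
    unfolding u_def
  proof (intro continuous_on_vec_lambda)
    fix i
    let ?e = "axis i 1 :: real^'m"
    show "continuous_on UNIV (\<lambda>y. L (k y ?e))"
    proof (rule continuous_on_sequentiallyI)
      fix s :: "nat \<Rightarrow> real^'m" and y assume s: "s \<longlonglongrightarrow> y"
      obtain K where K: "\<And>n. norm (s n) \<le> K"
        using convergent_imp_Bseq[of s] s unfolding convergent_def Bseq_def by blast
      have "(\<lambda>n. LINT x|lborel. norm (k (s n) ?e x - k y ?e x)) \<longlonglongrightarrow> (LINT x|(lborel :: (real^'m) measure). 0)"
      \<comment> \<open>The convergent centres stay in a ball of radius \<open>K\<close>, so all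
        translated kernels live in the ball of radius \<open>K + S\<close>.\<close>
      proof (rule integral_dominated_convergence[where w="\<lambda>x. B * indicator (cball 0 (K + S)) x + norm (k y ?e x)"])
        show "(\<lambda>x. norm (k (s n) ?e x - k y ?e x)) \<in> borel_measurable lborel" for n
          using Cc_measurable[OF Cc_norm[OF Cc_diff[OF kc kc]]] by simp
        show "integrable lborel (\<lambda>x. B * indicator (cball 0 (K + S)) x + norm (k y ?e x))"
          by (intro Bochner_Integration.integrable_add Cc_integrable Cc_norm kc integrable_mult_right
              integrable_real_indicator emeasure_bounded_finite) auto
        show "AE x in lborel. (\<lambda>n. norm (k (s n) ?e x - k y ?e x)) \<longlonglongrightarrow> 0"
        proof (rule AE_I2)
          fix x :: "real^'m"
          have "(\<lambda>n. \<rho> (x - s n)) \<longlonglongrightarrow> \<rho> (x - y)"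
            by (rule continuous_on_tendsto_compose[OF Cc_continuous[OF \<rho>(1)]]) (auto intro!: tendsto_intros s)
          then have "(\<lambda>n. norm (k (s n) ?e x - k y ?e x)) \<longlonglongrightarrow> norm (k y ?e x - k y ?e x)"
            unfolding k_def by (intro tendsto_intros)
          then show "(\<lambda>n. norm (k (s n) ?e x - k y ?e x)) \<longlonglongrightarrow> 0" by simp
        qed
        show "AE x in lborel. norm (norm (k (s n) ?e x - k y ?e x)) \<le> B * indicator (cball 0 (K + S)) x + norm (k y ?e x)" for n
        proof (rule AE_I2)
          fix x :: "real^'m"
          have "norm (k (s n) ?e x) \<le> B * indicator (cball 0 (K + S)) x"
          proof (cases "norm x \<le> K + S")
            case True then show ?thesis using B by (simp add: k_def)
          next
            case False
            then have "norm (x - s n) > S" using K[of n] norm_triangle_ineq2[of x "s n"] by linarith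
            then show ?thesis using S B by (simp add: k_def)
          qed
          then show "norm (norm (k (s n) ?e x - k y ?e x)) \<le> B * indicator (cball 0 (K + S)) x + norm (k y ?e x)"
            using norm_triangle_ineq4[of "k (s n) ?e x" "k y ?e x"] by simp
        qed
      qed simp
      then have t0: "(\<lambda>n. C * (LINT x|lborel. norm (k (s n) ?e x - k y ?e x))) \<longlonglongrightarrow> 0"
        using tendsto_mult_right_zero by simp
      have "norm (L (k (s n) ?e) - L (k y ?e)) \<le> C * (LINT x|lborel. norm (k (s n) ?e x - k y ?e x))" for n
        using bd[OF Cc_diff[OF kc kc]] Ldiff[OF kc kc] by simp
      then have "(\<lambda>n. L (k (s n) ?e) - L (k y ?e)) \<longlonglongrightarrow> 0"
        by (intro Lim_null_comparison[OF always_eventually t0]) blast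
      then show "(\<lambda>n. L (k (s n) ?e)) \<longlonglongrightarrow> L (k y ?e)" by (simp add: LIM_zero_iff)
    qed
  qed
  have rep: "(LINT y|lborel. g y \<bullet> u y) = L (conv \<rho> g)" if g: "Cc g" for g :: "real^'m \<Rightarrow> real^'m"
  proof -
    obtain R1 where R1: "\<And>x. norm x > R1 \<Longrightarrow> g x = 0" using Cc_support[OF g] by blast
    define R where "R = Suc (nat \<lceil>R1\<rceil>)"
    have "real R > R1" unfolding R_def by linarith
    then have R: "\<And>x. norm x \<ge> real R \<Longrightarrow> g x = 0" using R1 by auto
    obtain B' where B': "B' > 0" "\<And>x. norm (g x) \<le> B'" using Cc_bounded[OF g] by blast
    define h where "h n = (1 / real (Suc n)) ^ CARD('m)" for n
    have h: "h n \<ge> 0" for n by (simp add: h_def)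
    \<comment> \<open>A Riemann sum for \<open>conv \<rho> g\<close> made of whole fields; applying
      \<open>L\<close> to it gives the Riemann sum for the integral of
      \<open>g y \<bullet> u y\<close>.\<close>
    define s where "s n = (\<lambda>x. h n *\<^sub>R (\<Sum>j\<in>grid R n. k (grid_point n j) (g (grid_point n j)) x))" for n
    have sc: "Cc (s n)" for n unfolding s_def by (intro Cc_scaleR Cc_sum kc)
    have cc: "Cc (conv \<rho> g)" by (rule Cc_conv[OF \<rho>(1) g])
    have Lsn: "L (s n) = h n *\<^sub>R (\<Sum>j\<in>grid R n. g (grid_point n j) \<bullet> u (grid_point n j))" for n
      unfolding s_def by (subst Ls[OF Cc_sum[OF kc]], subst Lsum[OF kc]) (simp add: u)
    have "(\<lambda>n. L (s n)) \<longlonglongrightarrow> (LINT y|lborel. g y \<bullet> u y)"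
      unfolding Lsn h_def
      by (rule Riemann_sums_tendsto[OF continuous_on_inner[OF Cc_continuous[OF g] uc]]) (use R in simp)
    moreover have "(\<lambda>n. L (s n)) \<longlonglongrightarrow> L (conv \<rho> g)"
    proof -
      \<comment> \<open>Volume of the gridded cube times a bound for one summand, hence independent
        of \<open>n\<close>.\<close>
      define M where "M = (2 * real R) ^ CARD('m) * (B * B')"
      have M: "M \<ge> 0" using B B' by (simp add: M_def)
      have "(\<lambda>n. LINT x|lborel. norm (s n x - conv \<rho> g x)) \<longlonglongrightarrow> (LINT x|(lborel :: (real^'m) measure). 0)"
      proof (rule integral_dominated_convergence[where w="\<lambda>x. M * indicator (cball 0 (R + S)) x + norm (conv \<rho> g x)"])
        show "(\<lambda>x. norm (s n x - conv \<rho> g x)) \<in> borel_measurable lborel" for n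
          using Cc_measurable[OF Cc_norm[OF Cc_diff[OF sc cc]]] by simp
        show "integrable lborel (\<lambda>x. M * indicator (cball 0 (R + S)) x + norm (conv \<rho> g x))"
          by (intro Bochner_Integration.integrable_add Cc_integrable Cc_norm cc integrable_mult_right
              integrable_real_indicator emeasure_bounded_finite) auto
        show "AE x in lborel. (\<lambda>n. norm (s n x - conv \<rho> g x)) \<longlonglongrightarrow> 0"
        proof (rule AE_I2)
          fix x :: "real^'m"
          have "(\<lambda>n. s n x) \<longlonglongrightarrow> (LINT y|lborel. \<rho> (x - y) *\<^sub>R g y)"
            unfolding s_def k_def h_def
            by (rule Riemann_sums_tendsto[OF Cc_continuous[OF conv_integrand_Cc(1)[OF \<rho>(1) g]]]) (use R in simp)
          then have "(\<lambda>n. s n x - conv \<rho> g x) \<longlonglongrightarrow> 0" by (simp add: conv_def LIM_zero)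
          then show "(\<lambda>n. norm (s n x - conv \<rho> g x)) \<longlonglongrightarrow> 0" by (rule tendsto_norm_zero)
        qed
        show "AE x in lborel. norm (norm (s n x - conv \<rho> g x)) \<le> M * indicator (cball 0 (R + S)) x + norm (conv \<rho> g x)" for n
        proof (rule AE_I2)
          fix x :: "real^'m"
          have t: "norm (k p (g p) x) \<le> B * B' * indicator (cball 0 (R + S)) x" for p
          proof (cases "norm x \<le> R + S")
            case True then show ?thesis using B B' by (auto simp: k_def intro!: mult_mono)
          next
            case False
            then have "norm p \<ge> real R \<or> norm (x - p) > S" using norm_triangle_ineq2[of x p] by linarith
            then show ?thesis using S R B B' by (auto simp: k_def)
          qed
          have "norm (s n x) \<le> h n * (\<Sum>j\<in>(grid R n :: ('m \<Rightarrow> int) set). B * B' * indicator (cball 0 (R + S)) x)"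
            unfolding s_def norm_scaleR using h[of n]
            by (intro mult_mono order_trans[OF norm_sum] sum_mono t) auto
          also have "\<dots> = (h n * real (card (grid R n :: ('m \<Rightarrow> int) set))) * (B * B' * indicator (cball 0 (R + S)) x)"
            by simp
          also have "h n * real (card (grid R n :: ('m \<Rightarrow> int) set)) = (2 * real R) ^ CARD('m)"
            unfolding h_def by (rule card_grid)
          finally have "norm (s n x) \<le> M * indicator (cball 0 (R + S)) x"
            by (simp only: M_def mult.assoc)
          then show "norm (norm (s n x - conv \<rho> g x)) \<le> M * indicator (cball 0 (R + S)) x + norm (conv \<rho> g x)"
            using norm_triangle_ineq4[of "s n x" "conv \<rho> g x"] by simp
        qed
      qed simp
      then have t0: "(\<lambda>n. C * (LINT x|lborel. norm (s n x - conv \<rho> g x))) \<longlonglongrightarrow> 0"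
        using tendsto_mult_right_zero by simp
      have "norm (L (s n) - L (conv \<rho> g)) \<le> C * (LINT x|lborel. norm (s n x - conv \<rho> g x))" for n
        using bd[OF Cc_diff[OF sc cc]] Ldiff[OF sc cc] by simp
      then have "(\<lambda>n. L (s n) - L (conv \<rho> g)) \<longlonglongrightarrow> 0"
        by (intro Lim_null_comparison[OF always_eventually t0]) blast
      then show ?thesis by (simp add: LIM_zero_iff)
    qed
    ultimately show ?thesis by (rule LIMSEQ_unique)
  qed
  show ?thesis by (rule that[OF uc ub rep])
qed

section \<open>Smooth functions vanishing at infinity with small gradient\<close>

lemma Ck_const: "Ck k (\<lambda>x::real^'m. c)"
proof (induction k arbitrary: c)
  case (Suc k)
  have "partial i (\<lambda>x::real^'m. c) = (\<lambda>x. 0)" for i by (simp add: fun_eq_iff partial_eq[of _ "\<lambda>h. 0"])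
  then show ?case using Suc by simp
qed simp

lemma Ck_coordinate: "Ck k (\<lambda>x::real^'m. x $ i)"
proof (cases k)
  case (Suc k')
  have d: "((\<lambda>x::real^'m. x $ i) has_derivative (\<lambda>h. h $ i)) (at x)" for x
    by (rule bounded_linear_imp_has_derivative[OF bounded_linear_vec_nth])
  have "partial j (\<lambda>x::real^'m. x $ i) = (\<lambda>x. axis j 1 $ i)" for j
    by (rule ext) (rule partial_eq[OF d])
  then show ?thesis using d by (auto simp: Suc Ck_const differentiable_def)
qed (auto intro: continuous_intros)

lemma bracket_pos: "0 < 1 + x \<bullet> (x::'a::real_inner)"
  by (simp add: add_pos_nonneg)

lemma has_derivative_bracket_powr:
  "((\<lambda>x::real^'m. (1 + x \<bullet> x) powr s) has_derivative
     (\<lambda>h. s * (1 + x \<bullet> x) powr (s - 1) * (2 * (x \<bullet> h)))) (at x)"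
proof -
  have 1: "((\<lambda>x::real^'m. 1 + x \<bullet> x) has_derivative (\<lambda>h. 2 * (x \<bullet> h))) (at x)"
    by (auto intro!: derivative_eq_intros simp: inner_commute)
  have "((\<lambda>z. z powr s) has_real_derivative s * (1 + x \<bullet> x) powr (s - 1)) (at (1 + x \<bullet> x))"
    by (rule has_real_derivative_powr[OF bracket_pos])
  from has_derivative_compose[OF 1 this[unfolded has_field_derivative_def]]
  show ?thesis .
qed

lemma grad_bracket_powr:
  "grad (\<lambda>x::real^'m. (1 + x \<bullet> x) powr s) x = (2 * s * (1 + x \<bullet> x) powr (s - 1)) *\<^sub>R x"
  by (simp add: vec_eq_iff partial_grad partial_eq[OF has_derivative_bracket_powr] inner_axis)

lemma Ck_bracket_powr: "Ck k (\<lambda>x::real^'m. (1 + x \<bullet> x) powr s)"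
proof (induction k arbitrary: s)
  case 0
  have "1 + x \<bullet> x \<noteq> 0" for x :: "real^'m" using bracket_pos[of x] by simp
  then show ?case by (auto intro!: continuous_intros)
next
  case (Suc k)
  have "partial i (\<lambda>x::real^'m. (1 + x \<bullet> x) powr s) = (\<lambda>x. (2 * s) * (x $ i * (1 + x \<bullet> x) powr (s - 1)))" for i
    by (simp add: fun_eq_iff partial_grad[symmetric] grad_bracket_powr)
  then show ?case
    using has_derivative_bracket_powr[of s] Ck_cmult[OF Ck_mult[OF Ck_coordinate Suc.IH]]
    by (auto simp: differentiable_def)
qed

text \<open>Dyadic shells: where \<open>1 + x \<bullet> x\<close> lies between 4^k and 4^(k+1), the
  integrand is at most \<open>t k\<close>, and the shell sits in a ball of radius 2^(k+1). The
  result is a geometric series of ratio \<open>4 powr - d\<close>. The constant is explicit because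
  its growth as \<open>d\<close> tends to 0 decides the capacity estimate.\<close>

lemma nn_integral_bracket_powr:
  fixes d :: real
  assumes d: "d > 0"
  shows "(\<integral>\<^sup>+x. ennreal ((1 + x \<bullet> x) powr - (real CARD('m) / 2 + d)) \<partial>(lborel :: (real^'m) measure))
    \<le> ennreal (2 ^ CARD('m) * measure lborel (ball (0::real^'m) 1) / (1 - 4 powr - d))"
proof -
  define a where "a = real CARD('m) / 2 + d"
  have a: "a > 0" using d by (simp add: a_def add_nonneg_pos)
  define c where "c = measure lborel (ball (0::real^'m) 1)"
  define t where "t k = 4 powr (- a * real k)" for k :: nat
  have pt: "ennreal ((1 + x \<bullet> x) powr - a) \<le> (\<Sum>k. ennreal (t k) * indicator (ball 0 (2 ^ Suc k)) x)"
    for x :: "real^'m"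
  proof -
    define z where "z = 1 + x \<bullet> x"
    have z: "z \<ge> 1" by (simp add: z_def)
    obtain N where N: "z < 4 ^ N" using real_arch_pow[of 4 z] by auto
    \<comment> \<open>The index of the shell containing \<open>x\<close>.\<close>
    define n where "n = (LEAST n. z < 4 ^ Suc n)"
    have "z < 4 ^ Suc N" using N z by simp
    then have n1: "z < 4 ^ Suc n" unfolding n_def by (rule LeastI)
    have n2: "4 ^ n \<le> z"
    proof (cases n)
      case (Suc n')
      then have "\<not> z < 4 ^ Suc n'" using not_less_Least[of n' "\<lambda>n. z < 4 ^ Suc n"] by (simp add: n_def)
      then show ?thesis using Suc by simp
    qed (use z in simp)
    have "(2 ^ Suc n)\<^sup>2 = (4::real) ^ Suc n"
      by (simp only: power2_eq_square power_mult_distrib[symmetric]) simp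
    then have "(norm x)\<^sup>2 < (2 ^ Suc n)\<^sup>2"
      using n1 unfolding z_def power2_norm_eq_inner by linarith
    then have "norm x < 2 ^ Suc n" by (rule power2_less_imp_less) simp
    then have xb: "x \<in> ball 0 (2 ^ Suc n)" by simp
    have "z powr - a \<le> (4 ^ n) powr - a" using n2 a by (intro powr_mono2') auto
    also have "\<dots> = t n" by (simp add: t_def powr_realpow[symmetric] powr_powr mult.commute)
    finally have "ennreal (z powr - a) \<le> ennreal (t n) * indicator (ball 0 (2 ^ Suc n)) x"
      using xb by (simp add: ennreal_leI)
    also have "\<dots> \<le> (\<Sum>k. ennreal (t k) * indicator (ball 0 (2 ^ Suc k)) x)"
    proof -
      have "F n \<le> (\<Sum>k. F k)" for F :: "nat \<Rightarrow> ennreal"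
        using sum_le_suminf[OF summableI, of "{n}" F] by simp
      then show ?thesis .
    qed
    finally show ?thesis by (simp add: z_def)
  qed
  have meas: "emeasure lborel (ball (0::real^'m) (2 ^ Suc k)) = ennreal (2 ^ (Suc k * CARD('m)) * c)" for k
  proof -
    have "measure lborel (ball (0::real^'m) (2 ^ Suc k)) = (2 ^ Suc k) ^ DIM(real^'m) * c"
      unfolding c_def by (rule content_ball_conv_unit_ball) simp
    moreover have "(2 ^ Suc k) ^ DIM(real^'m) = (2::real) ^ (Suc k * CARD('m))"
      by (simp only: power_mult[symmetric]) simp
    ultimately have "measure lborel (ball (0::real^'m) (2 ^ Suc k)) = 2 ^ (Suc k * CARD('m)) * c" by simp
    moreover have "emeasure lborel (ball (0::real^'m) (2 ^ Suc k)) < \<infinity>" by (rule emeasure_bounded_finite) simp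
    ultimately show ?thesis by (metis emeasure_eq_ennreal_measure infinity_ennreal_def less_irrefl)
  qed
  \<comment> \<open>The volume growth 2^(km) equals 4^(km/2) and cancels the part m/2 of the
    exponent \<open>a\<close>.\<close>
  have geo: "t k * (2 ^ (Suc k * CARD('m)) * c) = 2 ^ CARD('m) * c * (4 powr - d) ^ k" for k
  proof -
    have "(2::real) ^ (k * CARD('m)) = 4 powr (real CARD('m) / 2 * real k)"
    proof -
      have "(4::real) powr (real CARD('m) / 2 * real k) = (2 powr 2) powr (real CARD('m) / 2 * real k)" by simp
      also have "\<dots> = 2 powr (real (k * CARD('m)))" unfolding powr_powr by (simp add: mult.commute)
      also have "\<dots> = 2 ^ (k * CARD('m))" by (rule powr_realpow) simp
      finally show ?thesis by simp
    qed
    then have "t k * 2 ^ (k * CARD('m)) = 4 powr (- a * real k + real CARD('m) / 2 * real k)"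
      by (simp only: t_def powr_add)
    also have "- a * real k + real CARD('m) / 2 * real k = - d * real k"
      by (simp add: a_def algebra_simps)
    also have "4 powr (- d * real k) = (4 powr - d) ^ k" by (simp add: powr_powr powr_realpow[symmetric])
    finally have "t k * 2 ^ (k * CARD('m)) = (4 powr - d) ^ k" .
    then have "2 ^ CARD('m) * c * (t k * 2 ^ (k * CARD('m))) = 2 ^ CARD('m) * c * (4 powr - d) ^ k" by simp
    then show ?thesis by (simp add: power_add mult_ac)
  qed
  have r: "norm (4 powr - d) < 1" using d by (simp add: powr_less_one)
  have c0: "c \<ge> 0" by (simp add: c_def)
  have "(\<integral>\<^sup>+x. ennreal ((1 + x \<bullet> x) powr - a) \<partial>(lborel :: (real^'m) measure))
      \<le> (\<integral>\<^sup>+x. (\<Sum>k. ennreal (t k) * indicator (ball 0 (2 ^ Suc k)) x) \<partial>(lborel :: (real^'m) measure))"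
    by (intro nn_integral_mono pt)
  also have "\<dots> = (\<Sum>k. \<integral>\<^sup>+x. ennreal (t k) * indicator (ball 0 (2 ^ Suc k)) x \<partial>(lborel :: (real^'m) measure))"
    by (intro nn_integral_suminf borel_measurable_times_ennreal borel_measurable_const borel_measurable_indicator) simp
  also have "\<dots> = (\<Sum>k. ennreal (t k) * emeasure lborel (ball (0::real^'m) (2 ^ Suc k)))"
    by (simp add: nn_integral_cmult_indicator)
  also have "\<dots> = (\<Sum>k. ennreal (2 ^ CARD('m) * c * (4 powr - d) ^ k))"
  proof -
    have "ennreal (t k) * emeasure lborel (ball (0::real^'m) (2 ^ Suc k)) = ennreal (2 ^ CARD('m) * c * (4 powr - d) ^ k)" for k
      unfolding meas geo[symmetric] using c0 by (intro ennreal_mult[symmetric]) (auto simp: t_def)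
    then show ?thesis by simp
  qed
  also have "\<dots> = ennreal (\<Sum>k. 2 ^ CARD('m) * c * (4 powr - d) ^ k)"
    using c0 r by (intro suminf_ennreal2) (auto intro!: summable_mult summable_geometric)
  also have "(\<Sum>k. 2 ^ CARD('m) * c * (4 powr - d) ^ k) = 2 ^ CARD('m) * c / (1 - 4 powr - d)"
    using r by (simp add: suminf_mult suminf_geometric summable_geometric)
  finally show ?thesis by (simp add: a_def c_def)
qed

text \<open>The functions \<open>(1 + |x|\<^sup>2) powr -e\<close> show that infinity has zero \<open>m\<close>-capacity: the \<open>m\<close>-th power
  of the gradient has integral of order \<open>e\<^sup>m / e\<close>. They need not have compact support, since they
  only multiply test functions.\<close>

lemma slowly_decaying_cutoff:
  fixes r \<eta> :: real
  assumes m: "CARD('m) \<ge> 2" and \<eta>: "\<eta> > 0"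
  obtains \<zeta> :: "real^'m \<Rightarrow> real" where "\<And>k. Ck k \<zeta>" "\<And>x. 0 \<le> \<zeta> x" "\<And>x. \<zeta> x \<le> 1"
    "(\<zeta> \<longlongrightarrow> 0) at_infinity" "\<And>x. norm x \<le> r \<Longrightarrow> 1 - \<zeta> x \<le> \<eta>"
    "(\<lambda>x. norm (grad \<zeta> x)) \<in> Lspace (real CARD('m))"
    "Lnorm (real CARD('m)) (\<lambda>x. norm (grad \<zeta> x)) < \<eta>"
proof -
  let ?m = "real CARD('m)"
  define c where "c = measure lborel (ball (0::real^'m) 1)"
  \<comment> \<open>Constant for which the integral of the m-th power of the gradient is at most
    \<open>A * e\<close>.\<close>
  define A where "A = 4 ^ CARD('m) * c * 2"
  have A: "A \<ge> 0" by (simp add: A_def c_def)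
  define Lr where "Lr = ln (1 + r\<^sup>2)"
  have Lr: "Lr \<ge> 0" by (simp add: Lr_def)
  \<comment> \<open>The three bounds serve in turn to make \<open>?m * e \<le> 1\<close>, to bring
    \<open>A * e\<close> below \<open>\<eta> powr ?m\<close>, and to keep \<open>\<zeta>\<close>
    within \<open>\<eta>\<close> of 1 on the ball of radius \<open>r\<close>.\<close>
  define e where "e = min (1 / ?m) (min (\<eta> powr ?m / (2 * (A + 1))) (\<eta> / (Lr + 1)))"
  have mp: "?m > 0" "?m \<ge> 2" using m by auto
  have e: "e > 0" "e \<le> 1 / ?m" "e \<le> \<eta> powr ?m / (2 * (A + 1))" "e \<le> \<eta> / (Lr + 1)"
    using \<eta> A Lr mp by (auto simp: e_def)
  have me: "?m * e \<le> 1" using e(2) mp by (simp add: pos_le_divide_eq mult.commute)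
  have e1: "e \<le> 1"
  proof -
    have "1 * e \<le> ?m * e" using e(1) mp by (intro mult_right_mono) auto
    then show ?thesis using me by simp
  qed
  define \<zeta> :: "real^'m \<Rightarrow> real" where "\<zeta> x = (1 + x \<bullet> x) powr - e" for x
  have Ck\<zeta>: "Ck k \<zeta>" for k unfolding \<zeta>_def[abs_def] by (rule Ck_bracket_powr)
  have le1: "\<zeta> x \<le> 1" for x
    using powr_mono2'[of "- e" 1 "1 + x \<bullet> x"] e by (simp add: \<zeta>_def)
  have lim: "(\<zeta> \<longlongrightarrow> 0) at_infinity"
  proof -
    have "filterlim (\<lambda>x::real^'m. norm x) at_top at_infinity" by (rule filterlim_norm_at_top)
    moreover have "((\<lambda>s::real. (1 + s\<^sup>2) powr - e) \<longlongrightarrow> 0) at_top"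
    proof (rule tendsto_neg_powr)
      show "filterlim (\<lambda>s::real. 1 + s\<^sup>2) at_top at_top"
        by (intro filterlim_tendsto_add_at_top[OF tendsto_const] filterlim_pow_at_top filterlim_ident) simp
    qed (use e in simp)
    ultimately have "((\<lambda>x::real^'m. (1 + (norm x)\<^sup>2) powr - e) \<longlongrightarrow> 0) at_infinity"
      by (rule filterlim_compose[rotated])
    then show ?thesis by (simp add: \<zeta>_def[abs_def] power2_norm_eq_inner)
  qed
  have near1: "1 - \<zeta> x \<le> \<eta>" if "norm x \<le> r" for x
  proof -
    have "x \<bullet> x \<le> r\<^sup>2" using that by (metis dot_square_norm norm_ge_zero power_mono)
    then have "ln (1 + x \<bullet> x) \<le> Lr" unfolding Lr_def by (subst ln_le_cancel_iff) (auto simp: bracket_pos add_pos_nonneg)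
    then have "e * ln (1 + x \<bullet> x) \<le> e * (Lr + 1)" using e by (intro mult_left_mono) auto
    also have "\<dots> \<le> \<eta>" using e(4) Lr by (simp add: pos_le_divide_eq)
    finally have "e * ln (1 + x \<bullet> x) \<le> \<eta>" .
    moreover have "1 + (- e * ln (1 + x \<bullet> x)) \<le> exp (- e * ln (1 + x \<bullet> x))" by (rule exp_ge_add_one_self)
    moreover have "\<zeta> x = exp (- e * ln (1 + x \<bullet> x))"
      using bracket_pos[of x] by (simp add: \<zeta>_def powr_def)
    ultimately show ?thesis by simp
  qed
  define w where "w x = norm (grad \<zeta> x)" for x
  have gc: "continuous_on UNIV w"
  proof -
    have "continuous_on UNIV (partial i \<zeta>)" for i using Ck\<zeta>[of 1] by simp
    then show ?thesis unfolding w_def grad_def by (intro continuous_on_norm continuous_on_vec_lambda)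
  qed
  \<comment> \<open>The gradient has size at most 2e times the power -e - 1/2 of
    \<open>1 + x \<bullet> x\<close>, so its m-th power falls under the preceding integral estimate
    with \<open>d = ?m * e\<close>.\<close>
  have gb: "w x powr ?m \<le> (2 * e) ^ CARD('m) * (1 + x \<bullet> x) powr - (?m / 2 + ?m * e)" for x
  proof -
    have "w x = 2 * e * (1 + x \<bullet> x) powr (- e - 1) * norm x"
      using e by (simp add: w_def \<zeta>_def[abs_def] grad_bracket_powr)
    also have "\<dots> \<le> 2 * e * (1 + x \<bullet> x) powr (- e - 1) * (1 + x \<bullet> x) powr (1 / 2)"
    proof (rule mult_left_mono)
      have "norm x \<le> sqrt (1 + x \<bullet> x)" by (simp add: norm_eq_sqrt_inner)
      then show "norm x \<le> (1 + x \<bullet> x) powr (1 / 2)" by (simp add: powr_half_sqrt)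
    qed (use e in simp)
    also have "\<dots> = 2 * e * (1 + x \<bullet> x) powr (- e - 1 / 2)"
    proof -
      have "- e - 1 + 1 / 2 = - e - 1 / 2" by simp
      then show ?thesis by (simp only: mult.assoc powr_add[symmetric])
    qed
    finally have "w x powr ?m \<le> (2 * e * (1 + x \<bullet> x) powr (- e - 1 / 2)) powr ?m"
      by (intro powr_mono2) (auto simp: w_def)
    also have "\<dots> = (2 * e) ^ CARD('m) * (1 + x \<bullet> x) powr ((- e - 1 / 2) * ?m)"
      using e by (simp add: powr_mult powr_powr powr_realpow)
    also have "(- e - 1 / 2) * ?m = - (?m / 2 + ?m * e)" by (simp add: algebra_simps)
    finally show ?thesis .
  qed
  define I where "I = (2 * e) ^ CARD('m) * (2 ^ CARD('m) * c / (1 - 4 powr - (?m * e)))"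
  \<comment> \<open>The denominator of the geometric series is of order \<open>e\<close>, which
    costs one factor \<open>1 / e\<close>.\<close>
  have quot: "?m * e / 2 \<le> 1 - 4 powr - (?m * e)"
  proof -
    define s where "s = ?m * e"
    have s: "0 < s" "s \<le> 1" using me e mp by (auto simp: s_def)
    have "1 + s \<le> exp s" by (rule exp_ge_add_one_self)
    also have "exp s \<le> 4 powr s"
    proof -
      have "1 \<le> ln (4::real)" using exp_le by (subst ln_ge_iff) auto
      then show ?thesis using s by (simp add: powr_def)
    qed
    finally have "4 powr - s \<le> 1 / (1 + s)" using s by (simp add: powr_minus field_simps)
    moreover have "1 / (1 + s) \<le> 1 - s / 2" using s by (simp add: field_simps)
    ultimately show ?thesis by (simp add: s_def)
  qed
  have quot_pos: "0 < 1 - 4 powr - (?m * e)" using quot e mp by (smt (verit) divide_pos_pos mult_pos_pos)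
  have I0: "I \<ge> 0" using quot_pos e by (auto simp: I_def c_def intro!: mult_nonneg_nonneg divide_nonneg_nonneg)
  have IA: "I \<le> A * e"
  proof -
    have "I \<le> (2 * e) ^ CARD('m) * (2 ^ CARD('m) * c / (?m * e / 2))"
      unfolding I_def using quot quot_pos e mp
      by (intro mult_left_mono divide_left_mono mult_pos_pos) (auto simp: c_def)
    also have "\<dots> = 4 ^ CARD('m) * c * 2 * (e ^ CARD('m) / e) / ?m"
    proof -
      have "(4::real) ^ CARD('m) = 2 ^ CARD('m) * 2 ^ CARD('m)"
        by (simp only: power_mult_distrib[symmetric]) simp
      then show ?thesis by (simp add: power_mult_distrib mult_ac)
    qed
    also have "\<dots> \<le> 4 ^ CARD('m) * c * 2 * (e ^ CARD('m) / e) / 1"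
      using mp e by (intro divide_left_mono) (auto simp: c_def)
    also have "e ^ CARD('m) / e = e ^ (CARD('m) - 1)" using e m by (simp add: power_diff)
    \<comment> \<open>Here the dimension enters: for m at least 2 a factor \<open>e\<close>
      survives, so the integral is small with \<open>e\<close>.\<close>
    also have "4 ^ CARD('m) * c * 2 * e ^ (CARD('m) - 1) / 1 \<le> 4 ^ CARD('m) * c * 2 * e ^ 1 / 1"
      using e e1 m by (intro divide_right_mono mult_left_mono power_decreasing) (auto simp: c_def)
    finally show ?thesis by (simp add: A_def)
  qed
  have nn: "(\<integral>\<^sup>+x. ennreal (w x powr ?m) \<partial>lborel) \<le> ennreal I"
  proof -
    have "(\<integral>\<^sup>+x. ennreal (w x powr ?m) \<partial>lborel)
        \<le> (\<integral>\<^sup>+x. ennreal ((2 * e) ^ CARD('m)) * ennreal ((1 + x \<bullet> x) powr - (?m / 2 + ?m * e)) \<partial>(lborel :: (real^'m) measure))"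
    proof (rule nn_integral_mono)
      fix x
      have "ennreal (w x powr ?m) \<le> ennreal ((2 * e) ^ CARD('m) * (1 + x \<bullet> x) powr - (?m / 2 + ?m * e))"
        by (intro ennreal_leI gb)
      also have "\<dots> = ennreal ((2 * e) ^ CARD('m)) * ennreal ((1 + x \<bullet> x) powr - (?m / 2 + ?m * e))"
        using e by (intro ennreal_mult) auto
      finally show "ennreal (w x powr ?m)
          \<le> ennreal ((2 * e) ^ CARD('m)) * ennreal ((1 + x \<bullet> x) powr - (?m / 2 + ?m * e))" .
    qed
    also have "\<dots> = ennreal ((2 * e) ^ CARD('m)) * (\<integral>\<^sup>+x. ennreal ((1 + x \<bullet> x) powr - (?m / 2 + ?m * e)) \<partial>(lborel :: (real^'m) measure))"
      by (rule nn_integral_cmult) measurable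
    also have "\<dots> \<le> ennreal ((2 * e) ^ CARD('m)) * ennreal (2 ^ CARD('m) * c / (1 - 4 powr - (?m * e)))"
      unfolding c_def using e mp by (intro mult_left_mono nn_integral_bracket_powr) auto
    also have "\<dots> = ennreal I"
      unfolding I_def using e quot_pos by (subst ennreal_mult[symmetric]) (auto simp: c_def)
    finally show ?thesis .
  qed
  have wc: "continuous_on UNIV (\<lambda>x. \<bar>w x\<bar> powr ?m)" by (rule continuous_on_abs_powr[OF gc mp(1)])
  then have wm: "(\<lambda>x. \<bar>w x\<bar> powr ?m) \<in> borel_measurable lborel"
    using borel_measurable_continuous_onI by auto
  have wabs: "\<bar>w x\<bar> = w x" for x by (simp add: w_def)
  have int: "integrable lborel (\<lambda>x. \<bar>w x\<bar> powr ?m)"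
    using nn by (intro integrableI_nonneg wm) (auto simp: wabs intro: le_less_trans)
  have "(LINT x|lborel. \<bar>w x\<bar> powr ?m) \<le> I"
    by (subst integral_eq_nn_integral[OF wm]) (auto simp: wabs intro!: enn2real_leI I0 nn)
  also have "\<dots> \<le> A * e" by (rule IA)
  also have "\<dots> \<le> A * (\<eta> powr ?m / (2 * (A + 1)))" using e(3) A by (intro mult_left_mono) auto
  also have "\<dots> < \<eta> powr ?m"
  proof -
    have "A / (2 * (A + 1)) < 1" using A by simp
    then have "\<eta> powr ?m * (A / (2 * (A + 1))) < \<eta> powr ?m * 1" using \<eta> by (intro mult_strict_left_mono) auto
    then show ?thesis by (simp add: mult.commute)
  qed
  finally have "(LINT x|lebesgue. \<bar>w x\<bar> powr ?m) < \<eta> powr ?m"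
    by (simp add: continuous_integral_lebesgue[OF wc])
  then have wn: "Lnorm ?m w < \<eta>" by (rule Lnorm_less[OF mp(1) \<eta>])
  have "w \<in> borel_measurable lebesgue"
    using borel_measurable_continuous_onI[OF gc] by (simp add: measurable_completion)
  moreover have "integrable lebesgue (\<lambda>x. \<bar>w x\<bar> powr ?m)"
    using int wm by (subst integrable_completion) auto
  ultimately have wL: "w \<in> Lspace ?m" by (simp add: Lspace_def)
  show ?thesis
    by (rule that[OF Ck\<zeta> _ le1 lim near1 wL[unfolded w_def[abs_def]] wn[unfolded w_def[abs_def]]])
       (simp_all add: \<zeta>_def)
qed

section \<open>Divergences of fields vanishing at infinity\<close>

lemma distr_div_Cc: "\<phi> \<in> test_functions \<Longrightarrow> continuous_on UNIV v \<Longrightarrow> Cc (\<lambda>x. grad \<phi> x \<bullet> v x)"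
  by (rule Cc_inner1[OF test_grad])

lemma distr_div_eq:
  "\<phi> \<in> test_functions \<Longrightarrow> continuous_on UNIV v \<Longrightarrow> distr_div v \<phi> = - (LINT x|lborel. grad \<phi> x \<bullet> v x)"
  unfolding distr_div_def
  by (subst continuous_integral_lebesgue[OF Cc_continuous[OF distr_div_Cc]]) simp_all

lemma distr_div_close:
  assumes \<phi>: "\<phi> \<in> test_functions" and v: "continuous_on UNIV v" and w: "continuous_on UNIV w"
    and e: "\<And>x. norm (v x - w x) \<le> e"
  shows "\<bar>distr_div v \<phi> - distr_div w \<phi>\<bar> \<le> e * Lnorm 1 (grad \<phi>)"
proof -
  note iv = Cc_integrable_lebesgue[OF distr_div_Cc[OF \<phi> v]]
  note iw = Cc_integrable_lebesgue[OF distr_div_Cc[OF \<phi> w]]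
  note ig = Cc_integrable_lebesgue[OF Cc_norm[OF test_grad[OF \<phi>]]]
  have "\<bar>distr_div v \<phi> - distr_div w \<phi>\<bar> = \<bar>LINT x|lebesgue. grad \<phi> x \<bullet> w x - grad \<phi> x \<bullet> v x\<bar>"
    using iv iw by (simp add: distr_div_def)
  also have "\<dots> \<le> (LINT x|lebesgue. \<bar>grad \<phi> x \<bullet> w x - grad \<phi> x \<bullet> v x\<bar>)"
    by (rule integral_abs_bound)
  also have "\<dots> \<le> (LINT x|lebesgue. e * norm (grad \<phi> x))"
  proof (rule integral_mono)
    fix x
    have "\<bar>grad \<phi> x \<bullet> (w x - v x)\<bar> \<le> norm (grad \<phi> x) * norm (w x - v x)"
      by (rule Cauchy_Schwarz_ineq2)
    also have "\<dots> \<le> norm (grad \<phi> x) * e"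
      using e[of x] by (intro mult_left_mono) (auto simp: norm_minus_commute)
    finally show "\<bar>grad \<phi> x \<bullet> w x - grad \<phi> x \<bullet> v x\<bar> \<le> e * norm (grad \<phi> x)"
      by (simp add: inner_diff_right mult.commute)
  qed (use iv iw ig in auto)
  also have "\<dots> = e * Lnorm 1 (grad \<phi>)" by (simp add: Lnorm_1)
  finally show ?thesis .
qed

text \<open>The even kernel is moved from the field to \<open>\<phi>\<close>, the derivative from
  \<open>\<phi>\<close> to the kernel, and the differentiated kernel back to the field, which
  reflects it. As the partial derivatives of an even function are odd, the reflection and the minus
  sign cancel: the formula is the classical divergence of the mollified field.\<close>

lemma distr_div_mollified:
  fixes v :: "real^'m \<Rightarrow> real^'m"
  assumes \<phi>: "\<phi> \<in> test_functions" and v: "Cc v"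
    and \<kappa>: "Cc1 \<kappa>" "\<And>x. \<kappa> (- x) = \<kappa> x"
  shows "distr_div (conv \<kappa> v) \<phi>
    = (LINT x|lebesgue. \<phi> x * (- (\<Sum>i\<in>UNIV. conv (\<lambda>z. partial i \<kappa> (- z)) (\<lambda>y. v y $ i) x)))"
proof -
  have kc: "Cc \<kappa>" and pk: "Cc (partial i \<kappa>)" for i using \<kappa>(1) by (auto simp: Cc1_def)
  have vc: "Cc (\<lambda>y. v y $ i)" for i by (rule Cc_nth[OF v])
  note \<phi>c = test_Cc[OF \<phi>] and \<phi>1 = test_Cc1[OF \<phi>]
  have pp: "Cc (partial i \<phi>)" for i using \<phi>1 by (simp add: Cc1_def)
  have gc: "Cc (conv (\<lambda>z. partial i \<kappa> (- z)) (\<lambda>y. v y $ i))" for i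
    by (intro Cc_conv Cc_reflect pk vc)
  have comp: "(LINT x|lborel. partial i \<phi> x * conv \<kappa> (\<lambda>y. v y $ i) x)
      = (LINT x|lborel. \<phi> x * conv (\<lambda>z. partial i \<kappa> (- z)) (\<lambda>y. v y $ i) x)" for i
  proof -
    have even: "(\<lambda>z. \<kappa> (- z)) = \<kappa>" by (simp add: \<kappa>(2))
    have "(LINT x|lborel. partial i \<phi> x * conv \<kappa> (\<lambda>y. v y $ i) x)
        = (LINT x|lborel. conv \<kappa> (partial i \<phi>) x * v x $ i)"
      using integral_conv_mult[OF kc pp vc, of i i] by (simp add: even)
    also have "conv \<kappa> (partial i \<phi>) = conv (partial i \<kappa>) \<phi>"
      using partial_conv[OF kc \<phi>1, of i] partial_conv[OF \<phi>c \<kappa>(1), of i]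
        conv_commute[OF kc \<phi>c] conv_commute[OF \<phi>c pk] by simp
    also have "(LINT x|lborel. conv (partial i \<kappa>) \<phi> x * v x $ i)
        = (LINT x|lborel. \<phi> x * conv (\<lambda>z. partial i \<kappa> (- z)) (\<lambda>y. v y $ i) x)"
      by (rule integral_conv_mult[OF pk \<phi>c vc])
    finally show ?thesis .
  qed
  have "distr_div (conv \<kappa> v) \<phi> = - (LINT x|lborel. (\<Sum>i\<in>UNIV. partial i \<phi> x * conv \<kappa> (\<lambda>y. v y $ i) x))"
    unfolding distr_div_eq[OF \<phi> Cc_continuous[OF Cc_conv[OF kc v]]]
    by (simp add: inner_vec_def partial_grad conv_nth[OF kc v])
  also have "(LINT x|lborel. (\<Sum>i\<in>UNIV. partial i \<phi> x * conv \<kappa> (\<lambda>y. v y $ i) x))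
      = (\<Sum>i\<in>UNIV. LINT x|lborel. partial i \<phi> x * conv \<kappa> (\<lambda>y. v y $ i) x)"
    by (intro Bochner_Integration.integral_sum Cc_integrable Cc_mult1 pp Cc_continuous Cc_conv kc vc)
  also have "\<dots> = (\<Sum>i\<in>UNIV. LINT x|lborel. \<phi> x * conv (\<lambda>z. partial i \<kappa> (- z)) (\<lambda>y. v y $ i) x)"
    by (simp only: comp)
  also have "\<dots> = (LINT x|lborel. (\<Sum>i\<in>UNIV. \<phi> x * conv (\<lambda>z. partial i \<kappa> (- z)) (\<lambda>y. v y $ i) x))"
    by (rule Bochner_Integration.integral_sum[symmetric])
       (intro Cc_integrable Cc_mult1[OF \<phi>c] Cc_continuous[OF gc])
  also have "- \<dots> = (LINT x|lborel. \<phi> x * (- (\<Sum>i\<in>UNIV. conv (\<lambda>z. partial i \<kappa> (- z)) (\<lambda>y. v y $ i) x)))"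
    by (simp add: sum_distrib_left)
  also have "\<dots> = (LINT x|lebesgue. \<phi> x * (- (\<Sum>i\<in>UNIV. conv (\<lambda>z. partial i \<kappa> (- z)) (\<lambda>y. v y $ i) x)))"
    by (rule continuous_integral_lebesgue[symmetric])
       (intro continuous_intros Cc_continuous[OF \<phi>c] Cc_continuous[OF gc])
  finally show ?thesis .
qed

text \<open>Shortening every value of the field by the length \<open>e\<close>, with values of
  length at most \<open>e\<close> sent to 0, moves it by at most \<open>e\<close> and kills it
  outside a ball.\<close>

lemma C0_field_near_Cc:
  fixes v :: "real^'m \<Rightarrow> real^'m"
  assumes v: "v \<in> C0_fields" and e: "e > 0"
  obtains w where "Cc w" "\<And>x. norm (v x - w x) \<le> e"
proof -
  \<comment> \<open>The maximum in the denominator keeps \<open>s\<close> continuous at 0; where it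
    differs from \<open>norm y\<close>, the numerator is 0.\<close>
  define s where "s y = (max 0 (norm y - e) / max e (norm y)) *\<^sub>R y" for y :: "real^'m"
  have vc: "continuous_on UNIV v" and v0: "(v \<longlongrightarrow> 0) at_infinity"
    using v by (auto simp: C0_fields_def)
  have me: "max e (norm y) \<noteq> 0" for y :: "real^'m" using e by (auto simp: max_def)
  have sc: "continuous_on UNIV s"
    unfolding s_def[abs_def] by (intro continuous_intros ballI me)
  have "\<forall>\<^sub>F x in at_infinity. dist (v x) 0 < e" using v0 e by (rule tendstoD)
  then obtain R where R: "\<And>x. norm x \<ge> R \<Longrightarrow> norm (v x) < e"
    by (auto simp: eventually_at_infinity)
  show ?thesis
  proof (rule that[of "\<lambda>x. s (v x)"])
    show "Cc (\<lambda>x. s (v x))"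
    proof (rule CcI[of _ R])
      show "continuous_on UNIV (\<lambda>x. s (v x))"
        by (rule continuous_on_compose2[OF sc vc]) auto
    qed (use R in \<open>force simp: s_def\<close>)
    fix x
    show "norm (v x - s (v x)) \<le> e"
    proof (cases "norm (v x) \<le> e")
      case False
      then have n: "norm (v x) > 0" using e by linarith
      have "v x - s (v x) = (e / norm (v x)) *\<^sub>R v x"
        using False n by (simp add: s_def max_def diff_divide_distrib scaleR_diff_left)
      then show ?thesis using n e by simp
    qed (simp add: s_def)
  qed
qed

lemma C0_divergence_imp_approximable:
  fixes T :: "(real^'m \<Rightarrow> real) \<Rightarrow> real"
  assumes m: "CARD('m) \<ge> 2" and T: "is_C0_divergence T"
  shows "approximable T"
  unfolding approximable_def
proof (intro allI impI)
  fix \<epsilon> :: real assume \<epsilon>: "\<epsilon> > 0"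
  obtain v where v: "v \<in> C0_fields" "\<And>\<phi>. \<phi> \<in> test_functions \<Longrightarrow> T \<phi> = distr_div v \<phi>"
    using T unfolding is_C0_divergence_def by blast
  have vc: "continuous_on UNIV v" using v(1) by (simp add: C0_fields_def)
  obtain w where w: "Cc w" "\<And>x. norm (v x - w x) \<le> \<epsilon> / 2"
    using C0_field_near_Cc[OF v(1), of "\<epsilon> / 2"] \<epsilon> by auto
  \<comment> \<open>Half of \<open>\<epsilon>\<close> is left for mollifying, shared among the
    components because the norm is bounded by their sum.\<close>
  define e where "e = \<epsilon> / 2 / real CARD('m)"
  have e: "e > 0" using \<epsilon> by (simp add: e_def)
  obtain r where r: "r > 0" "\<And>x y. dist x y < r \<Longrightarrow> dist (w x) (w y) < e"
    using Cc_uniformly_continuous[OF w(1)] e unfolding uniformly_continuous_on_def by (metis UNIV_I)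
  obtain \<kappa> :: "real^'m \<Rightarrow> real" where \<kappa>: "Cc1 \<kappa>" "\<And>x. \<kappa> x \<ge> 0" "\<And>x. \<kappa> (- x) = \<kappa> x"
    "\<And>x. norm x \<ge> r \<Longrightarrow> \<kappa> x = 0" "(LINT x|lborel. \<kappa> x) = 1"
    by (rule mollifier_exists[OF r(1)]) (rule that)
  have kc: "Cc \<kappa>" using \<kappa>(1) by (simp add: Cc1_def)
  have close: "norm (w x - conv \<kappa> w x) \<le> \<epsilon> / 2" for x
  proof -
    have "\<bar>(w x - conv \<kappa> w x) $ i\<bar> \<le> e" for i
    proof -
      have "\<bar>conv \<kappa> (\<lambda>y. w y $ i) x - w x $ i\<bar> \<le> e"
      proof (rule conv_mollifier_close[OF kc \<kappa>(2,4,5) Cc_nth[OF w(1)]])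
        fix x y :: "real^'m" assume "dist x y < r"
        then show "dist (w x $ i) (w y $ i) \<le> e"
          using r(2)[of x y] dist_vec_nth_le[of "w x" i "w y"] by linarith
      qed
      then show ?thesis by (simp add: conv_nth[OF kc w(1)] abs_minus_commute)
    qed
    then have "(\<Sum>i\<in>UNIV. \<bar>(w x - conv \<kappa> w x) $ i\<bar>) \<le> (\<Sum>i\<in>(UNIV :: 'm set). e)" by (intro sum_mono)
    then show ?thesis using norm_le_l1_cart[of "w x - conv \<kappa> w x"] by (simp add: e_def)
  qed
  have vw: "norm (v x - conv \<kappa> w x) \<le> \<epsilon>" for x
    using norm_triangle_ineq[of "v x - w x" "w x - conv \<kappa> w x"] w(2)[of x] close[of x] by simp
  define g where "g x = - (\<Sum>i\<in>UNIV. conv (\<lambda>z. partial i \<kappa> (- z)) (\<lambda>y. w y $ i) x)" for x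
  have "Cc (\<lambda>x. (-1) *\<^sub>R (\<Sum>i\<in>UNIV. conv (\<lambda>z. partial i \<kappa> (- z)) (\<lambda>y. w y $ i) x))"
    using \<kappa>(1) by (intro Cc_scaleR Cc_sum Cc_conv Cc_reflect Cc_nth w(1)) (simp add: Cc1_def)
  then have gc: "Cc g" by (simp add: g_def[abs_def])
  show "\<exists>f\<in>Lspace (real CARD('m)). \<forall>\<phi>\<in>test_functions.
      \<bar>T \<phi> - pairing \<phi> f\<bar> \<le> \<epsilon> * Lnorm 1 (grad \<phi>)"
  proof (intro bexI ballI)
    show "g \<in> Lspace (real CARD('m))" by (rule Cc_Lspace[OF gc]) simp
    fix \<phi> :: "real^'m \<Rightarrow> real" assume \<phi>: "\<phi> \<in> test_functions"
    show "\<bar>T \<phi> - pairing \<phi> g\<bar> \<le> \<epsilon> * Lnorm 1 (grad \<phi>)"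
      using distr_div_close[OF \<phi> vc Cc_continuous[OF Cc_conv[OF kc w(1)]] vw]
      unfolding v(2)[OF \<phi>] distr_div_mollified[OF \<phi> w(1) \<kappa>(1,3)] g_def .
  qed
qed

section \<open>From approximable functionals to divergences\<close>

lemma Lspace_dominated:
  fixes h w :: "real^'m \<Rightarrow> real"
  assumes h: "h \<in> borel_measurable lebesgue" and w: "w \<in> Lspace p" and p: "p > 0"
    and C: "C \<ge> 0" and le: "\<And>x. \<bar>h x\<bar> \<le> C * \<bar>w x\<bar>"
  shows "h \<in> Lspace p" "Lnorm p h \<le> C * Lnorm p w"
proof -
  have pt: "\<bar>h x\<bar> powr p \<le> C powr p * \<bar>w x\<bar> powr p" for x
  proof -
    have "\<bar>h x\<bar> powr p \<le> (C * \<bar>w x\<bar>) powr p" using p le[of x] by (intro powr_mono2) auto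
    then show ?thesis using C by (simp add: powr_mult)
  qed
  have iw: "integrable lebesgue (\<lambda>x. C powr p * \<bar>w x\<bar> powr p)" using w by (simp add: Lspace_def)
  have ih: "integrable lebesgue (\<lambda>x. \<bar>h x\<bar> powr p)"
    by (rule Bochner_Integration.integrable_bound[OF iw]) (use h pt in \<open>auto intro!: AE_I2\<close>)
  then show "h \<in> Lspace p" using h by (simp add: Lspace_def)
  have "(LINT x|lebesgue. \<bar>h x\<bar> powr p) \<le> (LINT x|lebesgue. C powr p * \<bar>w x\<bar> powr p)"
    by (rule integral_mono[OF ih iw pt])
  then have "Lnorm p h \<le> (C powr p * (LINT x|lebesgue. \<bar>w x\<bar> powr p)) powr (1 / p)"
    unfolding Lnorm_def real_norm_def using p by (intro powr_mono2) auto
  also have "\<dots> = C * Lnorm p w"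
    using C p by (simp add: Lnorm_def powr_mult powr_powr)
  finally show "Lnorm p h \<le> C * Lnorm p w" .
qed

lemma mollifier_close_Lnorm:
  fixes f :: "real^'m \<Rightarrow> real"
  assumes f: "Cc f" and p: "p > 0" and e: "e > 0"
  obtains \<kappa> :: "real^'m \<Rightarrow> real" where "Cc \<kappa>" "\<And>x. \<kappa> x \<ge> 0" "\<And>x. \<kappa> (- x) = \<kappa> x"
    "(LINT x|lborel. \<kappa> x) = 1" "Lnorm p (\<lambda>x. conv \<kappa> f x - f x) < e"
proof -
  obtain R where R: "R > 0" "\<And>x. norm x > R \<Longrightarrow> f x = 0" using Cc_support[OF f] by blast
  define M where "M = measure lebesgue (cball (0::real^'m) (R + 1))"
  define d where "d = (e powr p / (M + 1)) powr (1 / p)"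
  have M: "M \<ge> 0" by (simp add: M_def)
  have d: "d > 0" "d powr p = e powr p / (M + 1)" using e p M by (auto simp: d_def powr_powr add_nonneg_eq_0_iff)
  obtain r where r: "r > 0" "\<And>x y. dist x y < r \<Longrightarrow> dist (f x) (f y) < d"
    using Cc_uniformly_continuous[OF f] d(1) unfolding uniformly_continuous_on_def by (metis UNIV_I)
  \<comment> \<open>Capped at 1 so that \<open>conv \<kappa> f\<close> stays supported in the ball
    of radius \<open>R + 1\<close>, whose measure is \<open>M\<close>.\<close>
  define r' where "r' = min r 1"
  have r': "r' > 0" using r by (simp add: r'_def)
  obtain \<kappa> :: "real^'m \<Rightarrow> real" where \<kappa>: "Cc1 \<kappa>" "\<And>x. \<kappa> x \<ge> 0" "\<And>x. \<kappa> (- x) = \<kappa> x"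
    "\<And>x. norm x \<ge> r' \<Longrightarrow> \<kappa> x = 0" "(LINT x|lborel. \<kappa> x) = 1"
    by (rule mollifier_exists[OF r']) (rule that)
  have kc: "Cc \<kappa>" using \<kappa>(1) by (simp add: Cc1_def)
  have close: "\<bar>conv \<kappa> f x - f x\<bar> \<le> d" for x
    by (rule conv_mollifier_close[OF kc \<kappa>(2,4,5) f]) (use r(2) in \<open>auto simp: r'_def intro: less_imp_le\<close>)
  have out: "conv \<kappa> f x - f x = 0" if x: "norm x > R + 1" for x
  proof -
    have "\<kappa> (x - y) *\<^sub>R f y = 0" for y
    proof (cases "norm y > R")
      case False
      then have "norm (x - y) \<ge> r'" using x norm_triangle_ineq2[of x y] by (simp add: r'_def)
      then show ?thesis using \<kappa>(4) by simp
    qed (use R in simp)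
    then have "conv \<kappa> f x = 0" unfolding conv_def by (simp only: integral_zero)
    then show ?thesis using R x by simp
  qed
  have "(LINT x|lebesgue. \<bar>conv \<kappa> f x - f x\<bar> powr p) \<le> d powr p * M"
    unfolding M_def
  proof (rule Lspace_bounded_support(2)[OF _ p])
    show "(\<lambda>x. conv \<kappa> f x - f x) \<in> borel_measurable lebesgue"
      using Cc_Lspace[OF Cc_diff[OF Cc_conv[OF kc f] f] p] by (simp add: Lspace_def)
  qed (use close out in auto)
  also have "\<dots> = e powr p * (M / (M + 1))" by (simp add: d)
  also have "\<dots> < e powr p * 1" using e M by (intro mult_strict_left_mono) auto
  finally have "Lnorm p (\<lambda>x. conv \<kappa> f x - f x) < e"
    using Lnorm_less[OF p e] by simp
  then show ?thesis using that kc \<kappa>(2,3,5) by blast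
qed

text \<open>The Hahn-Banach theorem extends \<open>grad \<psi> \<mapsto> - \<integral> \<psi> f\<close> from gradients to all fields without
  increasing its norm; mollifying the extension turns it into a continuous field \<open>u\<close>.\<close>

lemma bounded_field_with_mollified_divergence:
  fixes f :: "real^'m \<Rightarrow> real"
  assumes f: "Cc f" and b: "\<And>\<phi>. \<phi> \<in> test_functions \<Longrightarrow> \<bar>LINT x|lborel. \<phi> x * f x\<bar> \<le> C * Lnorm 1 (grad \<phi>)"
    and \<kappa>: "Cc \<kappa>" "\<And>x. \<kappa> x \<ge> 0" "\<And>x. \<kappa> (- x) = \<kappa> x" "(LINT x|lborel. \<kappa> x) = 1" and C: "C \<ge> 0"
  obtains u :: "real^'m \<Rightarrow> real^'m" where "continuous_on UNIV u" "\<And>x. norm (u x) \<le> C"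
    "\<And>\<phi>. \<phi> \<in> test_functions \<Longrightarrow> distr_div u \<phi> = (LINT x|lborel. \<phi> x * conv \<kappa> f x)"
proof -
  define V where "V = {W :: real^'m \<Rightarrow> real^'m. Cc W}"
  define p where "p W = C * (LINT x|lborel. norm (W x))" for W :: "real^'m \<Rightarrow> real^'m"
  \<comment> \<open>A relation, not yet a function of the gradient: consistency comes from
    domination by \<open>p\<close>. The minus sign is that of the distributional divergence.\<close>
  define G where "G = {(grad \<psi>, - (LINT x|lborel. \<psi> x * f x)) |\<psi>. \<psi> \<in> test_functions}"
  have V: "(\<lambda>x. W x + c *\<^sub>R Z x) \<in> V" if "W \<in> V" "Z \<in> V" for W Z c
    using that by (simp add: V_def Cc_add Cc_scaleR)
  have p_add: "p (\<lambda>x. W x + Z x) \<le> p W + p Z" if "W \<in> V" "Z \<in> V" for W Z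
  proof -
    have c: "Cc W" "Cc Z" using that by (auto simp: V_def)
    have "(LINT x|lborel. norm (W x + Z x)) \<le> (LINT x|lborel. norm (W x) + norm (Z x))"
      by (intro integral_mono Bochner_Integration.integrable_add Cc_integrable Cc_norm Cc_add c norm_triangle_ineq)
    also have "\<dots> = (LINT x|lborel. norm (W x)) + (LINT x|lborel. norm (Z x))"
      by (intro Bochner_Integration.integral_add Cc_integrable Cc_norm c)
    finally show ?thesis using C unfolding p_def by (simp add: distrib_left[symmetric] mult_left_mono)
  qed
  have p_scale: "p (\<lambda>x. c *\<^sub>R W x) = c * p W" if "W \<in> V" "c \<ge> 0" for W c
    using that by (simp add: p_def)
  have dg: "dominated_graph V p G"
    unfolding dominated_graph_def
  proof (intro conjI allI impI)
    show "G \<subseteq> V \<times> UNIV" by (auto simp: G_def V_def intro: test_grad)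
    have "grad (\<lambda>x::real^'m. 0) = (\<lambda>x. 0)"
    proof
      fix x :: "real^'m"
      have "-1 < norm x" by (rule less_le_trans[OF _ norm_ge_zero]) simp
      then show "grad (\<lambda>x::real^'m. 0) x = 0" by (rule grad_outside_support[rotated]) simp
    qed
    then show "((\<lambda>x. 0), 0) \<in> G" unfolding G_def using test_zero by force
  next
    fix W a Z d c assume "(W, a) \<in> G" "(Z, d) \<in> G"
    then obtain \<psi>1 \<psi>2 where t: "\<psi>1 \<in> test_functions" "\<psi>2 \<in> test_functions"
      and e: "W = grad \<psi>1" "a = - (LINT x|lborel. \<psi>1 x * f x)" "Z = grad \<psi>2" "d = - (LINT x|lborel. \<psi>2 x * f x)"
      by (auto simp: G_def)
    have "grad (\<lambda>x. \<psi>1 x + c * \<psi>2 x) = (\<lambda>x. W x + c *\<^sub>R Z x)"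
      using grad_add[OF test_differentiable[OF t(1)] test_differentiable[OF test_cmult[OF t(2), of c]]]
        grad_cmult[OF test_differentiable[OF t(2)]] by (auto simp: e)
    moreover have "(LINT x|lborel. (\<psi>1 x + c * \<psi>2 x) * f x) = (LINT x|lborel. \<psi>1 x * f x) + c * (LINT x|lborel. \<psi>2 x * f x)"
      using Cc_integrable[OF Cc_mult1[OF test_Cc[OF t(1)] Cc_continuous[OF f]]]
        Cc_integrable[OF Cc_mult1[OF test_Cc[OF t(2)] Cc_continuous[OF f]]]
      by (simp add: distrib_right mult.assoc)
    then have "a + c * d = - (LINT x|lborel. (\<psi>1 x + c * \<psi>2 x) * f x)" by (simp add: e)
    ultimately show "((\<lambda>x. W x + c *\<^sub>R Z x), a + c * d) \<in> G"
      unfolding G_def using test_lin[OF t, of c] by (intro CollectI exI[of _ "\<lambda>x. \<psi>1 x + c * \<psi>2 x"]) simp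
  next
    fix W a assume "(W, a) \<in> G"
    then obtain \<psi> where t: "\<psi> \<in> test_functions" and e: "W = grad \<psi>" "a = - (LINT x|lborel. \<psi> x * f x)"
      by (auto simp: G_def)
    have "a \<le> C * Lnorm 1 (grad \<psi>)" using b[OF t] by (simp add: e)
    then show "a \<le> p W" by (simp add: p_def e Lnorm_grad[OF test_Cc1[OF t]])
  qed
  obtain L where L: "\<And>W a. (W, a) \<in> G \<Longrightarrow> L W = a"
    "\<And>W Z c. W \<in> V \<Longrightarrow> Z \<in> V \<Longrightarrow> L (\<lambda>x. W x + c *\<^sub>R Z x) = L W + c * L Z"
    "\<And>W. W \<in> V \<Longrightarrow> L W \<le> p W"
    by (rule Hahn_Banach[OF V p_add p_scale dg]) (assumption+, rule that)
  have L0: "L (\<lambda>x. 0) = 0"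
    using L(2)[of "\<lambda>x. 0" "\<lambda>x. 0" 1] Cc_zero by (simp add: V_def)
  have Labs: "\<bar>L W\<bar> \<le> C * (LINT x|lborel. norm (W x))" if "Cc W" for W
  proof -
    have W: "W \<in> V" "(\<lambda>x. 0) \<in> V" using that Cc_zero by (auto simp: V_def)
    have "L (\<lambda>x. 0 + (-1) *\<^sub>R W x) = L (\<lambda>x. 0) + (-1) * L W" by (rule L(2)[OF W(2,1)])
    moreover have "L (\<lambda>x. 0 + (-1) *\<^sub>R W x) \<le> p (\<lambda>x. 0 + (-1) *\<^sub>R W x)" by (rule L(3)[OF V[OF W(2,1)]])
    ultimately show ?thesis using L(3)[OF W(1)] L0 by (simp add: p_def abs_le_iff)
  qed
  obtain u where u: "continuous_on UNIV u" "\<And>y. norm (u y) \<le> C"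
    "\<And>g. Cc g \<Longrightarrow> (LINT y|lborel. g y \<bullet> u y) = L (conv \<kappa> g)"
    using mollified_Riesz[of L C \<kappa>] L(2) Labs \<kappa> by (auto simp: V_def)
  have "distr_div u \<phi> = (LINT x|lborel. \<phi> x * conv \<kappa> f x)" if \<phi>: "\<phi> \<in> test_functions" for \<phi>
  proof -
    \<comment> \<open>Mollification commutes with the gradient, so \<open>L\<close> is evaluated on
      a gradient, where its value is prescribed.\<close>
    have "(LINT x|lborel. grad \<phi> x \<bullet> u x) = L (grad (conv \<kappa> \<phi>))"
      by (simp add: u(3)[OF test_grad[OF \<phi>]] grad_conv[OF \<kappa>(1) test_Cc1[OF \<phi>]])
    also have "\<dots> = - (LINT x|lborel. conv \<kappa> \<phi> x * f x)"
      using test_conv[OF \<kappa>(1) \<phi>] by (intro L(1)) (auto simp: G_def)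
    also have "(LINT x|lborel. conv \<kappa> \<phi> x * f x) = (LINT x|lborel. \<phi> x * conv \<kappa> f x)"
      using integral_conv_mult[OF \<kappa>(1) test_Cc[OF \<phi>] f] by (simp add: \<kappa>(3))
    finally show ?thesis by (simp add: distr_div_eq[OF \<phi> u(1)])
  qed
  with u(1,2) show ?thesis by (rule that)
qed

lemma approximable_minus_pairing:
  fixes T S :: "(real^'m \<Rightarrow> real) \<Rightarrow> real"
  assumes m: "CARD('m) \<ge> 2" and T: "approximable T" and g: "g \<in> Lspace (real CARD('m))"
    and S: "\<And>\<phi>. \<phi> \<in> test_functions \<Longrightarrow> S \<phi> = T \<phi> - pairing \<phi> g"
  shows "approximable S"
  unfolding approximable_def
proof (intro allI impI)
  fix e :: real assume "e > 0"
  then obtain f where f: "f \<in> Lspace (real CARD('m))"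
    "\<forall>\<phi>\<in>test_functions. \<bar>T \<phi> - pairing \<phi> f\<bar> \<le> e * Lnorm 1 (grad \<phi>)"
    using T unfolding approximable_def by blast
  show "\<exists>f\<in>Lspace (real CARD('m)). \<forall>\<phi>\<in>test_functions.
      \<bar>S \<phi> - pairing \<phi> f\<bar> \<le> e * Lnorm 1 (grad \<phi>)"
  proof (intro bexI ballI)
    show "(\<lambda>x. f x + (-1) * g x) \<in> Lspace (real CARD('m))"
      using f(1) g by (intro Lspace_add Lspace_cmult) auto
    fix \<phi> :: "real^'m \<Rightarrow> real" assume \<phi>: "\<phi> \<in> test_functions"
    show "\<bar>S \<phi> - (LINT x|lebesgue. \<phi> x * (f x + (-1) * g x))\<bar> \<le> e * Lnorm 1 (grad \<phi>)"
      unfolding S[OF \<phi>] pairing_lin_right[OF m f(1) g \<phi>] using bspec[OF f(2) \<phi>] by simp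
  qed
qed

text \<open>One round of the correction, with \<open>v = \<zeta> u\<close>. Its divergence is
  \<open>\<zeta> k + grad \<zeta> \<bullet> u\<close>, with \<open>k\<close> the mollified
  \<open>f\<close>: the first term is close to \<open>k\<close> in L_m, the second is small in L_m.
  That the divergence is exactly an L_m function keeps the remainder approximable for the next
  round.\<close>

lemma approximable_by_C0_divergence:
  fixes T :: "(real^'m \<Rightarrow> real) \<Rightarrow> real"
  assumes m: "CARD('m) \<ge> 2" and T: "approximable T" and c: "c > 0" and \<delta>: "\<delta> > 0"
    and b: "\<And>\<phi>. \<phi> \<in> test_functions \<Longrightarrow> \<bar>T \<phi>\<bar> \<le> c * Lnorm 1 (grad \<phi>)"
  obtains v g where "v \<in> C0_fields" "\<And>x. norm (v x) \<le> 2 * c" "g \<in> Lspace (real CARD('m))"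
    "\<And>\<phi>. \<phi> \<in> test_functions \<Longrightarrow> distr_div v \<phi> = pairing \<phi> g"
    "\<And>\<phi>. \<phi> \<in> test_functions \<Longrightarrow> \<bar>T \<phi> - pairing \<phi> g\<bar> \<le> \<delta> * Lnorm 1 (grad \<phi>)"
proof -
  let ?L = "Lspace (real CARD('m)) :: (real^'m \<Rightarrow> real) set"
  let ?n = "Lnorm (real CARD('m)) :: (real^'m \<Rightarrow> real) \<Rightarrow> real"
  have mp: "real CARD('m) > 0" by simp
  \<comment> \<open>The errors add up to \<open>5 * d\<close>: two for replacing \<open>T\<close> by
    \<open>f\<close>, one each for mollifying, for multiplying by \<open>\<zeta>\<close>, and for
    \<open>l\<close>. The bound \<open>2 * d \<le> c\<close> is what allows the constant
    \<open>2 * c\<close> for \<open>f\<close>.\<close>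
  define d where "d = min (\<delta> / 8) (c / 2)"
  have d: "d > 0" "8 * d \<le> \<delta>" "2 * d \<le> c" using \<delta> c by (auto simp: d_def)
  have pair_close: "\<bar>pairing \<phi> h - pairing \<phi> k\<bar> \<le> d * Lnorm 1 (grad \<phi>)"
    if \<phi>: "\<phi> \<in> test_functions" and hk: "h \<in> ?L" "k \<in> ?L" "?n (\<lambda>x. h x - k x) \<le> d" for \<phi> h k
  proof -
    have "(LINT x|lebesgue. \<phi> x * (h x - k x)) = pairing \<phi> h - pairing \<phi> k"
      using pairing_lin_right[OF m hk(1,2) \<phi>, of "-1"] by simp
    moreover have "\<bar>LINT x|lebesgue. \<phi> x * (h x - k x)\<bar> \<le> d * Lnorm 1 (grad \<phi>)"
      by (rule order_trans[OF pairing_bound(2)[OF m test_Cc1[OF \<phi>] Lspace_diff[OF hk(1,2) mp]]])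
         (intro mult_right_mono hk Lnorm_nonneg)
    ultimately show ?thesis by simp
  qed
  obtain f0 where f0: "f0 \<in> ?L"
    "\<forall>\<phi>\<in>test_functions. \<bar>T \<phi> - pairing \<phi> f0\<bar> \<le> d * Lnorm 1 (grad \<phi>)"
    using T d(1) unfolding approximable_def by blast
  obtain f where f: "Cc f" "?n (\<lambda>x. f0 x - f x) < d" using Cc_dense[OF f0(1) mp d(1)] by blast
  note fL = Cc_Lspace[OF f(1) mp]
  have Tf: "\<bar>T \<phi> - pairing \<phi> f\<bar> \<le> 2 * d * Lnorm 1 (grad \<phi>)"
    if \<phi>: "\<phi> \<in> test_functions" for \<phi>
    using bspec[OF f0(2) \<phi>] pair_close[OF \<phi> f0(1) fL] f(2) by linarith
  have leb: "pairing \<phi> k = (LINT x|lborel. \<phi> x * k x)"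
    if "\<phi> \<in> test_functions" "continuous_on UNIV k" for \<phi> k :: "real^'m \<Rightarrow> real"
    by (rule continuous_integral_lebesgue[OF Cc_continuous[OF Cc_mult1[OF test_Cc[OF that(1)] that(2)]]])
  have fb: "\<bar>LINT x|lborel. \<phi> x * f x\<bar> \<le> (2 * c) * Lnorm 1 (grad \<phi>)" if \<phi>: "\<phi> \<in> test_functions" for \<phi>
  proof -
    have "2 * d * Lnorm 1 (grad \<phi>) \<le> c * Lnorm 1 (grad \<phi>)" by (intro mult_right_mono d Lnorm_nonneg)
    then show ?thesis using Tf[OF \<phi>] b[OF \<phi>] unfolding leb[OF \<phi> Cc_continuous[OF f(1)]] by linarith
  qed
  obtain \<kappa> :: "real^'m \<Rightarrow> real" where \<kappa>: "Cc \<kappa>" "\<And>x. \<kappa> x \<ge> 0" "\<And>x. \<kappa> (- x) = \<kappa> x"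
    "(LINT x|lborel. \<kappa> x) = 1" and fk: "?n (\<lambda>x. conv \<kappa> f x - f x) < d"
    by (rule mollifier_close_Lnorm[OF f(1) mp d(1)]) (rule that)
  define k where "k = conv \<kappa> f"
  have kc: "Cc k" unfolding k_def by (rule Cc_conv[OF \<kappa>(1) f(1)])
  note kL = Cc_Lspace[OF kc mp]
  have c': "2 * c > 0" using c by simp
  obtain u where u: "continuous_on UNIV u" "\<And>x. norm (u x) \<le> 2 * c"
    "\<And>\<phi>. \<phi> \<in> test_functions \<Longrightarrow> distr_div u \<phi> = (LINT x|lborel. \<phi> x * conv \<kappa> f x)"
    by (rule bounded_field_with_mollified_divergence[OF f(1) fb \<kappa> order_less_imp_le[OF c']])
       (assumption, rule that)
  obtain R where R: "R > 0" "\<And>x. norm x > R \<Longrightarrow> k x = 0" using Cc_support[OF kc] by blast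
  \<comment> \<open>The first bound controls \<open>\<zeta> k - k\<close>, the second the term with
    the gradient of \<open>\<zeta>\<close>.\<close>
  define \<eta> where "\<eta> = min (d / (?n k + 1)) (d / (2 * c))"
  have nk: "?n k \<ge> 0" by (rule Lnorm_nonneg)
  have \<eta>: "\<eta> > 0" "\<eta> * ?n k \<le> d" "2 * c * \<eta> \<le> d"
  proof -
    have "\<eta> * ?n k \<le> d / (?n k + 1) * (?n k + 1)"
      using nk d(1) by (intro mult_mono) (auto simp: \<eta>_def)
    then show "\<eta> * ?n k \<le> d" using nk by simp
    show "\<eta> > 0" using d c nk by (simp add: \<eta>_def)
    have "2 * c * \<eta> \<le> 2 * c * (d / (2 * c))" using c by (intro mult_left_mono) (auto simp: \<eta>_def)
    then show "2 * c * \<eta> \<le> d" using c by simp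
  qed
  obtain \<zeta> :: "real^'m \<Rightarrow> real" where \<zeta>: "\<And>n. Ck n \<zeta>" "\<And>x. 0 \<le> \<zeta> x" "\<And>x. \<zeta> x \<le> 1"
    "(\<zeta> \<longlongrightarrow> 0) at_infinity" "\<And>x. norm x \<le> R \<Longrightarrow> 1 - \<zeta> x \<le> \<eta>"
    "(\<lambda>x. norm (grad \<zeta> x)) \<in> ?L" "?n (\<lambda>x. norm (grad \<zeta> x)) < \<eta>"
    by (rule slowly_decaying_cutoff[OF m \<eta>(1), of R]) (rule that)
  have \<zeta>c: "continuous_on UNIV \<zeta>" using \<zeta>(1)[of 0] by simp
  have \<zeta>d: "\<zeta> differentiable (at x)" for x using \<zeta>(1)[of 1] by simp
  have g\<zeta>c: "continuous_on UNIV (grad \<zeta>)"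
  proof -
    have "continuous_on UNIV (partial i \<zeta>)" for i using \<zeta>(1)[of 1] by simp
    then show ?thesis unfolding grad_def[abs_def] by (intro continuous_on_vec_lambda)
  qed
  define l where "l x = grad \<zeta> x \<bullet> u x" for x
  have lc: "continuous_on UNIV l" unfolding l_def by (intro continuous_on_inner g\<zeta>c u)
  have lm: "l \<in> borel_measurable lebesgue"
    using borel_measurable_continuous_onI[OF lc] by (simp add: measurable_completion)
  have lle: "\<bar>l x\<bar> \<le> 2 * c * \<bar>norm (grad \<zeta> x)\<bar>" for x
  proof -
    have "\<bar>l x\<bar> \<le> norm (grad \<zeta> x) * norm (u x)" unfolding l_def by (rule Cauchy_Schwarz_ineq2)
    also have "\<dots> \<le> norm (grad \<zeta> x) * (2 * c)" by (intro mult_left_mono u) simp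
    finally show ?thesis by (simp add: mult.commute)
  qed
  have c2: "2 * c \<ge> 0" using c by simp
  note l = Lspace_dominated[OF lm \<zeta>(6) mp c2 lle]
  have ln: "?n l \<le> d"
  proof -
    have "?n l \<le> 2 * c * \<eta>"
      by (rule order_trans[OF l(2)]) (use \<zeta>(7) c in auto)
    then show ?thesis using \<eta>(3) by linarith
  qed
  define h where "h x = \<zeta> x * k x" for x
  have hc: "Cc h" unfolding h_def[abs_def] by (rule Cc_mult2[OF kc \<zeta>c])
  note hL = Cc_Lspace[OF hc mp]
  have hk: "?n (\<lambda>x. h x - k x) \<le> d"
  proof -
    have "(\<lambda>x. h x - k x) \<in> borel_measurable lebesgue"
      using Lspace_diff[OF hL kL mp] by (simp add: Lspace_def)
    moreover have "\<bar>h x - k x\<bar> \<le> \<eta> * \<bar>k x\<bar>" for x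
    proof (cases "norm x \<le> R")
      case True
      have "h x - k x = - ((1 - \<zeta> x) * k x)" by (simp add: h_def left_diff_distrib)
      then have "\<bar>h x - k x\<bar> = (1 - \<zeta> x) * \<bar>k x\<bar>"
        using \<zeta>(3)[of x] by (simp only: abs_minus_cancel abs_mult)
      then show ?thesis using \<zeta>(5)[OF True] by (simp add: mult_right_mono)
    qed (use R in \<open>simp add: h_def\<close>)
    ultimately have "?n (\<lambda>x. h x - k x) \<le> \<eta> * ?n k"
      using \<eta>(1) by (intro Lspace_dominated(2)[OF _ kL mp]) auto
    then show ?thesis using \<eta>(2) by linarith
  qed
  define v where "v x = \<zeta> x *\<^sub>R u x" for x
  have vc: "continuous_on UNIV v" unfolding v_def by (intro continuous_on_scaleR \<zeta>c u)
  have v_le: "norm (v x) \<le> \<zeta> x * (2 * c)" for x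
    unfolding v_def norm_scaleR using \<zeta>(2)[of x] u(2)[of x] by (simp add: mult_left_mono)
  define g where "g x = h x + 1 * l x" for x
  show ?thesis
  proof (rule that[of v g])
    show "norm (v x) \<le> 2 * c" for x
      using v_le[of x] mult_right_mono[OF \<zeta>(3)[of x] c2] by simp
    have "(v \<longlongrightarrow> 0) at_infinity"
    proof (rule Lim_null_comparison)
      show "\<forall>\<^sub>F x in at_infinity. norm (v x) \<le> \<zeta> x * (2 * c)" using v_le by (intro always_eventually) blast
      show "((\<lambda>x. \<zeta> x * (2 * c)) \<longlongrightarrow> 0) at_infinity" by (rule tendsto_mult_left_zero[OF \<zeta>(4)])
    qed
    then show "v \<in> C0_fields" using vc by (simp add: C0_fields_def)
    show "g \<in> ?L" unfolding g_def[abs_def] by (intro Lspace_add Lspace_cmult hL l mp)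
    fix \<phi> :: "real^'m \<Rightarrow> real" assume \<phi>: "\<phi> \<in> test_functions"
    note \<zeta>\<phi> = test_mult[OF \<phi> \<zeta>(1)]
    have split: "pairing \<phi> g = pairing \<phi> h + pairing \<phi> l"
      unfolding g_def using pairing_lin_right[OF m hL l(1) \<phi>, of 1] by simp
    show "distr_div v \<phi> = pairing \<phi> g"
    proof -
      \<comment> \<open>Product rule: \<open>u\<close> is tested on \<open>\<zeta> \<phi>\<close>,
        which has compact support even though \<open>\<zeta>\<close> does not.\<close>
      have "grad \<phi> x \<bullet> v x = grad (\<lambda>x. \<zeta> x * \<phi> x) x \<bullet> u x - \<phi> x * l x" for x
        by (simp add: grad_mult[OF \<zeta>d test_differentiable[OF \<phi>]] v_def l_def inner_add_left)
      then have "(LINT x|lborel. grad \<phi> x \<bullet> v x) = (LINT x|lborel. grad (\<lambda>x. \<zeta> x * \<phi> x) x \<bullet> u x - \<phi> x * l x)"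
        by simp
      also have "\<dots> = (LINT x|lborel. grad (\<lambda>x. \<zeta> x * \<phi> x) x \<bullet> u x) - (LINT x|lborel. \<phi> x * l x)"
        by (intro Bochner_Integration.integral_diff Cc_integrable distr_div_Cc[OF \<zeta>\<phi> u(1)] Cc_mult1 test_Cc[OF \<phi>] lc)
      also have "(LINT x|lborel. grad (\<lambda>x. \<zeta> x * \<phi> x) x \<bullet> u x) = - (LINT x|lborel. \<zeta> x * \<phi> x * k x)"
        using u(3)[OF \<zeta>\<phi>, folded k_def] distr_div_eq[OF \<zeta>\<phi> u(1)] by simp
      also have "(LINT x|lborel. \<zeta> x * \<phi> x * k x) = (LINT x|lborel. \<phi> x * h x)"
        by (simp add: h_def mult_ac)
      finally show ?thesis
        unfolding split distr_div_eq[OF \<phi> vc] leb[OF \<phi> lc] leb[OF \<phi> Cc_continuous[OF hc]] by simp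
    qed
    have 1: "\<bar>pairing \<phi> h - pairing \<phi> k\<bar> \<le> d * Lnorm 1 (grad \<phi>)"
      by (rule pair_close[OF \<phi> hL kL hk])
    have 2: "\<bar>pairing \<phi> k - pairing \<phi> f\<bar> \<le> d * Lnorm 1 (grad \<phi>)"
      using fk by (intro pair_close[OF \<phi> kL fL]) (simp add: k_def)
    have 3: "\<bar>pairing \<phi> l\<bar> \<le> d * Lnorm 1 (grad \<phi>)"
      by (rule order_trans[OF pairing_bound(2)[OF m test_Cc1[OF \<phi>] l(1)]])
         (intro mult_right_mono ln Lnorm_nonneg)
    have "8 * d * Lnorm 1 (grad \<phi>) \<le> \<delta> * Lnorm 1 (grad \<phi>)" by (intro mult_right_mono d Lnorm_nonneg)
    moreover have "0 \<le> d * Lnorm 1 (grad \<phi>)" using d(1) by (intro mult_nonneg_nonneg Lnorm_nonneg) simp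
    ultimately show "\<bar>T \<phi> - pairing \<phi> g\<bar> \<le> \<delta> * Lnorm 1 (grad \<phi>)"
      unfolding split using Tf[OF \<phi>] 1 2 3 by linarith
  qed
qed

lemma distr_div_sum:
  assumes \<phi>: "\<phi> \<in> test_functions" and v: "\<And>i. i \<in> I \<Longrightarrow> continuous_on UNIV (v i)"
  shows "distr_div (\<lambda>x. \<Sum>i\<in>I. v i x) \<phi> = (\<Sum>i\<in>I. distr_div (v i) \<phi>)"
  unfolding distr_div_def inner_sum_right
  by (subst Bochner_Integration.integral_sum)
     (auto intro!: Cc_integrable_lebesgue distr_div_Cc[OF \<phi>] v simp: sum_negf)

lemma approximable_imp_C0_divergence:
  fixes T :: "(real^'m \<Rightarrow> real) \<Rightarrow> real"
  assumes m: "CARD('m) \<ge> 2" and T: "approximable T"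
  shows "is_C0_divergence T"
proof -
  obtain f where f: "f \<in> Lspace (real CARD('m))"
    "\<forall>\<phi>\<in>test_functions. \<bar>T \<phi> - pairing \<phi> f\<bar> \<le> 1 * Lnorm 1 (grad \<phi>)"
    using T zero_less_one unfolding approximable_def by blast
  \<comment> \<open>Being approximable already implies a bound: 1 from the approximation error, the
    norm of \<open>f\<close> from \<open>pairing_bound\<close>.\<close>
  define c where "c = 1 + Lnorm (real CARD('m)) f"
  have c: "c > 0" using Lnorm_nonneg[of "real CARD('m)" f] by (simp add: c_def)
  have Tc: "\<bar>T \<phi>\<bar> \<le> c * Lnorm 1 (grad \<phi>)" if \<phi>: "\<phi> \<in> test_functions" for \<phi>
    using bspec[OF f(2) \<phi>] pairing_bound(2)[OF m test_Cc1[OF \<phi>] f(1)]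
    unfolding c_def distrib_right by linarith
  \<comment> \<open>The state pairs the remaining functional with the field just subtracted to reach
    it; the field at index 0 is a dummy.\<close>
  define P :: "nat \<Rightarrow> (real^'m \<Rightarrow> real^'m) \<times> ((real^'m \<Rightarrow> real) \<Rightarrow> real) \<Rightarrow> bool" where
    "P n vS \<longleftrightarrow> approximable (snd vS) \<and> (\<forall>\<phi>\<in>test_functions. \<bar>snd vS \<phi>\<bar> \<le> c / 2 ^ n * Lnorm 1 (grad \<phi>)) \<and> (n = 0 \<longrightarrow> snd vS = T)" for n vS
  define Q :: "nat \<Rightarrow> (real^'m \<Rightarrow> real^'m) \<times> ((real^'m \<Rightarrow> real) \<Rightarrow> real) \<Rightarrow> (real^'m \<Rightarrow> real^'m) \<times> ((real^'m \<Rightarrow> real) \<Rightarrow> real) \<Rightarrow> bool" where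
    "Q n vS wU \<longleftrightarrow> fst wU \<in> C0_fields \<and> (\<forall>x. norm (fst wU x) \<le> 2 * (c / 2 ^ n)) \<and>
      (\<forall>\<phi>\<in>test_functions. snd wU \<phi> = snd vS \<phi> - distr_div (fst wU) \<phi>)" for n vS wU
  have "\<exists>F. \<forall>n. P n (F n) \<and> Q n (F n) (F (Suc n))"
  proof (rule dependent_nat_choice)
    show "\<exists>vS. P 0 vS" by (rule exI[of _ "(\<lambda>x. 0, T)"]) (simp add: P_def T Tc)
    fix vS n assume vS: "P n vS"
    have S: "approximable (snd vS)" "\<And>\<phi>. \<phi> \<in> test_functions \<Longrightarrow> \<bar>snd vS \<phi>\<bar> \<le> c / 2 ^ n * Lnorm 1 (grad \<phi>)"
      using vS by (auto simp: P_def)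
    have c1: "c / 2 ^ n > 0" and c2: "c / 2 ^ Suc n > 0" using c by simp_all
    obtain v g where v: "v \<in> C0_fields" "\<And>x. norm (v x) \<le> 2 * (c / 2 ^ n)"
      and g: "g \<in> Lspace (real CARD('m))"
      and e: "\<And>\<phi>. \<phi> \<in> test_functions \<Longrightarrow> distr_div v \<phi> = pairing \<phi> g"
      and d: "\<And>\<phi>. \<phi> \<in> test_functions \<Longrightarrow>
        \<bar>snd vS \<phi> - pairing \<phi> g\<bar> \<le> c / 2 ^ Suc n * Lnorm 1 (grad \<phi>)"
      by (rule approximable_by_C0_divergence[OF m S(1) c1 c2 S(2)]) (assumption, rule that)
    define U where "U \<phi> = snd vS \<phi> - distr_div v \<phi>" for \<phi>
    have "approximable U" by (rule approximable_minus_pairing[OF m S(1) g]) (simp add: U_def e)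
    then have "P (Suc n) (v, U) \<and> Q n vS (v, U)"
      using v d by (simp add: P_def Q_def U_def e del: power_Suc)
    then show "\<exists>wU. P (Suc n) wU \<and> Q n vS wU" by blast
  qed
  then obtain F where F: "\<And>n. P n (F n)" "\<And>n. Q n (F n) (F (Suc n))" by blast
  define S where "S n = snd (F n)" for n
  \<comment> \<open>Shifted by one, since the correction made at step \<open>n\<close> is stored in
    the next state.\<close>
  define v where "v n = fst (F (Suc n))" for n
  have S: "\<bar>S n \<phi>\<bar> \<le> c / 2 ^ n * Lnorm 1 (grad \<phi>)" if "\<phi> \<in> test_functions" for n \<phi>
    using F(1)[of n] that by (simp add: P_def S_def)
  have S0: "S 0 = T" using F(1)[of 0] by (simp add: P_def S_def)
  have v: "v n \<in> C0_fields" "\<And>x. norm (v n x) \<le> 2 * c * (1 / 2) ^ n" for n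
    using F(2)[of n] by (simp_all add: Q_def v_def power_one_over)
  have vc: "continuous_on UNIV (v n)" and v0: "(v n \<longlongrightarrow> 0) at_infinity" for n
    using v(1)[of n] by (simp_all add: C0_fields_def)
  have SSuc: "S (Suc n) \<phi> = S n \<phi> - distr_div (v n) \<phi>" if "\<phi> \<in> test_functions" for n \<phi>
    using F(2)[of n] that by (simp add: Q_def S_def v_def)
  define w where "w n x = (\<Sum>i<n. v i x)" for n x
  define V where "V x = (\<Sum>i. v i x)" for x
  have wc: "continuous_on UNIV (w n)" for n unfolding w_def by (intro continuous_on_sum vc)
  have w0: "(w n \<longlongrightarrow> 0) at_infinity" for n
    unfolding w_def using tendsto_sum[of "{..<n}" v "\<lambda>_. 0" at_infinity] v0 by simp
  have ul: "uniform_limit UNIV w V sequentially"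
    unfolding w_def[abs_def] V_def[abs_def]
    by (rule Weierstrass_m_test[OF v(2)]) (auto intro!: summable_mult summable_geometric)
  have close: "\<exists>n0. \<forall>n\<ge>n0. \<forall>x. norm (w n x - V x) < e" if "e > 0" for e
    using uniform_limitD[OF ul that] by (auto simp: eventually_sequentially dist_norm)
  have Vc: "continuous_on UNIV V"
    by (rule uniform_limit_theorem[OF _ ul]) (auto intro: always_eventually wc)
  have V0: "(V \<longlongrightarrow> 0) at_infinity"
  proof (rule tendstoI)
    fix e :: real assume e: "e > 0"
    obtain n where n: "\<And>x. norm (w n x - V x) < e / 2" using close[of "e / 2"] e by auto
    have "\<forall>\<^sub>F x in at_infinity. dist (w n x) 0 < e / 2" using w0 e by (intro tendstoD) auto
    then show "\<forall>\<^sub>F x in at_infinity. dist (V x) 0 < e"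
    proof eventually_elim
      case (elim x)
      have "norm (V x) \<le> norm (w n x) + norm (w n x - V x)"
        using norm_triangle_ineq4[of "w n x" "w n x - V x"] by simp
      then show ?case using elim n[of x] by simp
    qed
  qed
  have "T \<phi> = distr_div V \<phi>" if \<phi>: "\<phi> \<in> test_functions" for \<phi>
  proof -
    \<comment> \<open>The corrections telescope; it remains to let \<open>n\<close> tend to infinity
      on both sides, using decay of \<open>S n\<close> and uniform convergence of the
      fields.\<close>
    have eq: "T \<phi> - S n \<phi> = distr_div (w n) \<phi>" for n
    proof -
      have "T \<phi> - S n \<phi> = (\<Sum>i<n. distr_div (v i) \<phi>)"
        by (induction n) (simp_all add: S0 SSuc[OF \<phi>])
      then show ?thesis unfolding w_def[abs_def] by (simp add: distr_div_sum[OF \<phi> vc])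
    qed
    have "(\<lambda>n. S n \<phi>) \<longlonglongrightarrow> 0"
    proof (rule Lim_null_comparison)
      show "\<forall>\<^sub>F n in sequentially. norm (S n \<phi>) \<le> c * Lnorm 1 (grad \<phi>) * (1 / 2) ^ n"
        using S[OF \<phi>] by (intro always_eventually) (simp add: power_one_over)
      show "(\<lambda>n. c * Lnorm 1 (grad \<phi>) * (1 / 2) ^ n) \<longlonglongrightarrow> 0"
        by (intro tendsto_mult_right_zero LIMSEQ_realpow_zero) auto
    qed
    then have "(\<lambda>n. T \<phi> - S n \<phi>) \<longlonglongrightarrow> T \<phi> - 0" by (intro tendsto_intros)
    then have 1: "(\<lambda>n. distr_div (w n) \<phi>) \<longlonglongrightarrow> T \<phi>" by (simp add: eq)
    have 2: "(\<lambda>n. distr_div (w n) \<phi>) \<longlonglongrightarrow> distr_div V \<phi>"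
    proof (rule LIMSEQ_I)
      fix r :: real assume r: "r > 0"
      define K where "K = Lnorm 1 (grad \<phi>)"
      have K: "K \<ge> 0" unfolding K_def by (rule Lnorm_nonneg)
      obtain n0 where n0: "\<And>n x. n \<ge> n0 \<Longrightarrow> norm (w n x - V x) < r / (K + 1)"
        using close[of "r / (K + 1)"] r K by auto
      have "norm (distr_div (w n) \<phi> - distr_div V \<phi>) < r" if "n \<ge> n0" for n
      proof -
        have "\<bar>distr_div (w n) \<phi> - distr_div V \<phi>\<bar> \<le> r / (K + 1) * K"
          unfolding K_def
          by (rule distr_div_close[OF \<phi> wc Vc]) (use n0[OF that] in \<open>auto simp: K_def intro: less_imp_le\<close>)
        also have "\<dots> < r" using r K by (simp add: field_simps)
        finally show ?thesis by simp
      qed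
      then show "\<exists>n0. \<forall>n\<ge>n0. norm (distr_div (w n) \<phi> - distr_div V \<phi>) < r" by blast
    qed
    show ?thesis by (rule LIMSEQ_unique[OF 1 2])
  qed
  then show ?thesis unfolding is_C0_divergence_def using Vc V0 by (auto simp: C0_fields_def)
qed

theorem mainTheorem16:
  fixes T :: "(real^'m \<Rightarrow> real) \<Rightarrow> real"
  assumes "CARD('m) \<ge> 2"
    and "linear_functional T"
  shows "(is_C0_divergence T \<longleftrightarrow> single_function_bound T) \<and>
         (single_function_bound T \<longleftrightarrow> finite_family_bound T) \<and>
         (finite_family_bound T \<longleftrightarrow> sequentially_continuous T)"
proof -
  have "is_C0_divergence T \<longleftrightarrow> approximable T"
    using C0_divergence_imp_approximable approximable_imp_C0_divergence assms(1) by blast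
  moreover have "approximable T \<longleftrightarrow> finite_sum_bound T"
    "single_function_bound T \<longleftrightarrow> finite_sum_bound T"
    using approximable_imp_single_function_bound[of T] single_function_bound_imp_finite_sum_bound[of T]
      finite_sum_bound_imp_approximable[OF assms] by blast+
  moreover have "finite_family_bound T \<longleftrightarrow> finite_sum_bound T"
    using finite_family_bound_imp_finite_sum_bound finite_sum_bound_imp_finite_family_bound assms(1) by blast
  moreover have "sequentially_continuous T \<longleftrightarrow> finite_sum_bound T"
    using finite_sum_bound_imp_sequentially_continuous
      sequentially_continuous_imp_finite_sum_bound[OF assms] by blast
  ultimately show ?thesis by blast
qed

end
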